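(* Let $R>0$ and let $\psi\in L^2(\mathbb{R}^3,\mathbb{C}^4)$, $\psi\neq0$, be a Dirac wavefunction localized in the ball $B_R=\{x\in\mathbb{R}^3:|x|\le R\}$. Then for every unit vector $e\in\mathbb{R}^3$ $$e(\psi_t)=e(\psi_{2R})+2R-t\quad\text{for all } t\ge2R,\qquad e(\psi_t)=e(\psi_{-2R})+2R+t\quad\text{for all } t\le-2R.$$
   Context: Fix a mass $m>0$ and Dirac matrices $\alpha_1,\alpha_2,\alpha_3,\beta$: Hermitian $4\times4$ complex matrices with $\alpha_j\alpha_k+\alpha_k\alpha_j=2\delta_{jk}I_4$, $\alpha_k\beta+\beta\alpha_k=0$, $\beta^2=I_4$. The free Dirac operator is the self-adjoint operator $H=\sum_{k=1}^3\alpha_k\frac{1}{\mathrm{i}}\partial_k+\beta m$ in $L^2(\mathbb{R}^3,\mathbb{C}^4)$ (equivalently $H=\mathcal{F}^{-1}h\mathcal{F}$, where $\mathcal{F}$ is the unitary Fourier transform and $h$ denotes multiplication by $h(p)=\sum_k\alpha_kp_k+\beta m$). A Dirac wavefunction is an element of $L^2(\mathbb{R}^3,\mathbb{C}^4)$. For a Dirac wavefunction $\psi$ and $t\in\mathbb{R}$ put $\psi_t:=\mathrm{e}^{\mathrm{i}tH}\psi$. The wavefunction $\psi$ is localized in a measurable set $\Delta\subset\mathbb{R}^3$ if $1_\Delta\psi=\psi$ a.e. For $x,y\in\mathbb{R}^3$, $xy:=\sum_kx_ky_k$. For a unit vector $e\in\mathbb{R}^3$ and $\psi\neq0$, $e(\psi)\in[-\infty,\infty]$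 denotes the maximal $\alpha\in[-\infty,\infty]$ such that $1_{\{x\in\mathbb{R}^3:\,xe\le\alpha\}}\psi=0$ a.e. *)

theory Defs
  imports "HOL-Analysis.Analysis"
begin

subsection \<open>Square-integrable functions and the Fourier transform\<close>

text \<open>Elements of \<open>L\<^sup>2(\<real>\<^sup>3, \<complex>\<^sup>4)\<close> are represented by functions; everything below
  depends on them only up to equality almost everywhere.\<close>

definition square_integrable :: "(real^3 \<Rightarrow> complex^4) \<Rightarrow> bool" where
  "square_integrable f \<longleftrightarrow>
     f \<in> borel_measurable lebesgue \<and> integrable lebesgue (\<lambda>x. (norm (f x))\<^sup>2)"

text \<open>The distance is measured by the nonnegative integral, because the Bochner integral of a
  function that is not integrable is 0. The limit is determined up to a null set.\<close>

definition L2_limit :: "(nat \<Rightarrow> real^3 \<Rightarrow> complex^4) \<Rightarrow> real^3 \<Rightarrow> complex^4" where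
  "L2_limit F = (SOME g. square_integrable g \<and>
     (\<lambda>n. \<integral>\<^sup>+ p. ennreal ((norm (F n p - g p))\<^sup>2) \<partial>lebesgue) \<longlonglongrightarrow> 0)"

text \<open>The unitary Fourier transform and its inverse: square-integrable functions need not be
  integrable, so the integrals are taken over balls and the limit in \<open>L\<^sup>2\<close> is formed. With
  the sign chosen here, \<open>-\<i> \<partial>\<^sub>k\<close> becomes multiplication by \<open>p\<^sub>k\<close>.\<close>

definition fourier :: "(real^3 \<Rightarrow> complex^4) \<Rightarrow> real^3 \<Rightarrow> complex^4" where
  "fourier f = L2_limit (\<lambda>n p. (2 * pi) powr (-3/2) *\<^sub>R
     set_lebesgue_integral lebesgue (cball 0 (real n))
       (\<lambda>x. exp (- \<i> * complex_of_real (p \<bullet> x)) *s f x))"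

definition inv_fourier :: "(real^3 \<Rightarrow> complex^4) \<Rightarrow> real^3 \<Rightarrow> complex^4" where
  "inv_fourier g = L2_limit (\<lambda>n x. (2 * pi) powr (-3/2) *\<^sub>R
     set_lebesgue_integral lebesgue (cball 0 (real n))
       (\<lambda>p. exp (\<i> * complex_of_real (p \<bullet> x)) *s g p))"

subsection \<open>The free Dirac evolution\<close>

definition hermitian :: "complex^'n^'n \<Rightarrow> bool" where
  "hermitian A \<longleftrightarrow> (\<forall>i j. A $ i $ j = cnj (A $ j $ i))"

definition dirac_matrices :: "(3 \<Rightarrow> complex^4^4) \<Rightarrow> complex^4^4 \<Rightarrow> bool" where
  "dirac_matrices \<alpha> \<beta> \<longleftrightarrow>
     (\<forall>k. hermitian (\<alpha> k)) \<and> hermitian \<beta> \<and>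
     (\<forall>j k. \<alpha> j ** \<alpha> k + \<alpha> k ** \<alpha> j = (if j = k then mat 2 else 0)) \<and>
     (\<forall>k. \<alpha> k ** \<beta> + \<beta> ** \<alpha> k = 0) \<and>
     \<beta> ** \<beta> = mat 1"

definition dirac_symbol ::
  "(3 \<Rightarrow> complex^4^4) \<Rightarrow> complex^4^4 \<Rightarrow> real \<Rightarrow> real^3 \<Rightarrow> complex^4^4" where
  "dirac_symbol \<alpha> \<beta> m p = (\<Sum>k\<in>UNIV. (p $ k) *\<^sub>R \<alpha> k) + m *\<^sub>R \<beta>"

definition matrix_exp :: "complex^'n^'n \<Rightarrow> complex^'n^'n" where
  "matrix_exp A = (\<Sum>n. (1 / fact n) *\<^sub>R (((**) A ^^ n) (mat 1)))"

text \<open>The Fourier transform \<open>F\<close> turns the Dirac operator \<open>H = F\<^sup>-\<^sup>1 h F\<close> into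
  multiplication by the Hermitian matrices \<open>h(p)\<close>, so the functional calculus gives
  \<open>exp(\<i>tH) = F\<^sup>-\<^sup>1 exp(\<i>th) F\<close>. Multiplying by the matrix \<open>mat c\<close> multiplies by the
  scalar \<open>c\<close>.\<close>

definition dirac_evolution ::
  "(3 \<Rightarrow> complex^4^4) \<Rightarrow> complex^4^4 \<Rightarrow> real \<Rightarrow> real \<Rightarrow>
   (real^3 \<Rightarrow> complex^4) \<Rightarrow> real^3 \<Rightarrow> complex^4" where
  "dirac_evolution \<alpha> \<beta> m t \<psi> = inv_fourier (\<lambda>p.
     matrix_exp (mat (\<i> * complex_of_real t) ** dirac_symbol \<alpha> \<beta> m p) *v fourier \<psi> p)"

subsection \<open>Localization\<close>

definition localized_in :: "(real^3 \<Rightarrow> complex^4) \<Rightarrow> (real^3) set \<Rightarrow> bool" where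
  "localized_in \<psi> \<Delta> \<longleftrightarrow> (AE x in lebesgue. indicat_real \<Delta> x *\<^sub>R \<psi> x = \<psi> x)"

definition support_edge :: "real^3 \<Rightarrow> (real^3 \<Rightarrow> complex^4) \<Rightarrow> ereal" where
  "support_edge e \<psi> = (GREATEST a :: ereal.
     AE x in lebesgue. indicat_real {x. ereal (x \<bullet> e) \<le> a} x *\<^sub>R \<psi> x = 0)"

end

(*
  Fix a unit vector e and continue the Fourier transform of psi_t analytically along the complex
  lines p + w e, with p orthogonal to e. By a Paley-Wiener argument psi_t vanishes for x e <= a iff
  the continuation is O(exp(a Im w)) in the lower half plane. There exp(i t h) acts as exp(i t E)
  and exp(-i t E) on two components of the transform Phi of psi, where E is the square root of
  h^2 = w^2 + |p|^2 + m^2 with Im E < 0; |exp(i t E)| is comparable to exp(-t Im w).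
  Suppose psi_t vanishes for x e <= a and put b = a + t, t >= 0. Then the first component of Phi is
  O(exp(b Im w)); the second is always O(exp(-R Im w)).
  If b <= 3 R, then for every t' >= 2 R the second component contributes O(exp((t' - R) Im w)) to
  psi_t', which is within O(exp((b - t') Im w)), so psi_t' vanishes for x e <= b - t'.
  If b > 3 R, then the entire function N = h^2 Phi_i^2 - (h Phi)_i^2, essentially the product of the
  two components, makes exp(2 i R w) N polynomially bounded and decaying along the negative imaginary axis, so N = 0; as
  h^2 has simple zeros in w (here m > 0 enters), Phi_i = 0.
  In either case the vanishing for t >= 2 R depends on a + t only.
*)

theory Submission
  imports Defs "HOL-Complex_Analysis.Complex_Analysis" "HOL-Probability.Sinc_Integral" "HOL-Real_Asymp.Real_Asymp"
begin

section \<open>Holomorphic parameter integrals and Gaussians\<close>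

text \<open>The root E has no holomorphic choice on the whole w-plane. So the continuation is
  written with cos(sqrt y) and sin(sqrt y)/sqrt y, which are entire, and E is chosen anew at every
  single point, only to estimate; N is safe because replacing E by -E swaps its two factors. The
  number 3 R is the balance for N: above the real axis N grows at most like exp(2 R Im w), far below
  it is O(exp((b - R) Im w)); the factor exp(2 i R w) cancels the first and leaves exp((b - 3 R) Im
  w) of the second. The bound t' \<ge> 2 R makes b \<le> 3 R imply b - t' \<le> t' - R. The two
  roots separate only where -Im w is large compared with sqrt(|p|^2 + m^2), so the estimates lose a
  factor exponential in |p|. The Paley-Wiener criterion has to admit this loss; a Gaussian in the
  orthogonal momentum absorbs it. The converse of the criterion needs psi_t integrable. This follows
  from bounded support, which is the criterion itself applied with an a priori bound to the six
  directions along the axes. Negative times are reached by changing the sign of H.\<close>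

lemma holomorphic_on_param_integral:
  fixes f :: "'x \<Rightarrow> complex \<Rightarrow> complex"
  assumes "open U"
    and hol: "\<And>x. f x holomorphic_on U"
    and meas: "\<And>z. z \<in> U \<Longrightarrow> (\<lambda>x. f x z) \<in> borel_measurable M"
    and dom: "\<And>z. z \<in> U \<Longrightarrow> \<exists>r>0. \<exists>B. integrable M B \<and> ball z r \<subseteq> U \<and>
      (\<forall>x. \<forall>w\<in>ball z r. norm (f x w) \<le> B x)"
  shows "(\<lambda>z. \<integral>x. f x z \<partial>M) holomorphic_on U"
proof (rule holomorphic_onI)
  fix z assume z: "z \<in> U"
  obtain r B where r: "r > 0" and B: "integrable M B" and sub: "ball z r \<subseteq> U"
    and bd: "\<And>x w. w \<in> ball z r \<Longrightarrow> norm (f x w) \<le> B x"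
    using dom[OF z] by blast
  \<comment> \<open>Halving the radius leaves room for Cauchy discs of radius r/4 around every point
    of S. They turn the bound on f into the bound 4 B/r on its derivative, which then dominates the
    difference quotients.\<close>
  define S where "S = ball z (r/2)"
  have zS: "z \<in> S" and oS: "open S" and SU: "S \<subseteq> U" and Sr: "S \<subseteq> ball z r"
    using r sub by (auto simp: S_def)
  have derb: "norm (deriv (f x) w) \<le> 4 * B x / r" if w: "w \<in> S" for x w
  proof -
    have cb: "cball w (r/4) \<subseteq> ball z r"
    proof
      fix y assume "y \<in> cball w (r/4)"
      then have "dist z y < r/2 + r/2"
        using w r dist_triangle[of z y w] by (auto simp: S_def)
      then show "y \<in> ball z r" by auto
    qed
    have "norm ((deriv ^^ 1) (f x) w) \<le> fact 1 * B x / (r/4)^1"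
    proof (rule Cauchy_inequality)
      show "f x holomorphic_on ball w (r/4)"
        using hol cb sub by (meson ball_subset_cball holomorphic_on_subset subset_trans)
      show "continuous_on (cball w (r/4)) (f x)"
        using hol cb sub by (meson holomorphic_on_imp_continuous_on holomorphic_on_subset subset_trans)
      show "norm (f x y) \<le> B x" if "norm (w - y) = r/4" for y
        using that cb by (intro bd) (auto simp: dist_norm subset_iff)
    qed (use r in auto)
    then show ?thesis by (simp add: field_simps)
  qed
  have lip: "norm (f x w - f x z) \<le> 4 * B x / r * norm (w - z)" if w: "w \<in> S" for x w
  proof (rule field_differentiable_bound[of S "f x" "deriv (f x)"])
    show "convex S" by (simp add: S_def)
    show "(f x has_field_derivative deriv (f x) v) (at v within S)" if "v \<in> S" for v
      using hol[of x] that SU \<open>open U\<close> by (meson DERIV_subset holomorphic_derivI subset_iff has_field_derivative_at_within)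
  qed (use derb w zS in auto)
  have quot: "(\<lambda>n. \<integral>x. (f x (X n) - f x z) / (X n - z) \<partial>M) \<longlonglongrightarrow> (\<integral>x. deriv (f x) z \<partial>M)"
    if X: "\<And>n. X n \<in> S - {z}" "X \<longlonglongrightarrow> z" for X
  proof (rule integral_dominated_convergence)
    have lim: "(\<lambda>n. (f x (X n) - f x z) / (X n - z)) \<longlonglongrightarrow> deriv (f x) z" for x
    proof -
      have "(f x has_field_derivative deriv (f x) z) (at z)"
        by (rule holomorphic_derivI[OF hol \<open>open U\<close> z])
      then have "((\<lambda>w. (f x w - f x z) / (w - z)) \<longlongrightarrow> deriv (f x) z) (at z)"
        by (simp add: has_field_derivative_iff)
      then show ?thesis
        using X unfolding tendsto_at_iff_sequentially by (force simp: o_def)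
    qed
    show "AE x in M. (\<lambda>n. (f x (X n) - f x z) / (X n - z)) \<longlonglongrightarrow> deriv (f x) z"
      using lim by simp
    show m: "(\<lambda>x. (f x (X n) - f x z) / (X n - z)) \<in> borel_measurable M" for n
      using X(1)[of n] SU z meas by (intro borel_measurable_divide borel_measurable_diff) auto
    show "(\<lambda>x. deriv (f x) z) \<in> borel_measurable M"
      using m lim by (rule borel_measurable_LIMSEQ_metric)
    show "integrable M (\<lambda>x. 4 * B x / r)" using B by auto
    show "AE x in M. norm ((f x (X n) - f x z) / (X n - z)) \<le> 4 * B x / r" for n
      using lip[of "X n"] X(1)[of n] by (auto simp: norm_divide divide_simps)
  qed
  have int: "integrable M (\<lambda>x. f x w)" if "w \<in> S" for w
    using that Sr SU by (intro Bochner_Integration.integrable_bound[OF B] meas) (auto intro!: AE_I2 order_trans[OF bd])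
  have "((\<lambda>w. ((\<integral>x. f x w \<partial>M) - (\<integral>x. f x z \<partial>M)) / (w - z)) \<longlongrightarrow> (\<integral>x. deriv (f x) z \<partial>M)) (at z within S)"
    unfolding tendsto_at_iff_sequentially
  proof (intro allI impI)
    fix X assume X: "\<forall>i. X i \<in> S - {z}" "X \<longlonglongrightarrow> z"
    have "((\<integral>x. f x (X n) \<partial>M) - (\<integral>x. f x z \<partial>M)) / (X n - z) = (\<integral>x. (f x (X n) - f x z) / (X n - z) \<partial>M)" for n
      using X int zS by (simp add: Bochner_Integration.integral_diff)
    then show "((\<lambda>w. ((\<integral>x. f x w \<partial>M) - (\<integral>x. f x z \<partial>M)) / (w - z)) \<circ> X) \<longlonglongrightarrow> (\<integral>x. deriv (f x) z \<partial>M)"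
      using quot[of X] X by (simp add: o_def)
  qed
  then have "((\<lambda>w. \<integral>x. f x w \<partial>M) has_field_derivative (\<integral>x. deriv (f x) z \<partial>M)) (at z)"
    using at_within_open[OF zS oS] by (simp add: has_field_derivative_iff)
  then show "(\<lambda>z. \<integral>x. f x z \<partial>M) field_differentiable at z within U"
    using field_differentiable_def field_differentiable_at_within by blast
qed

section \<open>Integrable weights on Euclidean space\<close>

lemma integrable_prod_inverse_square:
  "integrable lborel (\<lambda>x::'a::euclidean_space. \<Prod>b\<in>Basis. inverse (1 + (x \<bullet> b)\<^sup>2))"
proof (rule integrableI_bounded)
  have 1: "(\<integral>\<^sup>+x. ennreal (inverse (1 + x\<^sup>2)) \<partial>(lborel::real measure)) < \<infinity>"
  proof -
    have "integrable lborel (\<lambda>x::real. inverse (1 + x\<^sup>2))"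
      using integrable_inverse_1_plus_square by (simp add: set_integrable_def)
    then show ?thesis
      by (auto simp: integrable_iff_bounded)
  qed
  have "(\<integral>\<^sup>+x. ennreal (norm (\<Prod>b\<in>Basis. inverse (1 + (x \<bullet> b)\<^sup>2))) \<partial>(lborel::'a measure))
      = (\<integral>\<^sup>+x. (\<Prod>b\<in>Basis. ennreal (inverse (1 + (x \<bullet> b)\<^sup>2))) \<partial>(lborel::'a measure))"
    by (subst prod_ennreal) (auto simp: abs_prod intro!: nn_integral_cong arg_cong[of _ _ ennreal] prod.cong)
  also have "\<dots> = (\<Prod>b\<in>(Basis::'a set). \<integral>\<^sup>+x. ennreal (inverse (1 + x\<^sup>2)) \<partial>lborel)"
    by (rule nn_integral_lborel_prod) auto
  also have "\<dots> < \<infinity>"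
    using 1 by (auto simp: power_less_top_ennreal)
  finally show "(\<integral>\<^sup>+x. ennreal (norm (\<Prod>b\<in>Basis. inverse (1 + (x \<bullet> b)\<^sup>2))) \<partial>(lborel::'a measure)) < \<infinity>" .
qed auto

text \<open>Each of the d factors 1 + (x \<bullet> b)^2 of the integrable product is at most (1 +
  |x|)^2; hence the exponent \<open>2 * DIM('a)\<close>.\<close>

lemma integrable_inverse_power_norm:
  "integrable lborel (\<lambda>x::'a::euclidean_space. inverse ((1 + norm x) ^ (2 * DIM('a))))"
proof (rule Bochner_Integration.integrable_bound[OF integrable_prod_inverse_square])
  have "inverse ((1 + norm x) ^ (2 * DIM('a))) \<le> (\<Prod>b\<in>Basis. inverse (1 + (x \<bullet> b)\<^sup>2))" for x :: 'a
  proof -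
    have "(\<Prod>b\<in>Basis. 1 + (x \<bullet> b)\<^sup>2) \<le> (\<Prod>b\<in>(Basis::'a set). (1 + norm x)\<^sup>2)"
    proof (rule prod_mono, safe)
      fix b :: 'a assume "b \<in> Basis"
      then have "\<bar>x \<bullet> b\<bar> \<le> norm x" by (rule Basis_le_norm)
      then have "(x \<bullet> b)\<^sup>2 \<le> (norm x)\<^sup>2" using abs_le_square_iff[of "x \<bullet> b" "norm x"] by simp
      then show "1 + (x \<bullet> b)\<^sup>2 \<le> (1 + norm x)\<^sup>2"
        by (simp add: power2_sum add_increasing2)
    qed auto
    also have "\<dots> = (1 + norm x) ^ (2 * DIM('a))" by (simp add: power_mult)
    finally have le: "(\<Prod>b\<in>Basis. 1 + (x \<bullet> b)\<^sup>2) \<le> (1 + norm x) ^ (2 * DIM('a))" .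
    have pos: "0 < (\<Prod>b\<in>Basis. 1 + (x \<bullet> b)\<^sup>2)"
      by (rule prod_pos) (simp add: add_pos_nonneg)
    have "(\<Prod>b\<in>Basis. inverse (1 + (x \<bullet> b)\<^sup>2)) = inverse (\<Prod>b\<in>Basis. 1 + (x \<bullet> b)\<^sup>2)"
      using prod_inversef[of "\<lambda>b. 1 + (x \<bullet> b)\<^sup>2" Basis] unfolding o_def .
    then show ?thesis
      using le_imp_inverse_le[OF le pos] by metis
  qed
  then show "AE x in (lborel::'a measure). norm (inverse ((1 + norm x) ^ (2 * DIM('a)))) \<le> norm (\<Prod>b\<in>Basis. inverse (1 + (x \<bullet> b)\<^sup>2))"
    by (intro AE_I2) (simp add: order_trans[OF _ abs_ge_self])
qed auto

section \<open>Gaussians and their transforms\<close>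

definition gauss :: "real \<Rightarrow> 'a::euclidean_space \<Rightarrow> real" where
  "gauss \<epsilon> x = exp (- \<epsilon> * (norm x)\<^sup>2)"

lemma gauss_pos: "gauss \<epsilon> x > 0" by (simp add: gauss_def)
lemma gauss_le_1: "\<epsilon> \<ge> 0 \<Longrightarrow> gauss \<epsilon> x \<le> 1" by (simp add: gauss_def)

lemma borel_measurable_gauss[measurable]: "gauss \<epsilon> \<in> borel_measurable borel"
  unfolding gauss_def by measurable

lemma integrable_gauss:
  assumes "\<epsilon> > 0"
  shows "integrable lborel (gauss \<epsilon> :: 'a::euclidean_space \<Rightarrow> real)"
proof (rule Bochner_Integration.integrable_bound)
  \<comment> \<open>With this c, c (1 + s) \<le> 1 + \<epsilon> s \<le> exp(\<epsilon> s) for s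
    \<ge> 0, so each one-dimensional Gaussian factor is at most 1/(c (1 + s)).\<close>
  define c where "c = min 1 \<epsilon>"
  have c: "c > 0" "c \<le> 1" "c \<le> \<epsilon>" using assms by (auto simp: c_def)
  show "integrable lborel (\<lambda>x::'a. inverse c ^ DIM('a) * (\<Prod>b\<in>Basis. inverse (1 + (x \<bullet> b)\<^sup>2)))"
    using integrable_prod_inverse_square by auto
  have "gauss \<epsilon> x \<le> inverse c ^ DIM('a) * (\<Prod>b\<in>Basis. inverse (1 + (x \<bullet> b)\<^sup>2))" for x :: 'a
  proof -
    have "gauss \<epsilon> x = (\<Prod>b\<in>Basis. exp (- \<epsilon> * (x \<bullet> b)\<^sup>2))"
      by (simp add: gauss_def norm_eq_sqrt_inner euclidean_inner[of x x] sum_nonneg power2_eq_square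
          exp_sum[symmetric] sum_distrib_left sum_negf)
    also have "\<dots> \<le> (\<Prod>b\<in>(Basis::'a set). inverse c * inverse (1 + (x \<bullet> b)\<^sup>2))"
    proof (rule prod_mono, safe)
      fix b :: 'a
      let ?s = "(x \<bullet> b)\<^sup>2"
      have "c * (1 + ?s) \<le> 1 + \<epsilon> * ?s"
        using c by (auto simp: algebra_simps intro!: add_mono mult_right_mono)
      also have "\<dots> \<le> exp (\<epsilon> * ?s)" by (rule exp_ge_add_one_self)
      finally have "inverse (exp (\<epsilon> * ?s)) \<le> inverse (c * (1 + ?s))"
        using c by (intro le_imp_inverse_le mult_pos_pos) (auto intro: add_pos_nonneg)
      then show "exp (- \<epsilon> * ?s) \<le> inverse c * inverse (1 + ?s)" by (simp add: exp_minus)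
    qed auto
    finally show ?thesis by (simp add: prod.distrib)
  qed
  then show "AE x in (lborel::'a measure). norm (gauss \<epsilon> x) \<le> norm (inverse c ^ DIM('a) * (\<Prod>b\<in>Basis. inverse (1 + (x \<bullet> b)\<^sup>2)))"
    by (auto intro!: AE_I2 order_trans[OF _ abs_ge_self] simp: abs_of_pos[OF gauss_pos])
qed auto

lemma borel_measurable_cis[measurable]: "cis \<in> borel_measurable borel"
  by (intro borel_measurable_continuous_onI continuous_intros)

lemma borel_measurable_exp_complex[measurable]: "(exp :: complex \<Rightarrow> complex) \<in> borel_measurable borel"
  by (intro borel_measurable_continuous_onI continuous_intros)

lemma integral_lborel_affine:
  fixes f :: "'a::euclidean_space \<Rightarrow> 'b::{banach, second_countable_topology}"
  assumes "c \<noteq> 0" and f[measurable]: "f \<in> borel_measurable borel"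
  shows "(\<integral>x. f x \<partial>lborel) = \<bar>c\<bar> ^ DIM('a) *\<^sub>R (\<integral>x. f (t + c *\<^sub>R x) \<partial>lborel)"
  by (subst lborel_affine[OF assms(1), of t]) (simp add: integral_density integral_distr)

lemma integral_lborel_translate:
  fixes f :: "'a::euclidean_space \<Rightarrow> 'b::{banach, second_countable_topology}"
  assumes f[measurable]: "f \<in> borel_measurable borel"
  shows "(\<integral>x. f (t + x) \<partial>lborel) = (\<integral>x. f x \<partial>lborel)"
  using integral_lborel_affine[of 1 f t] assms by simp

lemma zero_islimpt_range_of_real: "0 islimpt (range complex_of_real)"
  unfolding islimpt_approachable
proof (intro allI impI)
  fix e :: real assume "e > 0"
  then show "\<exists>x'\<in>range complex_of_real. x' \<noteq> 0 \<and> dist x' 0 < e"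
    by (intro bexI[of _ "complex_of_real (e/2)"] rangeI) (auto simp: norm_divide)
qed

lemma entire_eq_of_eq_on_reals:
  assumes "f holomorphic_on UNIV" "g holomorphic_on UNIV"
    and "\<And>x::real. f (of_real x) = g (of_real x)"
  shows "f z = g z"
proof -
  have "f z - g z = 0"
    by (rule analytic_continuation[of "\<lambda>z. f z - g z", OF _ open_UNIV connected_UNIV subset_UNIV UNIV_I zero_islimpt_range_of_real _ UNIV_I])
      (use assms in \<open>auto intro!: holomorphic_on_diff\<close>)
  then show ?thesis by simp
qed

text \<open>For positive \<epsilon> this is pi/\<epsilon> to the power d/2. What is used of it is
  positivity and the scaling law.\<close>

definition gauss_mass :: "'a::euclidean_space itself \<Rightarrow> real \<Rightarrow> real" where
  "gauss_mass _ \<epsilon> = (\<integral>x. gauss \<epsilon> (x::'a) \<partial>lborel)"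

text \<open>Completing the square: a real exponential weight moves the centre of the Gaussian and
  rescales it.\<close>

lemma gauss_translate:
  fixes v x :: "'a::euclidean_space"
  assumes "\<epsilon> > 0"
  shows "exp (s * (v \<bullet> x)) * gauss \<epsilon> x =
    exp (s\<^sup>2 * (norm v)\<^sup>2 / (4 * \<epsilon>)) * gauss \<epsilon> ((- (s / (2 * \<epsilon>)) *\<^sub>R v) + x)"
proof -
  have n: "(norm ((- (s / (2 * \<epsilon>)) *\<^sub>R v) + x))\<^sup>2 = (s / (2*\<epsilon>))\<^sup>2 * (norm v)\<^sup>2 - 2 * (s / (2*\<epsilon>)) * (v \<bullet> x) + (norm x)\<^sup>2"
    unfolding power2_norm_eq_inner
    by (simp add: inner_add_left inner_add_right inner_commute power2_eq_square algebra_simps add_divide_distrib)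
  have "s * (v \<bullet> x) - \<epsilon> * (norm x)\<^sup>2 = s\<^sup>2 * (norm v)\<^sup>2 / (4 * \<epsilon>) - \<epsilon> * (norm ((- (s / (2 * \<epsilon>)) *\<^sub>R v) + x))\<^sup>2"
    unfolding n using assms by (simp add: field_simps power2_eq_square)
  then show ?thesis
    unfolding gauss_def by (simp add: exp_add[symmetric] algebra_simps)
qed

text \<open>For real z the integrand is a translated Gaussian. Both sides are entire in z, so the
  identity theorem carries the formula to complex z, in particular to z = \<i>, the Fourier
  transform.\<close>

lemma gauss_transform:
  fixes v :: "'a::euclidean_space" and z :: complex
  assumes \<epsilon>: "\<epsilon> > 0"
  shows "(\<integral>x. exp (z * of_real (v \<bullet> x)) * of_real (gauss \<epsilon> x) \<partial>lborel)
     = of_real (gauss_mass TYPE('a) \<epsilon>) * exp (z\<^sup>2 * of_real ((norm v)\<^sup>2 / (4 * \<epsilon>)))" (is "?f z = ?g z")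
proof (rule entire_eq_of_eq_on_reals[of ?f ?g])
  show "?g holomorphic_on UNIV" by (intro holomorphic_intros)
  show "?f holomorphic_on UNIV"
  proof (rule holomorphic_on_param_integral)
    show "(\<lambda>z. exp (z * of_real (v \<bullet> x)) * of_real (gauss \<epsilon> x)) holomorphic_on UNIV" for x
      by (intro holomorphic_intros)
    show "(\<lambda>x. exp (z * of_real (v \<bullet> x)) * of_real (gauss \<epsilon> x)) \<in> borel_measurable lborel" for z :: complex
      by measurable
    fix z :: complex
    \<comment> \<open>K bounds |Re w| |v| on the unit disc around z. Half of the Gaussian is then
      spent on absorbing exp(K |x|).\<close>
    define K where "K = (norm z + 1) * norm v"
    have K: "K \<ge> 0" by (simp add: K_def)
    have "norm (exp (w * of_real (v \<bullet> x)) * of_real (gauss \<epsilon> x)) \<le> exp (K\<^sup>2 / (2*\<epsilon>)) * gauss (\<epsilon>/2) x"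
      if w: "w \<in> ball z 1" for x w
    proof -
      have "norm w \<le> norm z + 1"
        using w norm_triangle_ineq2[of w z] by (auto simp: dist_norm norm_minus_commute)
      then have Re: "\<bar>Re w\<bar> \<le> norm z + 1" using abs_Re_le_cmod[of w] by linarith
      have "Re w * (v \<bullet> x) \<le> \<bar>Re w\<bar> * \<bar>v \<bullet> x\<bar>" by (metis abs_ge_self abs_mult)
      also have "\<dots> \<le> (norm z + 1) * (norm v * norm x)"
        by (intro mult_mono Re Cauchy_Schwarz_ineq2) auto
      also have "\<dots> = K * norm x" by (simp add: K_def)
      also have "K * norm x \<le> K\<^sup>2 / (2*\<epsilon>) + \<epsilon>/2 * (norm x)\<^sup>2"
      proof -
        have "0 \<le> (K - \<epsilon> * norm x)\<^sup>2 / (2 * \<epsilon>)" using \<epsilon> by simp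
        also have "\<dots> = K\<^sup>2 / (2*\<epsilon>) + \<epsilon>/2 * (norm x)\<^sup>2 - K * norm x"
          using \<epsilon> by (simp add: field_simps power2_eq_square)
        finally show ?thesis by simp
      qed
      finally have "Re w * (v \<bullet> x) - \<epsilon> * (norm x)\<^sup>2 \<le> K\<^sup>2 / (2*\<epsilon>) - \<epsilon>/2 * (norm x)\<^sup>2" by (simp add: algebra_simps)
      then have "exp (Re w * (v \<bullet> x) + - \<epsilon> * (norm x)\<^sup>2) \<le> exp (K\<^sup>2 / (2*\<epsilon>) + - (\<epsilon>/2) * (norm x)\<^sup>2)" by simp
      then have "exp (Re w * (v \<bullet> x)) * gauss \<epsilon> x \<le> exp (K\<^sup>2 / (2*\<epsilon>)) * gauss (\<epsilon>/2) x"
        unfolding gauss_def exp_add .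
      then show ?thesis
        by (simp add: norm_mult abs_of_pos[OF gauss_pos])
    qed
    then show "\<exists>r>0. \<exists>B. integrable lborel B \<and> ball z r \<subseteq> UNIV \<and>
        (\<forall>x. \<forall>w\<in>ball z r. norm (exp (w * of_real (v \<bullet> x)) * complex_of_real (gauss \<epsilon> x)) \<le> B x)"
      using \<epsilon> integrable_gauss[of "\<epsilon>/2"]
      by (intro exI[of _ 1] exI[of _ "\<lambda>x. exp (K\<^sup>2 / (2*\<epsilon>)) * gauss (\<epsilon>/2) x"] conjI) auto
  qed auto
  fix s :: real
  have "?f (of_real s) = (\<integral>x. of_real (exp (s * (v \<bullet> x)) * gauss \<epsilon> x) \<partial>(lborel::'a measure))"
    by (simp add: exp_of_real[symmetric])
  also have "\<dots> = of_real (\<integral>x. exp (s * (v \<bullet> x)) * gauss \<epsilon> x \<partial>lborel)" by (rule integral_complex_of_real)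
  also have "(\<integral>x. exp (s * (v \<bullet> x)) * gauss \<epsilon> x \<partial>lborel) = exp (s\<^sup>2 * (norm v)\<^sup>2 / (4 * \<epsilon>)) * gauss_mass TYPE('a) \<epsilon>"
    unfolding gauss_translate[OF \<epsilon>]
    using integral_lborel_translate[of "gauss \<epsilon>" "- (s / (2 * \<epsilon>)) *\<^sub>R v"] by (simp add: gauss_mass_def)
  finally show "?f (of_real s) = ?g (of_real s)"
    by (simp add: exp_of_real[symmetric])
qed

lemma gauss_transform_cis:
  fixes v :: "'a::euclidean_space"
  assumes \<epsilon>: "\<epsilon> > 0"
  shows "(\<integral>x. cis (v \<bullet> x) * of_real (gauss \<epsilon> x) \<partial>lborel)
     = of_real (gauss_mass TYPE('a) \<epsilon> * gauss (1 / (4 * \<epsilon>)) v)"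
  using gauss_transform[OF \<epsilon>, of \<i> v]
  by (simp add: cis_conv_exp gauss_def exp_of_real[symmetric])

lemma gauss_mass_scale:
  assumes "c > 0"
  shows "gauss_mass TYPE('a::euclidean_space) \<epsilon> = c ^ DIM('a) * gauss_mass TYPE('a) (c\<^sup>2 * \<epsilon>)"
proof -
  have "gauss \<epsilon> (0 + c *\<^sub>R x) = gauss (c\<^sup>2 * \<epsilon>) x" for x :: 'a
    by (simp add: gauss_def power_mult_distrib mult_ac)
  then show ?thesis
    unfolding gauss_mass_def using assms integral_lborel_affine[of c "gauss \<epsilon>" "0::'a"] by simp
qed

lemma gauss_mass_pos: "\<epsilon> > 0 \<Longrightarrow> gauss_mass TYPE('a::euclidean_space) \<epsilon> > 0"
  unfolding gauss_mass_def
proof -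
  assume "\<epsilon> > 0"
  have "(\<integral>x. gauss \<epsilon> (x::'a) \<partial>lborel) \<noteq> 0"
  proof
    assume "(\<integral>x. gauss \<epsilon> (x::'a) \<partial>lborel) = 0"
    then have "AE x in lborel. gauss \<epsilon> (x::'a) = 0"
      by (rule integral_nonneg_eq_0_iff_AE[OF integrable_gauss[OF \<open>\<epsilon> > 0\<close>]
            AE_I2[OF less_imp_le[OF gauss_pos]], THEN iffD1])
    then have "AE x in (lborel :: 'a measure). \<not> True"
      by eventually_elim (use gauss_pos[of \<epsilon>] in \<open>auto simp: less_le\<close>)
    from emeasure_eq_0_AE[OF this] show False by simp
  qed
  moreover have "(\<integral>x. gauss \<epsilon> (x::'a) \<partial>lborel) \<ge> 0" by (simp add: less_imp_le gauss_pos)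
  ultimately show "(\<integral>x. gauss \<epsilon> (x::'a) \<partial>lborel) > 0" by simp
qed

text \<open>This is (2 pi)^d in dimension d, the constant of Plancherel's formula for transforms
  without normalising factor.\<close>

definition plancherel_const :: "'a::euclidean_space itself \<Rightarrow> real" where
  "plancherel_const _ = 2 ^ DIM('a) * (gauss_mass TYPE('a) 1)\<^sup>2"

text \<open>Both masses are rescaled to width 1, with factors sqrt \<epsilon> and 1/(2 sqrt
  \<epsilon>); the powers of \<epsilon> cancel. The independence of \<epsilon> makes the weighted
  Plancherel bound uniform.\<close>

lemma gauss_mass_dual:
  assumes "\<epsilon> > 0"
  shows "gauss_mass TYPE('a::euclidean_space) \<epsilon> * gauss_mass TYPE('a) (1 / (4 * \<epsilon>)) = plancherel_const TYPE('a)"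
proof -
  have 1: "gauss_mass TYPE('a) 1 = sqrt \<epsilon> ^ DIM('a) * gauss_mass TYPE('a) \<epsilon>"
    using gauss_mass_scale[of "sqrt \<epsilon>" 1, where 'a = 'a] assms by simp
  have 2: "gauss_mass TYPE('a) 1 = (1 / (2 * sqrt \<epsilon>)) ^ DIM('a) * gauss_mass TYPE('a) (1 / (4 * \<epsilon>))"
    using gauss_mass_scale[of "1 / (2 * sqrt \<epsilon>)" 1, where 'a = 'a] assms
    by (simp add: power_divide power_mult_distrib)
  have "(gauss_mass TYPE('a) 1)\<^sup>2 = (sqrt \<epsilon> ^ DIM('a) * gauss_mass TYPE('a) \<epsilon>) * ((1 / (2 * sqrt \<epsilon>)) ^ DIM('a) * gauss_mass TYPE('a) (1 / (4 * \<epsilon>)))"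
    unfolding power2_eq_square using 1 2 by metis
  then show ?thesis
    using assms by (simp add: plancherel_const_def power_divide power_mult_distrib field_simps)
qed

text \<open>The values s = 1 and s = -1 give the two directions of the Fourier transform, so results
  proved under \<open>s\<^sup>2 = 1\<close> serve both.\<close>

definition ftrans :: "real \<Rightarrow> ('a::euclidean_space \<Rightarrow> complex) \<Rightarrow> 'a \<Rightarrow> complex" where
  "ftrans s f x = (\<integral>p. cis (s * (x \<bullet> p)) * f p \<partial>lborel)"

lemma integrable_cis_mult:
  fixes f :: "'a::euclidean_space \<Rightarrow> complex"
  assumes "integrable lborel f"
  shows "integrable lborel (\<lambda>p. cis (s * (x \<bullet> p)) * f p)"
proof (rule Bochner_Integration.integrable_bound[OF assms])
  have [measurable]: "f \<in> borel_measurable borel" using assms by auto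
  show "(\<lambda>p. cis (s * (x \<bullet> p)) * f p) \<in> borel_measurable lborel" by measurable
qed (auto simp: norm_mult)

lemma borel_measurable_ftrans[measurable]:
  assumes [measurable]: "f \<in> borel_measurable borel"
  shows "ftrans s f \<in> borel_measurable borel"
  unfolding ftrans_def by measurable

lemma norm_ftrans_le: "norm (ftrans s f x) \<le> (\<integral>p. norm (f p) \<partial>lborel)"
  unfolding ftrans_def using integral_norm_bound[of lborel "\<lambda>p. cis (s * (x \<bullet> p)) * f p"]
  by (simp add: norm_mult)

lemma integrable_bounded_mult:
  fixes f :: "'x \<Rightarrow> complex"
  assumes "integrable M f" "g \<in> borel_measurable M" "\<And>x. norm (g x) \<le> C"
  shows "integrable M (\<lambda>x. g x * f x)"
proof (rule Bochner_Integration.integrable_bound)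
  show "integrable M (\<lambda>x. C * norm (f x))" using assms(1) by auto
  show "(\<lambda>x. g x * f x) \<in> borel_measurable M" using assms by auto
  show "AE x in M. norm (g x * f x) \<le> norm (C * norm (f x))"
    using assms(3) by (auto intro!: AE_I2 mult_right_mono order_trans[OF _ abs_ge_self] simp: norm_mult abs_mult)
qed

text \<open>Fubini, for a kernel that is symmetric in x and p.\<close>

lemma ftrans_multiplication:
  fixes f g :: "'a::euclidean_space \<Rightarrow> complex"
  assumes f: "integrable lborel f" and g: "integrable lborel g"
  shows "(\<integral>x. ftrans s f x * g x \<partial>lborel) = (\<integral>p. f p * ftrans s g p \<partial>lborel)"
proof -
  have [measurable]: "f \<in> borel_measurable borel" "g \<in> borel_measurable borel" using f g by auto
  have "integrable (lborel \<Otimes>\<^sub>M lborel) (\<lambda>(x, p). cis (s * (x \<bullet> p)) * f p * g x)"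
  proof (rule lborel_pair.Fubini_integrable)
    show "(\<lambda>(x, p). cis (s * (x \<bullet> p)) * f p * g x) \<in> borel_measurable (lborel \<Otimes>\<^sub>M lborel)" by measurable
    show "integrable lborel (\<lambda>x. \<integral>p. norm (case (x, p) of (x, p) \<Rightarrow> cis (s * (x \<bullet> p)) * f p * g x) \<partial>lborel)"
      using f g by (simp add: norm_mult)
    show "AE x in lborel. integrable lborel (\<lambda>p. case (x, p) of (x, p) \<Rightarrow> cis (s * (x \<bullet> p)) * f p * g x)"
      using integrable_cis_mult[OF f] by auto
  qed
  then have "(\<integral>p. (\<integral>x. cis (s * (x \<bullet> p)) * f p * g x \<partial>lborel) \<partial>lborel) = (\<integral>x. (\<integral>p. cis (s * (x \<bullet> p)) * f p * g x \<partial>lborel) \<partial>lborel)"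
    by (rule lborel_pair.Fubini_integral)
  moreover have "(\<integral>x. cis (s * (x \<bullet> p)) * f p * g x \<partial>lborel) = f p * ftrans s g p" for p
  proof -
    have "(\<integral>x. cis (s * (x \<bullet> p)) * f p * g x \<partial>lborel) = (\<integral>x. f p * (cis (s * (p \<bullet> x)) * g x) \<partial>lborel)"
      by (intro Bochner_Integration.integral_cong) (auto simp: inner_commute mult_ac)
    then show ?thesis by (simp add: ftrans_def)
  qed
  moreover have "(\<integral>p. cis (s * (x \<bullet> p)) * f p * g x \<partial>lborel) = ftrans s f x * g x" for x
    unfolding ftrans_def by (rule integral_mult_left_zero)
  ultimately show ?thesis by (simp only:)
qed

section \<open>The Fourier transform in \<open>L\<^sup>2\<close>\<close>

lemma gauss_diff_sym: "gauss \<epsilon> (p - q) = gauss \<epsilon> (q - p)"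
  by (simp add: gauss_def norm_minus_commute)

lemma nn_integral_gauss:
  "\<epsilon> > 0 \<Longrightarrow> (\<integral>\<^sup>+x. ennreal (gauss \<epsilon> (x::'a::euclidean_space)) \<partial>lborel) = ennreal (gauss_mass TYPE('a) \<epsilon>)"
  unfolding gauss_mass_def by (intro nn_integral_eq_integral integrable_gauss) (auto simp: less_imp_le gauss_pos)

lemma nn_integral_lborel_translate:
  fixes f :: "'a::euclidean_space \<Rightarrow> ennreal"
  assumes [measurable]: "f \<in> borel_measurable borel"
  shows "(\<integral>\<^sup>+x. f (t + x) \<partial>lborel) = (\<integral>\<^sup>+x. f x \<partial>lborel)"
  by (subst (2) lborel_distr_plus[of t, symmetric]) (simp add: nn_integral_distr)

lemma nn_integral_gauss_diff:
  fixes q :: "'a::euclidean_space"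
  shows "\<epsilon> > 0 \<Longrightarrow> (\<integral>\<^sup>+p. ennreal (gauss \<epsilon> (p - q)) \<partial>lborel) = ennreal (gauss_mass TYPE('a) \<epsilon>)"
  using nn_integral_lborel_translate[of "\<lambda>x. ennreal (gauss \<epsilon> x)" "- q"] nn_integral_gauss[where 'a='a, of \<epsilon>]
  by simp

lemma ftrans_gauss:
  fixes p q :: "'a::euclidean_space"
  assumes "\<epsilon> > 0" "s\<^sup>2 = 1"
  shows "ftrans s (\<lambda>x. cis (- s * (p \<bullet> x)) * of_real (gauss \<epsilon> x)) q
    = of_real (gauss_mass TYPE('a) \<epsilon> * gauss (1 / (4 * \<epsilon>)) (p - q))"
proof -
  have "ftrans s (\<lambda>x. cis (- s * (p \<bullet> x)) * of_real (gauss \<epsilon> x)) q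
      = (\<integral>x. cis ((s *\<^sub>R (q - p)) \<bullet> x) * of_real (gauss \<epsilon> x) \<partial>lborel)"
    unfolding ftrans_def
  proof (intro Bochner_Integration.integral_cong refl)
    fix x :: 'a
    have "s * (q \<bullet> x) + - s * (p \<bullet> x) = (s *\<^sub>R (q - p)) \<bullet> x" by (simp add: inner_diff_left right_diff_distrib)
    then show "cis (s * (q \<bullet> x)) * (cis (- s * (p \<bullet> x)) * of_real (gauss \<epsilon> x))
        = cis ((s *\<^sub>R (q - p)) \<bullet> x) * of_real (gauss \<epsilon> x)"
      unfolding mult.assoc[symmetric] cis_mult by simp
  qed
  also have "\<dots> = of_real (gauss_mass TYPE('a) \<epsilon> * gauss (1 / (4 * \<epsilon>)) (s *\<^sub>R (q - p)))"
    by (rule gauss_transform_cis[OF assms(1)])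
  also have "gauss (1 / (4 * \<epsilon>)) (s *\<^sub>R (q - p)) = gauss (1 / (4 * \<epsilon>)) (p - q)"
    using assms(2) by (simp add: gauss_def power_mult_distrib norm_minus_commute)
  finally show ?thesis .
qed

lemma integrable_cis_gauss:
  "\<epsilon> > 0 \<Longrightarrow> integrable lborel (\<lambda>x. cis (s * (p \<bullet> x)) * of_real (gauss \<epsilon> (x::'a::euclidean_space)))"
  by (intro integrable_cis_mult integrable_of_real integrable_gauss)

text \<open>The multiplication formula against a modulated Gaussian: damping the inverse transform
  by a Gaussian amounts to smoothing f by a Gaussian of reciprocal width.\<close>

lemma ftrans_gauss_convolution:
  fixes f :: "'a::euclidean_space \<Rightarrow> complex"
  assumes f: "integrable lborel f" and "\<epsilon> > 0" "s\<^sup>2 = 1"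
  shows "(\<integral>x. cis (- s * (p \<bullet> x)) * of_real (gauss \<epsilon> x) * ftrans s f x \<partial>lborel)
    = (\<integral>q. of_real (gauss_mass TYPE('a) \<epsilon> * gauss (1 / (4 * \<epsilon>)) (p - q)) * f q \<partial>lborel)"
  using ftrans_multiplication[OF f integrable_cis_gauss[OF assms(2), of "- s" p], of s]
  unfolding ftrans_gauss[OF assms(2,3)] by (simp only: mult.commute)

text \<open>The Gaussian weight makes the square of the transform integrable. The multiplication
  formula turns the weighted integral into a double integral of f(p) k(p - q) cnj(f(q)), and Schur's
  test bounds it: k integrates to \<open>plancherel_const\<close> in either variable, whatever
  \<epsilon> is.\<close>

lemma plancherel_gauss:
  fixes f :: "'a::euclidean_space \<Rightarrow> complex"
  assumes f: "integrable lborel f" and e: "\<epsilon> > 0" and s: "s\<^sup>2 = 1"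
  shows "(\<integral>\<^sup>+x. ennreal ((norm (ftrans s f x))\<^sup>2 * gauss \<epsilon> x) \<partial>lborel)
    \<le> ennreal (plancherel_const TYPE('a)) * (\<integral>\<^sup>+p. ennreal ((norm (f p))\<^sup>2) \<partial>lborel)"
proof -
  have fm[measurable]: "f \<in> borel_measurable borel" using f by auto
  define g where "g = (\<lambda>p. cnj (f p))"
  have g: "integrable lborel g" using f by (simp add: g_def)
  then have gm[measurable]: "g \<in> borel_measurable borel" by auto
  have ng: "norm (g p) = norm (f p)" for p by (simp add: g_def)
  have cnj: "cnj (ftrans s f x) = ftrans (- s) g x" for x
    unfolding ftrans_def g_def by (subst Bochner_Integration.integral_cnj[symmetric]) (simp add: cis_cnj)
  define w where "w = (\<lambda>x::'a. complex_of_real (gauss \<epsilon> x))"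
  define h where "h = (\<lambda>x. ftrans (- s) g x * w x)"
  have w: "integrable lborel w" unfolding w_def by (intro integrable_of_real integrable_gauss e)
  have h: "integrable lborel h" unfolding h_def
    by (rule integrable_bounded_mult[OF w _ norm_ftrans_le]) simp
  define k where "k = (\<lambda>v::'a. gauss_mass TYPE('a) \<epsilon> * gauss (1 / (4 * \<epsilon>)) v)"
  have k0: "k v \<ge> 0" for v
    unfolding k_def using gauss_mass_pos[OF e, where 'a='a] by (simp add: less_imp_le gauss_pos)
  have km[measurable]: "k \<in> borel_measurable borel" unfolding k_def by measurable
  have kint: "(\<integral>\<^sup>+p. ennreal (k (p - q)) \<partial>lborel) = ennreal (plancherel_const TYPE('a))" for q
  proof -
    have "(\<integral>\<^sup>+p. ennreal (k (p - q)) \<partial>lborel)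
        = ennreal (gauss_mass TYPE('a) \<epsilon>) * (\<integral>\<^sup>+p. ennreal (gauss (1 / (4 * \<epsilon>)) (p - q)) \<partial>lborel)"
      unfolding k_def using gauss_mass_pos[OF e, where 'a='a]
      by (subst nn_integral_cmult[symmetric]) (auto simp: ennreal_mult less_imp_le gauss_pos)
    then show ?thesis
      using e gauss_mass_pos[OF e, where 'a='a] gauss_mass_pos[of "1 / (4*\<epsilon>)", where 'a='a]
      by (simp add: nn_integral_gauss_diff ennreal_mult[symmetric] less_imp_le gauss_mass_dual)
  qed
  have ksym: "k (p - q) = k (q - p)" for p q unfolding k_def by (simp add: gauss_diff_sym)
  have kint2: "(\<integral>\<^sup>+q. ennreal (k (p - q)) \<partial>lborel) = ennreal (plancherel_const TYPE('a))" for p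
    using kint[of p] by (simp only: ksym[of p])
  have hT: "ftrans s h p = (\<integral>q. of_real (k (p - q)) * g q \<partial>lborel)" for p
  proof -
    have "ftrans s h p = (\<integral>x. cis (- (- s) * (p \<bullet> x)) * of_real (gauss \<epsilon> x) * ftrans (- s) g x \<partial>lborel)"
      by (simp add: ftrans_def h_def w_def mult_ac)
    also have "\<dots> = (\<integral>q. of_real (k (p - q)) * g q \<partial>lborel)"
      unfolding k_def using s by (intro ftrans_gauss_convolution[OF g e]) simp
    finally show ?thesis .
  qed
  have fh: "integrable lborel (\<lambda>p. f p * ftrans s h p)"
    using integrable_bounded_mult[OF f, of "ftrans s h", OF _ norm_ftrans_le] h by (simp add: mult.commute)
  have sq: "complex_of_real ((norm (ftrans s f x))\<^sup>2 * gauss \<epsilon> x) = ftrans s f x * h x" for x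
    by (simp add: h_def w_def cnj[symmetric] complex_norm_square del: of_real_power)
  have fhi: "integrable lborel (\<lambda>x. ftrans s f x * h x)"
    using integrable_bounded_mult[OF h, of "ftrans s f", OF _ norm_ftrans_le] by simp
  then have sqi: "integrable lborel (\<lambda>x. (norm (ftrans s f x))\<^sup>2 * gauss \<epsilon> x)"
    unfolding sq[symmetric] by (subst (asm) complex_of_real_integrable_eq)
  have nn: "0 \<le> (norm (ftrans s f x))\<^sup>2 * gauss \<epsilon> x" for x by (simp add: less_imp_le gauss_pos)
  have "(\<integral>\<^sup>+x. ennreal ((norm (ftrans s f x))\<^sup>2 * gauss \<epsilon> x) \<partial>lborel)
      = ennreal (\<integral>x. (norm (ftrans s f x))\<^sup>2 * gauss \<epsilon> x \<partial>lborel)"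
    by (rule nn_integral_eq_integral[OF sqi]) (simp add: nn)
  also have "\<dots> = ennreal (norm (\<integral>x. complex_of_real ((norm (ftrans s f x))\<^sup>2 * gauss \<epsilon> x) \<partial>lborel))"
    unfolding integral_complex_of_real by (simp add: integral_nonneg_AE nn)
  also have "\<dots> = ennreal (norm (\<integral>p. f p * ftrans s h p \<partial>lborel))"
    unfolding sq ftrans_multiplication[OF f h] ..
  also have "\<dots> \<le> (\<integral>\<^sup>+p. ennreal (norm (f p * ftrans s h p)) \<partial>lborel)"
    by (rule integral_norm_bound_ennreal[OF fh])
  also have "\<dots> \<le> (\<integral>\<^sup>+p. (\<integral>\<^sup>+q. ennreal ((norm (f p))\<^sup>2 / 2) * ennreal (k (p - q)) + ennreal ((norm (f q))\<^sup>2 / 2) * ennreal (k (p - q)) \<partial>lborel) \<partial>lborel)"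
  proof (rule nn_integral_mono)
    fix p :: 'a
    have kg: "integrable lborel (\<lambda>q. of_real (k (p - q)) * g q)"
    proof (rule integrable_bounded_mult[OF g])
      show "norm (complex_of_real (k (p - q))) \<le> gauss_mass TYPE('a) \<epsilon>" for q
        using k0[of "p - q"] gauss_le_1[of "1 / (4*\<epsilon>)" "p - q"] e gauss_mass_pos[OF e, where 'a='a]
        by (simp add: k_def mult_left_le norm_mult abs_of_pos[OF gauss_pos])
    qed measurable
    have "ennreal (norm (f p * ftrans s h p)) = ennreal (norm (f p)) * ennreal (norm (\<integral>q. of_real (k (p - q)) * g q \<partial>lborel))"
      by (simp add: hT norm_mult ennreal_mult)
    also have "\<dots> \<le> ennreal (norm (f p)) * (\<integral>\<^sup>+q. ennreal (norm (of_real (k (p - q)) * g q)) \<partial>lborel)"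
      by (intro mult_left_mono integral_norm_bound_ennreal[OF kg]) simp
    also have "\<dots> = (\<integral>\<^sup>+q. ennreal (norm (f p)) * ennreal (norm (of_real (k (p - q)) * g q)) \<partial>lborel)"
      by (subst nn_integral_cmult) auto
    also have "\<dots> \<le> (\<integral>\<^sup>+q. ennreal ((norm (f p))\<^sup>2 / 2) * ennreal (k (p - q)) + ennreal ((norm (f q))\<^sup>2 / 2) * ennreal (k (p - q)) \<partial>lborel)"
    proof (rule nn_integral_mono)
      fix q :: 'a
      \<comment> \<open>The inequality between arithmetic and geometric mean separates f(p) from
        f(q), so that in each term k can be integrated out first.\<close>
      have "norm (f p) * norm (f q) \<le> (norm (f p))\<^sup>2 / 2 + (norm (f q))\<^sup>2 / 2"
        using sum_squares_bound[of "norm (f p)" "norm (f q)"] by simp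
      then have "norm (f p) * norm (f q) * k (p - q) \<le> ((norm (f p))\<^sup>2 / 2 + (norm (f q))\<^sup>2 / 2) * k (p - q)"
        by (rule mult_right_mono[OF _ k0])
      then show "ennreal (norm (f p)) * ennreal (norm (of_real (k (p - q)) * g q))
        \<le> ennreal ((norm (f p))\<^sup>2 / 2) * ennreal (k (p - q)) + ennreal ((norm (f q))\<^sup>2 / 2) * ennreal (k (p - q))"
        using k0[of "p - q"]
        by (simp add: norm_mult ng ennreal_mult[symmetric] ennreal_plus[symmetric] ennreal_leI algebra_simps del: ennreal_plus)
    qed
    finally show "ennreal (norm (f p * ftrans s h p)) \<le> \<dots>" .
  qed
  also have "\<dots> = (\<integral>\<^sup>+p. (\<integral>\<^sup>+q. ennreal ((norm (f p))\<^sup>2 / 2) * ennreal (k (p - q)) \<partial>lborel) \<partial>lborel)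
     + (\<integral>\<^sup>+p. (\<integral>\<^sup>+q. ennreal ((norm (f q))\<^sup>2 / 2) * ennreal (k (p - q)) \<partial>lborel) \<partial>lborel)"
    by (subst nn_integral_add[symmetric]) (auto intro!: nn_integral_cong nn_integral_add)
  also have "(\<integral>\<^sup>+p. (\<integral>\<^sup>+q. ennreal ((norm (f q))\<^sup>2 / 2) * ennreal (k (p - q)) \<partial>lborel) \<partial>lborel)
     = (\<integral>\<^sup>+q. (\<integral>\<^sup>+p. ennreal ((norm (f q))\<^sup>2 / 2) * ennreal (k (p - q)) \<partial>lborel) \<partial>lborel)"
    by (rule lborel_pair.Fubini') simp
  also have "(\<integral>\<^sup>+q. (\<integral>\<^sup>+p. ennreal ((norm (f q))\<^sup>2 / 2) * ennreal (k (p - q)) \<partial>lborel) \<partial>lborel)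
     = (\<integral>\<^sup>+q. ennreal ((norm (f q))\<^sup>2 / 2) * ennreal (plancherel_const TYPE('a)) \<partial>lborel)"
    by (subst nn_integral_cmult) (auto simp: kint)
  also have "(\<integral>\<^sup>+p. (\<integral>\<^sup>+q. ennreal ((norm (f p))\<^sup>2 / 2) * ennreal (k (p - q)) \<partial>lborel) \<partial>lborel)
     = (\<integral>\<^sup>+q. ennreal ((norm (f q))\<^sup>2 / 2) * ennreal (plancherel_const TYPE('a)) \<partial>lborel)"
    by (subst nn_integral_cmult) (auto simp: kint2)
  also have "(\<integral>\<^sup>+q. ennreal ((norm (f q))\<^sup>2 / 2) * ennreal (plancherel_const TYPE('a)) \<partial>lborel)
    + (\<integral>\<^sup>+q. ennreal ((norm (f q))\<^sup>2 / 2) * ennreal (plancherel_const TYPE('a)) \<partial>lborel)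
    = ennreal (plancherel_const TYPE('a)) * (\<integral>\<^sup>+p. ennreal ((norm (f p))\<^sup>2) \<partial>lborel)"
  proof -
    let ?C = "ennreal (plancherel_const TYPE('a))" and ?N = "\<integral>\<^sup>+p. ennreal ((norm (f p))\<^sup>2) \<partial>lborel"
    have "ennreal ((norm (f q))\<^sup>2 / 2) * ?C = (ennreal (1/2) * ?C) * ennreal ((norm (f q))\<^sup>2)" for q
    proof -
      have "ennreal ((norm (f q))\<^sup>2 / 2) = ennreal (1/2) * ennreal ((norm (f q))\<^sup>2)"
        by (subst ennreal_mult[symmetric]) auto
      then show ?thesis by (simp only: mult_ac)
    qed
    then have "(\<integral>\<^sup>+q. ennreal ((norm (f q))\<^sup>2 / 2) * ?C \<partial>lborel) = (ennreal (1/2) * ?C) * ?N"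
      by (simp add: nn_integral_cmult)
    moreover have "(ennreal (1/2) * ?C) * ?N + (ennreal (1/2) * ?C) * ?N = (ennreal (1/2) + ennreal (1/2)) * (?C * ?N)"
      by (simp only: distrib_right mult.assoc)
    moreover have "ennreal (1/2) + ennreal (1/2) = 1"
      by (subst ennreal_plus[symmetric]) auto
    ultimately show ?thesis by simp
  qed
  finally show ?thesis .
qed

text \<open>Fatou's lemma for Gaussian weights that increase to 1, under a bound independent of the
  weight.\<close>

theorem plancherel_le:
  fixes f :: "'a::euclidean_space \<Rightarrow> complex"
  assumes f: "integrable lborel f" and s: "s\<^sup>2 = 1"
  shows "(\<integral>\<^sup>+x. ennreal ((norm (ftrans s f x))\<^sup>2) \<partial>lborel)
    \<le> ennreal (plancherel_const TYPE('a)) * (\<integral>\<^sup>+p. ennreal ((norm (f p))\<^sup>2) \<partial>lborel)"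
proof -
  have [measurable]: "f \<in> borel_measurable borel" using f by auto
  have "(\<integral>\<^sup>+x. ennreal ((norm (ftrans s f x))\<^sup>2) \<partial>lborel)
      = (\<integral>\<^sup>+x. liminf (\<lambda>n. ennreal ((norm (ftrans s f x))\<^sup>2 * gauss (1 / real (Suc n)) x)) \<partial>lborel)"
  proof (intro nn_integral_cong lim_imp_Liminf[symmetric] tendsto_ennrealI)
    fix x :: 'a
    have "(\<lambda>n. (norm (ftrans s f x))\<^sup>2 * exp (- (1 / real (Suc n)) * (norm x)\<^sup>2)) \<longlonglongrightarrow> (norm (ftrans s f x))\<^sup>2 * exp (- 0 * (norm x)\<^sup>2)"
      by (intro tendsto_intros LIMSEQ_Suc[OF lim_1_over_n])
    then show "(\<lambda>n. (norm (ftrans s f x))\<^sup>2 * gauss (1 / real (Suc n)) x) \<longlonglongrightarrow> (norm (ftrans s f x))\<^sup>2"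
      by (simp add: gauss_def)
  qed simp
  also have "\<dots> \<le> liminf (\<lambda>n. \<integral>\<^sup>+x. ennreal ((norm (ftrans s f x))\<^sup>2 * gauss (1 / real (Suc n)) x) \<partial>lborel)"
    by (rule nn_integral_liminf) simp
  also have "\<dots> \<le> liminf (\<lambda>n::nat. ennreal (plancherel_const TYPE('a)) * (\<integral>\<^sup>+p. ennreal ((norm (f p))\<^sup>2) \<partial>lborel))"
    by (intro Liminf_mono always_eventually allI plancherel_gauss[OF f _ s]) simp
  finally show ?thesis by (simp add: Liminf_const)
qed

text \<open>If S is the value of the weighted sum, the weights 2^k force d_k \<le> sqrt S / (sqrt
  2)^k, a convergent geometric bound.\<close>

lemma summable_geometric_bound_of_suminf:
  fixes d :: "nat \<Rightarrow> real"
  assumes "(\<Sum>k. ennreal (2 ^ k * (d k)\<^sup>2)) \<noteq> \<infinity>" and d0: "\<And>k. d k \<ge> 0"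
  shows "summable d"
proof -
  obtain S where S: "S \<ge> 0" "(\<Sum>k. ennreal (2 ^ k * (d k)\<^sup>2)) = ennreal S"
  proof -
    define T where "T = (\<Sum>k. ennreal (2 ^ k * (d k)\<^sup>2))"
    have "T \<noteq> \<infinity>" using assms(1) unfolding T_def .
    then obtain S where "S \<ge> 0" "T = ennreal S" by (cases T) auto
    then show ?thesis using that unfolding T_def by blast
  qed
  have le: "norm (d k) \<le> sqrt S * (1 / sqrt 2) ^ k" for k
  proof -
    have "ennreal (2 ^ k * (d k)\<^sup>2) \<le> ennreal S"
      using sum_le_suminf[of "\<lambda>k. ennreal (2 ^ k * (d k)\<^sup>2)" "{k}"] S(2) by simp
    then have "2 ^ k * (d k)\<^sup>2 \<le> S" using S(1) by (simp add: ennreal_le_iff)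
    then have "(d k)\<^sup>2 \<le> S / 2 ^ k" by (simp add: field_simps)
    then have "d k \<le> sqrt (S / 2 ^ k)" using d0 by (simp add: real_le_rsqrt)
    then show ?thesis using d0[of k] by (simp add: real_sqrt_divide real_sqrt_power power_divide)
  qed
  have "summable (\<lambda>k. sqrt S * (1 / sqrt 2) ^ k)"
    by (intro summable_mult summable_geometric) simp
  then show ?thesis by (rule summable_comparison_test'[where N = 0]) (rule le)
qed

text \<open>Along indices whose squared distances are at most 4^(-k), the sum of 2^k d_k^2 has
  finite integral, so the steps are summable at almost every point. Fatou's lemma then bounds the
  distance of every late F n to the pointwise limit.\<close>

theorem riesz_fischer:
  fixes F :: "nat \<Rightarrow> 'x \<Rightarrow> 'b::{banach, second_countable_topology}"
  assumes F[measurable]: "\<And>n. F n \<in> borel_measurable M"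
    and cauchy: "\<And>\<epsilon>. \<epsilon> > 0 \<Longrightarrow> \<exists>N. \<forall>m\<ge>N. \<forall>n\<ge>N. (\<integral>\<^sup>+x. ennreal ((norm (F m x - F n x))\<^sup>2) \<partial>M) \<le> ennreal \<epsilon>"
  shows "\<exists>g\<in>borel_measurable M. (\<lambda>n. \<integral>\<^sup>+x. ennreal ((norm (F n x - g x))\<^sup>2) \<partial>M) \<longlonglongrightarrow> 0"
proof -
  have "\<exists>N. \<forall>m\<ge>N. \<forall>n\<ge>N. (\<integral>\<^sup>+x. ennreal ((norm (F m x - F n x))\<^sup>2) \<partial>M) \<le> ennreal ((1/4)^k)" for k :: nat
    by (rule cauchy) simp
  then obtain N where N: "\<And>k m n. m \<ge> N k \<Longrightarrow> n \<ge> N k \<Longrightarrow> (\<integral>\<^sup>+x. ennreal ((norm (F m x - F n x))\<^sup>2) \<partial>M) \<le> ennreal ((1/4)^k)"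
    by metis
  \<comment> \<open>A partial sum of the N j is at least each of its terms, so the index r k is late
    enough for all precisions up to k at once.\<close>
  define r where "r k = (\<Sum>j\<le>k. N j)" for k
  have rN: "r i \<ge> N k" if "k \<le> i" for i k
    unfolding r_def using that by (intro member_le_sum) auto
  define d where "d k x = norm (F (r (Suc k)) x - F (r k) x)" for k x
  have [measurable]: "d k \<in> borel_measurable M" for k unfolding d_def by measurable
  have "(\<integral>\<^sup>+x. (\<Sum>k. ennreal (2 ^ k * (d k x)\<^sup>2)) \<partial>M) = (\<Sum>k. \<integral>\<^sup>+x. ennreal (2 ^ k * (d k x)\<^sup>2) \<partial>M)"
    by (rule nn_integral_suminf) measurable
  also have "\<dots> \<le> (\<Sum>k. ennreal ((1/2)^k))"
  proof (rule suminf_le)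
    fix k
    have "(\<integral>\<^sup>+x. ennreal (2 ^ k * (d k x)\<^sup>2) \<partial>M) = ennreal (2^k) * (\<integral>\<^sup>+x. ennreal ((d k x)\<^sup>2) \<partial>M)"
      by (subst nn_integral_cmult[symmetric]) (auto simp: ennreal_mult)
    also have "\<dots> \<le> ennreal (2^k) * ennreal ((1/4)^k)"
      unfolding d_def by (intro mult_left_mono N rN) auto
    also have "\<dots> = ennreal ((1/2)^k)"
      by (subst ennreal_mult[symmetric]) (auto simp: power_mult_distrib[symmetric])
    finally show "(\<integral>\<^sup>+x. ennreal (2 ^ k * (d k x)\<^sup>2) \<partial>M) \<le> ennreal ((1/2)^k)" .
  qed auto
  also have "\<dots> = ennreal (\<Sum>k. (1/2)^k)"
    by (rule suminf_ennreal2) (auto intro!: summable_geometric)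
  also have "\<dots> < \<infinity>" by simp
  finally have "(\<integral>\<^sup>+x. (\<Sum>k. ennreal (2 ^ k * (d k x)\<^sup>2)) \<partial>M) \<noteq> \<infinity>" by simp
  then have "AE x in M. (\<Sum>k. ennreal (2 ^ k * (d k x)\<^sup>2)) \<noteq> \<infinity>"
    by (intro nn_integral_noteq_infinite) auto
  then have conv: "AE x in M. convergent (\<lambda>k. F (r k) x)"
  proof eventually_elim
    fix x assume "(\<Sum>k. ennreal (2 ^ k * (d k x)\<^sup>2)) \<noteq> \<infinity>"
    then have "summable (\<lambda>k. d k x)" by (rule summable_geometric_bound_of_suminf) (simp add: d_def)
    then have "summable (\<lambda>k. F (r (Suc k)) x - F (r k) x)" unfolding d_def by (rule summable_norm_cancel)
    then have "convergent (\<lambda>n. \<Sum>k<n. F (r (Suc k)) x - F (r k) x)" by (simp add: summable_iff_convergent)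
    then have "convergent (\<lambda>n. F (r n) x - F (r 0) x)" unfolding sum_lessThan_telescope[of "\<lambda>k. F (r k) x"] .
    then have "convergent (\<lambda>n. F (r n) x - F (r 0) x + F (r 0) x)" by (intro convergent_add convergent_const)
    then show "convergent (\<lambda>k. F (r k) x)" by simp
  qed
  define g where "g x = lim (\<lambda>k. F (r k) x)" for x
  have gm[measurable]: "g \<in> borel_measurable M" unfolding g_def by measurable
  have bound: "(\<integral>\<^sup>+x. ennreal ((norm (F n x - g x))\<^sup>2) \<partial>M) \<le> ennreal ((1/4)^j)" if n: "n \<ge> N j" for n j
  proof -
    have "(\<integral>\<^sup>+x. ennreal ((norm (F n x - g x))\<^sup>2) \<partial>M)
        = (\<integral>\<^sup>+x. liminf (\<lambda>k. ennreal ((norm (F n x - F (r k) x))\<^sup>2)) \<partial>M)"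
    proof (rule nn_integral_cong_AE, use conv in eventually_elim)
      fix x assume "convergent (\<lambda>k. F (r k) x)"
      then have "(\<lambda>k. F (r k) x) \<longlonglongrightarrow> g x" by (simp add: g_def convergent_LIMSEQ_iff)
      then have "(\<lambda>k. ennreal ((norm (F n x - F (r k) x))\<^sup>2)) \<longlonglongrightarrow> ennreal ((norm (F n x - g x))\<^sup>2)"
        by (intro tendsto_intros tendsto_ennrealI)
      then show "ennreal ((norm (F n x - g x))\<^sup>2) = liminf (\<lambda>k. ennreal ((norm (F n x - F (r k) x))\<^sup>2))"
        by (rule lim_imp_Liminf[OF trivial_limit_sequentially, symmetric])
    qed
    also have "\<dots> \<le> liminf (\<lambda>k. \<integral>\<^sup>+x. ennreal ((norm (F n x - F (r k) x))\<^sup>2) \<partial>M)"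
      by (rule nn_integral_liminf) measurable
    also have "\<dots> \<le> liminf (\<lambda>k::nat. ennreal ((1/4)^j))"
      by (intro Liminf_mono eventually_mono[OF eventually_ge_at_top[of j]] N n rN)
    finally show ?thesis by (simp add: Liminf_const)
  qed
  have "(\<lambda>n. \<integral>\<^sup>+x. ennreal ((norm (F n x - g x))\<^sup>2) \<partial>M) \<longlonglongrightarrow> 0"
  proof (rule tendsto_zero_ennreal)
    fix \<epsilon> :: real assume "\<epsilon> > 0"
    then obtain j where "(1/4::real) ^ j < \<epsilon>" using real_arch_pow_inv[of \<epsilon> "1/4"] by auto
    then have less: "ennreal ((1/4) ^ j) < ennreal \<epsilon>" using \<open>\<epsilon> > 0\<close> by (intro ennreal_lessI)
    show "\<forall>\<^sub>F n in sequentially. (\<integral>\<^sup>+x. ennreal ((norm (F n x - g x))\<^sup>2) \<partial>M) < ennreal \<epsilon>"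
      by (intro eventually_mono[OF eventually_ge_at_top[of "N j"]]) (rule le_less_trans[OF bound less])
  qed
  then show ?thesis using gm by blast
qed

section \<open>Mean-square convergence of truncations and regularisations\<close>

lemma nn_integral_norm_sq_add:
  fixes f g :: "'x \<Rightarrow> 'b::{real_normed_vector, second_countable_topology}"
  assumes [measurable]: "f \<in> borel_measurable M" "g \<in> borel_measurable M"
  shows "(\<integral>\<^sup>+x. ennreal ((norm (f x + g x))\<^sup>2) \<partial>M)
    \<le> 2 * (\<integral>\<^sup>+x. ennreal ((norm (f x))\<^sup>2) \<partial>M) + 2 * (\<integral>\<^sup>+x. ennreal ((norm (g x))\<^sup>2) \<partial>M)"
proof -
  have "(norm (f x + g x))\<^sup>2 \<le> 2 * (norm (f x))\<^sup>2 + 2 * (norm (g x))\<^sup>2" for x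
  proof -
    have "(norm (f x + g x))\<^sup>2 \<le> (norm (f x) + norm (g x))\<^sup>2" by (intro power_mono norm_triangle_ineq) auto
    also have "\<dots> \<le> 2 * (norm (f x))\<^sup>2 + 2 * (norm (g x))\<^sup>2"
      using sum_squares_bound[of "norm (f x)" "norm (g x)"] by (simp add: power2_sum)
    finally show ?thesis .
  qed
  then have "(\<integral>\<^sup>+x. ennreal ((norm (f x + g x))\<^sup>2) \<partial>M) \<le> (\<integral>\<^sup>+x. 2 * ennreal ((norm (f x))\<^sup>2) + 2 * ennreal ((norm (g x))\<^sup>2) \<partial>M)"
    by (intro nn_integral_mono) (auto simp: ennreal_plus[symmetric] ennreal_mult[symmetric] ennreal_leI
        simp del: ennreal_plus simp flip: ennreal_numeral)
  also have "\<dots> = 2 * (\<integral>\<^sup>+x. ennreal ((norm (f x))\<^sup>2) \<partial>M) + 2 * (\<integral>\<^sup>+x. ennreal ((norm (g x))\<^sup>2) \<partial>M)"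
    by (simp add: nn_integral_add nn_integral_cmult)
  finally show ?thesis .
qed

lemma nn_integral_norm_sq_mult_tendsto_0:
  fixes \<phi> :: "'x \<Rightarrow> complex"
  assumes [measurable]: "\<phi> \<in> borel_measurable M" and [measurable]: "\<And>n. \<kappa> n \<in> borel_measurable M"
    and fin: "(\<integral>\<^sup>+x. ennreal ((norm (\<phi> x))\<^sup>2) \<partial>M) < \<infinity>"
    and b: "\<And>n x. norm (\<kappa> n x) \<le> (1::real)" and lim: "\<And>x. (\<lambda>n. \<kappa> n x) \<longlonglongrightarrow> (1::complex)"
  shows "(\<lambda>n. \<integral>\<^sup>+x. ennreal ((norm (\<phi> x - \<kappa> n x * \<phi> x))\<^sup>2) \<partial>M) \<longlonglongrightarrow> 0"
proof -
  have "(\<lambda>n. \<integral>\<^sup>+x. ennreal ((norm (\<phi> x - \<kappa> n x * \<phi> x))\<^sup>2) \<partial>M) \<longlonglongrightarrow> (\<integral>\<^sup>+x. 0 \<partial>M)"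
  proof (rule nn_integral_dominated_convergence[where w = "\<lambda>x. 4 * ennreal ((norm (\<phi> x))\<^sup>2)"])
    show "AE x in M. (\<lambda>n. ennreal ((norm (\<phi> x - \<kappa> n x * \<phi> x))\<^sup>2)) \<longlonglongrightarrow> 0"
    proof (rule AE_I2)
      fix x
      have "(\<lambda>n. ennreal ((norm (\<phi> x - \<kappa> n x * \<phi> x))\<^sup>2)) \<longlonglongrightarrow> ennreal ((norm (\<phi> x - 1 * \<phi> x))\<^sup>2)"
        by (intro tendsto_intros tendsto_ennrealI lim)
      then show "(\<lambda>n. ennreal ((norm (\<phi> x - \<kappa> n x * \<phi> x))\<^sup>2)) \<longlonglongrightarrow> 0" by simp
    qed
    show "AE x in M. ennreal ((norm (\<phi> x - \<kappa> n x * \<phi> x))\<^sup>2) \<le> 4 * ennreal ((norm (\<phi> x))\<^sup>2)" for n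
    proof (rule AE_I2)
      fix x
      have "norm (\<phi> x - \<kappa> n x * \<phi> x) \<le> norm (\<phi> x) + norm (\<kappa> n x) * norm (\<phi> x)"
        by (metis norm_mult norm_triangle_ineq4)
      also have "\<dots> \<le> norm (\<phi> x) + 1 * norm (\<phi> x)" by (intro add_left_mono mult_right_mono b) auto
      finally have "(norm (\<phi> x - \<kappa> n x * \<phi> x))\<^sup>2 \<le> (2 * norm (\<phi> x))\<^sup>2" by (intro power_mono) auto
      then show "ennreal ((norm (\<phi> x - \<kappa> n x * \<phi> x))\<^sup>2) \<le> 4 * ennreal ((norm (\<phi> x))\<^sup>2)"
        by (simp add: power_mult_distrib ennreal_mult[symmetric] ennreal_leI flip: ennreal_numeral)
    qed
    show "(\<integral>\<^sup>+x. 4 * ennreal ((norm (\<phi> x))\<^sup>2) \<partial>M) < \<infinity>"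
      using fin by (simp add: nn_integral_cmult ennreal_mult_less_top)
  qed auto
  then show ?thesis by simp
qed

definition trunc :: "nat \<Rightarrow> ('a::euclidean_space \<Rightarrow> complex) \<Rightarrow> 'a \<Rightarrow> complex" where
  "trunc n f x = indicator (cball 0 (real n)) x * f x"

lemma borel_measurable_trunc[measurable]:
  "f \<in> borel_measurable borel \<Longrightarrow> trunc n f \<in> borel_measurable borel"
  unfolding trunc_def by (intro borel_measurable_times borel_measurable_indicator borel_closed closed_cball)

lemma trunc_tendsto: "(\<lambda>n. trunc n f x) \<longlonglongrightarrow> f x"
proof (rule tendsto_eventually, rule eventually_sequentiallyI)
  fix n assume "nat \<lceil>norm x\<rceil> \<le> n"
  then show "trunc n f x = f x" by (simp add: trunc_def)
qed

lemma trunc_L2_tendsto: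
  fixes \<phi> :: "'a::euclidean_space \<Rightarrow> complex"
  assumes [measurable]: "\<phi> \<in> borel_measurable borel"
    and fin: "(\<integral>\<^sup>+x. ennreal ((norm (\<phi> x))\<^sup>2) \<partial>lborel) < \<infinity>"
  shows "(\<lambda>n. \<integral>\<^sup>+x. ennreal ((norm (\<phi> x - trunc n \<phi> x))\<^sup>2) \<partial>lborel) \<longlonglongrightarrow> 0"
proof -
  have "(\<lambda>n. indicator (cball 0 (real n)) x :: complex) \<longlonglongrightarrow> 1" for x :: 'a
    using trunc_tendsto[of "\<lambda>_. 1" x] by (simp add: trunc_def)
  then show ?thesis
    unfolding trunc_def using fin
    by (intro nn_integral_norm_sq_mult_tendsto_0) (auto simp: indicator_def)
qed

text \<open>On the ball |\<phi>| \<le> 1 + |\<phi>|^2, and both summands are integrable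
  there.\<close>

lemma integrable_trunc:
  fixes \<phi> :: "'a::euclidean_space \<Rightarrow> complex"
  assumes [measurable]: "\<phi> \<in> borel_measurable borel"
    and fin: "(\<integral>\<^sup>+x. ennreal ((norm (\<phi> x))\<^sup>2) \<partial>lborel) < \<infinity>"
  shows "integrable lborel (trunc n \<phi>)"
proof (rule Bochner_Integration.integrable_bound)
  have "integrable lborel (\<lambda>x. (norm (\<phi> x))\<^sup>2)" using fin by (intro integrableI_bounded) auto
  moreover have "integrable lborel (indicator (cball (0::'a) (real n)) :: 'a \<Rightarrow> real)"
    by (rule integrable_real_indicator) (use emeasure_lborel_cball_finite[of "0::'a" "real n"] in \<open>auto simp: less_top\<close>)
  ultimately show "integrable lborel (\<lambda>x. indicator (cball (0::'a) (real n)) x + (norm (\<phi> x))\<^sup>2)" by (rule Bochner_Integration.integrable_add[rotated])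
  have "norm (trunc n \<phi> x) \<le> norm (indicator (cball 0 (real n)) x + (norm (\<phi> x))\<^sup>2)" for x
  proof -
    have "norm (\<phi> x) \<le> 2 * norm (\<phi> x)" by simp
    also have "\<dots> \<le> 1 + (norm (\<phi> x))\<^sup>2" using sum_squares_bound[of 1 "norm (\<phi> x)"] by simp
    finally have "norm (\<phi> x) \<le> 1 + (norm (\<phi> x))\<^sup>2" .
    then show ?thesis by (auto simp: trunc_def indicator_def)
  qed
  then show "AE x in lborel. norm (trunc n \<phi> x) \<le> norm (indicator (cball 0 (real n)) x + (norm (\<phi> x))\<^sup>2)" by simp
qed simp

lemma ftrans_diff:
  "integrable lborel f \<Longrightarrow> integrable lborel g \<Longrightarrow> ftrans s f x - ftrans s g x = ftrans s (\<lambda>p. f p - g p) x"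
  unfolding ftrans_def
  by (subst Bochner_Integration.integral_diff[symmetric]) (auto intro: integrable_cis_mult simp: right_diff_distrib)

text \<open>The \<open>L\<^sup>2\<close> limits of the truncated transforms are only handled through this relation, so that
  no choice of a representative is needed.\<close>

definition l2_ftrans :: "real \<Rightarrow> ('a::euclidean_space \<Rightarrow> complex) \<Rightarrow> ('a \<Rightarrow> complex) \<Rightarrow> bool" where
  "l2_ftrans s \<phi> g \<longleftrightarrow> g \<in> borel_measurable borel \<and>
     (\<lambda>n. \<integral>\<^sup>+x. ennreal ((norm (ftrans s (trunc n \<phi>) x - g x))\<^sup>2) \<partial>lborel) \<longlonglongrightarrow> 0"

text \<open>By Plancherel, g is also the mean-square limit of the transforms of the regularised
  functions \<open>\<kappa> n p * \<phi> p\<close>; if all of these vanish on A, so does g.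
  Pointwise arguments about integrable functions thus reach transforms of functions that are merely
  square-integrable.\<close>

lemma l2_ftrans_vanish:
  fixes \<phi> :: "'a::euclidean_space \<Rightarrow> complex"
  assumes \<phi>[measurable]: "\<phi> \<in> borel_measurable borel"
    and fin: "(\<integral>\<^sup>+x. ennreal ((norm (\<phi> x))\<^sup>2) \<partial>lborel) < \<infinity>"
    and g: "l2_ftrans s \<phi> g" and s: "s\<^sup>2 = 1"
    and [measurable]: "\<And>n. \<kappa> n \<in> borel_measurable borel"
    and b: "\<And>n x. norm (\<kappa> n x) \<le> (1::real)" and lim: "\<And>x. (\<lambda>n. \<kappa> n x) \<longlonglongrightarrow> (1::complex)"
    and int: "\<And>n. integrable lborel (\<lambda>p. \<kappa> n p * \<phi> p)"
    and A[measurable]: "A \<in> sets borel"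
    and van: "\<And>n x. x \<in> A \<Longrightarrow> ftrans s (\<lambda>p. \<kappa> n p * \<phi> p) x = 0"
  shows "AE x in lborel. x \<in> A \<longrightarrow> g x = 0"
proof -
  have [measurable]: "g \<in> borel_measurable borel" using g by (simp add: l2_ftrans_def)
  let ?K = "ennreal (plancherel_const TYPE('a))"
  let ?N = "\<lambda>f. \<integral>\<^sup>+x. ennreal ((norm (f x :: complex))\<^sup>2) \<partial>(lborel :: 'a measure)"
  let ?I = "\<integral>\<^sup>+x. ennreal ((norm (g x))\<^sup>2) * indicator A x \<partial>lborel"
  let ?T = "\<lambda>n. ftrans s (\<lambda>p. \<kappa> n p * \<phi> p)"
  let ?F = "\<lambda>n. ftrans s (trunc n \<phi>)"
  let ?B = "\<lambda>n. 2 * ?N (\<lambda>x. ?F n x - g x) + 2 * (?K * (2 * ?N (\<lambda>x. \<phi> x - trunc n \<phi> x) + 2 * ?N (\<lambda>x. \<phi> x - \<kappa> n x * \<phi> x)))"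
  have le: "?I \<le> ?B n" for n
  proof -
    have tr: "integrable lborel (trunc n \<phi>)" using fin by (intro integrable_trunc) auto
    have "?I \<le> ?N (\<lambda>x. (g x - ?F n x) + (?F n x - ?T n x))"
      by (rule nn_integral_mono) (auto simp: indicator_def van)
    also have "\<dots> \<le> 2 * ?N (\<lambda>x. g x - ?F n x) + 2 * ?N (\<lambda>x. ?F n x - ?T n x)"
      by (rule nn_integral_norm_sq_add) auto
    also have "?N (\<lambda>x. g x - ?F n x) = ?N (\<lambda>x. ?F n x - g x)" by (simp add: norm_minus_commute)
    also have "?N (\<lambda>x. ?F n x - ?T n x) = ?N (ftrans s (\<lambda>p. trunc n \<phi> p - \<kappa> n p * \<phi> p))"
      by (simp add: ftrans_diff[OF tr int])
    also have "\<dots> \<le> ?K * ?N (\<lambda>p. trunc n \<phi> p - \<kappa> n p * \<phi> p)"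
      using tr int by (intro plancherel_le s) auto
    also have "?N (\<lambda>p. trunc n \<phi> p - \<kappa> n p * \<phi> p) = ?N (\<lambda>p. (trunc n \<phi> p - \<phi> p) + (\<phi> p - \<kappa> n p * \<phi> p))" by simp
    also have "\<dots> \<le> 2 * ?N (\<lambda>p. trunc n \<phi> p - \<phi> p) + 2 * ?N (\<lambda>p. \<phi> p - \<kappa> n p * \<phi> p)"
      by (rule nn_integral_norm_sq_add) auto
    also have "?N (\<lambda>p. trunc n \<phi> p - \<phi> p) = ?N (\<lambda>p. \<phi> p - trunc n \<phi> p)" by (simp add: norm_minus_commute)
    finally show ?thesis by (simp add: mult_left_mono add_left_mono)
  qed
  have "?B \<longlonglongrightarrow> 2 * 0 + 2 * (?K * (2 * 0 + 2 * 0))"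
    using g fin
    by (intro tendsto_add ennreal_tendsto_cmult trunc_L2_tendsto nn_integral_norm_sq_mult_tendsto_0 b lim)
      (auto simp: l2_ftrans_def)
  then have "?I \<le> 2 * 0 + 2 * (?K * (2 * 0 + 2 * 0))"
    by (rule LIMSEQ_le_const) (use le in auto)
  then have "?I = 0" by simp
  then have "AE x in lborel. ennreal ((norm (g x))\<^sup>2) * indicator A x = 0"
    by (subst (asm) nn_integral_0_iff_AE) auto
  then show ?thesis by eventually_elim (auto simp: indicator_def split: if_splits)
qed

lemma plancherel_const_pos: "plancherel_const TYPE('a::euclidean_space) > 0"
  using gauss_mass_pos[of 1, where 'a='a] by (simp add: plancherel_const_def)

lemma l2_ftrans_exists:
  fixes \<phi> :: "'a::euclidean_space \<Rightarrow> complex"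
  assumes [measurable]: "\<phi> \<in> borel_measurable borel"
    and fin: "(\<integral>\<^sup>+x. ennreal ((norm (\<phi> x))\<^sup>2) \<partial>lborel) < \<infinity>" and s: "s\<^sup>2 = 1"
  obtains g where "l2_ftrans s \<phi> g"
proof -
  let ?N = "\<lambda>f. \<integral>\<^sup>+x. ennreal ((norm (f x :: complex))\<^sup>2) \<partial>(lborel :: 'a measure)"
  let ?F = "\<lambda>n. ftrans s (trunc n \<phi>)"
  define K where "K = plancherel_const TYPE('a)"
  have K: "K > 0" unfolding K_def by (rule plancherel_const_pos)
  have tr: "integrable lborel (trunc n \<phi>)" for n using fin by (intro integrable_trunc) auto
  have "\<exists>g\<in>borel_measurable lborel. (\<lambda>n. ?N (\<lambda>x. ?F n x - g x)) \<longlonglongrightarrow> 0"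
  proof (rule riesz_fischer)
    \<comment> \<open>The triangle inequality for squared norms doubles the error of each truncation
      and the transform costs a factor K, so errors of \<epsilon>/(4 K) add up to K (2 \<epsilon>/(4
      K) + 2 \<epsilon>/(4 K)) = \<epsilon>.\<close>
    fix \<epsilon> :: real assume e: "\<epsilon> > 0"
    have "\<forall>\<^sub>F n in sequentially. ?N (\<lambda>x. \<phi> x - trunc n \<phi> x) < ennreal (\<epsilon> / (4 * K))"
      using trunc_L2_tendsto[of \<phi>] fin e K by (intro order_tendstoD(2)[of _ 0]) auto
    then obtain N where N: "\<And>n. n \<ge> N \<Longrightarrow> ?N (\<lambda>x. \<phi> x - trunc n \<phi> x) < ennreal (\<epsilon> / (4 * K))"
      by (auto simp: eventually_sequentially)
    have "?N (\<lambda>x. ?F m x - ?F n x) \<le> ennreal \<epsilon>" if "m \<ge> N" "n \<ge> N" for m n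
    proof -
      have "?N (\<lambda>x. ?F m x - ?F n x) = ?N (ftrans s (\<lambda>p. trunc m \<phi> p - trunc n \<phi> p))"
        by (simp add: ftrans_diff[OF tr tr])
      also have "\<dots> \<le> ennreal K * ?N (\<lambda>p. trunc m \<phi> p - trunc n \<phi> p)"
        unfolding K_def using tr by (intro plancherel_le s) auto
      also have "?N (\<lambda>p. trunc m \<phi> p - trunc n \<phi> p) = ?N (\<lambda>p. (trunc m \<phi> p - \<phi> p) + (\<phi> p - trunc n \<phi> p))" by simp
      also have "\<dots> \<le> 2 * ?N (\<lambda>p. trunc m \<phi> p - \<phi> p) + 2 * ?N (\<lambda>p. \<phi> p - trunc n \<phi> p)"
        by (rule nn_integral_norm_sq_add) auto
      also have "?N (\<lambda>p. trunc m \<phi> p - \<phi> p) = ?N (\<lambda>p. \<phi> p - trunc m \<phi> p)" by (simp add: norm_minus_commute)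
      also have "2 * ?N (\<lambda>p. \<phi> p - trunc m \<phi> p) + 2 * ?N (\<lambda>p. \<phi> p - trunc n \<phi> p)
          \<le> 2 * ennreal (\<epsilon> / (4 * K)) + 2 * ennreal (\<epsilon> / (4 * K))"
        by (intro add_mono mult_left_mono less_imp_le N that) auto
      also have "\<dots> = ennreal (\<epsilon> / K)"
        using e K by (simp add: ennreal_plus[symmetric] ennreal_mult[symmetric] del: ennreal_plus flip: ennreal_numeral)
      also have "ennreal K * ennreal (\<epsilon> / K) = ennreal \<epsilon>"
        using e K by (simp add: ennreal_mult[symmetric])
      finally show ?thesis by (simp add: mult_left_mono)
    qed
    then show "\<exists>N. \<forall>m\<ge>N. \<forall>n\<ge>N. ?N (\<lambda>x. ?F m x - ?F n x) \<le> ennreal \<epsilon>" by blast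
  qed auto
  then show thesis using that unfolding l2_ftrans_def by auto
qed

lemma ftrans_L2:
  fixes f :: "'a::euclidean_space \<Rightarrow> complex"
  assumes f: "integrable lborel f" and fin: "(\<integral>\<^sup>+x. ennreal ((norm (f x))\<^sup>2) \<partial>lborel) < \<infinity>" and s: "s\<^sup>2 = 1"
  shows "(\<integral>\<^sup>+x. ennreal ((norm (ftrans s f x))\<^sup>2) \<partial>lborel) < \<infinity>"
  using plancherel_le[OF f s] fin by (auto intro!: le_less_trans[OF plancherel_le[OF f s]] simp: ennreal_mult_less_top)

lemma l2_ftrans_L2:
  fixes \<phi> :: "'a::euclidean_space \<Rightarrow> complex"
  assumes [measurable]: "\<phi> \<in> borel_measurable borel"
    and fin: "(\<integral>\<^sup>+x. ennreal ((norm (\<phi> x))\<^sup>2) \<partial>lborel) < \<infinity>" and s: "s\<^sup>2 = 1"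
    and g: "l2_ftrans s \<phi> g"
  shows "(\<integral>\<^sup>+x. ennreal ((norm (g x))\<^sup>2) \<partial>lborel) < \<infinity>"
proof -
  have [measurable]: "g \<in> borel_measurable borel" using g by (simp add: l2_ftrans_def)
  let ?N = "\<lambda>f. \<integral>\<^sup>+x. ennreal ((norm (f x :: complex))\<^sup>2) \<partial>(lborel :: 'a measure)"
  let ?F = "\<lambda>n. ftrans s (trunc n \<phi>)"
  have "\<forall>\<^sub>F n in sequentially. ?N (\<lambda>x. ?F n x - g x) < 1"
    using g by (intro order_tendstoD(2)[of _ 0]) (auto simp: l2_ftrans_def)
  then obtain n where n: "?N (\<lambda>x. ?F n x - g x) < 1"
    by (auto simp: eventually_sequentially)
  have "?N g = ?N (\<lambda>x. (g x - ?F n x) + ?F n x)" by simp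
  also have "\<dots> \<le> 2 * ?N (\<lambda>x. g x - ?F n x) + 2 * ?N (?F n)" by (rule nn_integral_norm_sq_add) auto
  also have "?N (\<lambda>x. g x - ?F n x) = ?N (\<lambda>x. ?F n x - g x)" by (simp add: norm_minus_commute)
  finally have "?N g \<le> 2 * ?N (\<lambda>x. ?F n x - g x) + 2 * ?N (?F n)" .
  moreover have "?N (?F n) < \<infinity>"
  proof (rule ftrans_L2[OF _ _ s])
    show "integrable lborel (trunc n \<phi>)" using fin by (intro integrable_trunc) auto
    have "?N (trunc n \<phi>) \<le> ?N \<phi>"
      by (intro nn_integral_mono) (auto simp: trunc_def indicator_def)
    then show "?N (trunc n \<phi>) < \<infinity>" using fin by (rule le_less_trans)
  qed
  moreover have "?N (\<lambda>x. ?F n x - g x) < \<infinity>" using n less_trans[OF n, of \<infinity>] by simp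
  ultimately show ?thesis
    by (auto simp: ennreal_mult_less_top elim!: le_less_trans)
qed

text \<open>The Gaussian identity passes to the limit of the truncations: on the left by
  Cauchy-Schwarz against the square-integrable Gaussian, on the right by dominated convergence, as
  the truncations stay below B.\<close>

lemma ftrans_gauss_weight_convolution:
  fixes \<phi> g :: "'a::euclidean_space \<Rightarrow> complex"
  assumes [measurable]: "\<phi> \<in> borel_measurable borel" and B: "\<And>p. norm (\<phi> p) \<le> B"
    and fin: "(\<integral>\<^sup>+x. ennreal ((norm (\<phi> x))\<^sup>2) \<partial>lborel) < \<infinity>" and s: "s\<^sup>2 = 1"
    and g: "l2_ftrans s \<phi> g" and gi: "integrable lborel g" and e: "\<epsilon> > 0"
  shows "(\<integral>x. cis (- s * (p \<bullet> x)) * of_real (gauss \<epsilon> x) * g x \<partial>lborel)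
    = (\<integral>q. of_real (gauss_mass TYPE('a) \<epsilon> * gauss (1 / (4 * \<epsilon>)) (p - q)) * \<phi> q \<partial>lborel)" (is "?L = ?R")
proof -
  have [measurable]: "g \<in> borel_measurable borel" using g by (simp add: l2_ftrans_def)
  let ?F = "\<lambda>n. ftrans s (trunc n \<phi>)"
  let ?A = "\<lambda>n. \<integral>x. cis (- s * (p \<bullet> x)) * of_real (gauss \<epsilon> x) * ?F n x \<partial>lborel"
  have tr: "integrable lborel (trunc n \<phi>)" for n using fin by (intro integrable_trunc) auto
  have wF: "integrable lborel (\<lambda>x. cis (- s * (p \<bullet> x)) * of_real (gauss \<epsilon> x) * ?F n x)" for n
    using integrable_bounded_mult[OF integrable_cis_gauss[OF e, of "- s" p], of "?F n", OF _ norm_ftrans_le]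
    by (simp add: mult_ac)
  have wg: "integrable lborel (\<lambda>x. cis (- s * (p \<bullet> x)) * of_real (gauss \<epsilon> x) * g x)"
    by (rule integrable_bounded_mult[OF gi, of _ 1])
      (auto simp: norm_mult abs_of_pos[OF gauss_pos] gauss_le_1 e less_imp_le)
  let ?G = "\<integral>\<^sup>+x. (ennreal (gauss \<epsilon> x))\<^sup>2 \<partial>(lborel :: 'a measure)"
  let ?N = "\<lambda>n. \<integral>\<^sup>+x. ennreal ((norm (?F n x - g x))\<^sup>2) \<partial>lborel"
  have "?A \<longlonglongrightarrow> ?L"
  proof -
    have le: "ennreal ((norm (?A n - ?L))\<^sup>2) \<le> ?G * ?N n" for n
    proof -
      have eq: "?A n - ?L = (\<integral>x. cis (- s * (p \<bullet> x)) * of_real (gauss \<epsilon> x) * (?F n x - g x) \<partial>lborel)"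
        by (subst Bochner_Integration.integral_diff[OF wF wg, symmetric]) (simp add: right_diff_distrib)
      have int: "integrable lborel (\<lambda>x. cis (- s * (p \<bullet> x)) * of_real (gauss \<epsilon> x) * (?F n x - g x))"
        using Bochner_Integration.integrable_diff[OF wF wg] by (simp add: right_diff_distrib)
      have "ennreal (norm (?A n - ?L)) \<le> (\<integral>\<^sup>+x. ennreal (norm (cis (- s * (p \<bullet> x)) * of_real (gauss \<epsilon> x) * (?F n x - g x))) \<partial>lborel)"
        unfolding eq by (rule integral_norm_bound_ennreal[OF int])
      also have "\<dots> = (\<integral>\<^sup>+x. ennreal (gauss \<epsilon> x) * ennreal (norm (?F n x - g x)) \<partial>lborel)"
        by (intro nn_integral_cong) (simp add: norm_mult abs_of_pos[OF gauss_pos] ennreal_mult less_imp_le[OF gauss_pos])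
      finally have "(ennreal (norm (?A n - ?L)))\<^sup>2 \<le> (\<integral>\<^sup>+x. ennreal (gauss \<epsilon> x) * ennreal (norm (?F n x - g x)) \<partial>lborel)\<^sup>2"
        by (intro power_mono) auto
      also have "\<dots> \<le> ?G * (\<integral>\<^sup>+x. (ennreal (norm (?F n x - g x)))\<^sup>2 \<partial>lborel)"
        by (rule Cauchy_Schwarz_nn_integral) auto
      finally show ?thesis by (simp add: ennreal_power)
    qed
    have G: "?G < \<infinity>"
    proof -
      have "?G \<le> (\<integral>\<^sup>+x. ennreal (gauss \<epsilon> x) \<partial>(lborel :: 'a measure))"
      proof (rule nn_integral_mono)
        fix x :: 'a
        have "(gauss \<epsilon> x)\<^sup>2 \<le> gauss \<epsilon> x"
          using gauss_le_1[of \<epsilon> x] gauss_pos[of \<epsilon> x] e by (simp add: power2_eq_square mult_left_le)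
        then show "(ennreal (gauss \<epsilon> x))\<^sup>2 \<le> ennreal (gauss \<epsilon> x)"
          by (simp add: ennreal_power less_imp_le[OF gauss_pos] ennreal_leI)
      qed
      also have "\<dots> < \<infinity>" using nn_integral_gauss[OF e, where 'a='a] by simp
      finally show ?thesis .
    qed
    have "(\<lambda>n. ?G * ?N n) \<longlonglongrightarrow> ?G * 0"
      using g G by (intro ennreal_tendsto_cmult) (auto simp: l2_ftrans_def)
    then have "(\<lambda>n. ?G * ?N n) \<longlonglongrightarrow> 0" by simp
    then have "(\<lambda>n. ennreal ((norm (?A n - ?L))\<^sup>2)) \<longlonglongrightarrow> 0"
      by (rule tendsto_sandwich[OF _ _ tendsto_const, rotated 2]) (use le in auto)
    then have "(\<lambda>n. (norm (?A n - ?L))\<^sup>2) \<longlonglongrightarrow> 0" by (simp add: ennreal_tendsto_0_iff)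
    then have "(\<lambda>n. sqrt ((norm (?A n - ?L))\<^sup>2)) \<longlonglongrightarrow> sqrt 0" by (rule tendsto_real_sqrt)
    then have "(\<lambda>n. norm (?A n - ?L)) \<longlonglongrightarrow> 0" by simp
    then show ?thesis using Lim_null tendsto_norm_zero_iff by blast
  qed
  moreover have "?A \<longlonglongrightarrow> ?R"
    unfolding ftrans_gauss_convolution[OF tr e s]
  proof (rule integral_dominated_convergence)
    have "integrable lborel (\<lambda>q. gauss (1 / (4 * \<epsilon>)) (p - q))"
    proof -
      have "integrable (distr lborel borel ((+) (- p))) (gauss (1 / (4 * \<epsilon>)))"
        unfolding lborel_distr_plus using e by (intro integrable_gauss) auto
      then have "integrable lborel (\<lambda>q. gauss (1 / (4 * \<epsilon>)) (- p + q))"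
        by (subst (asm) integrable_distr_eq) auto
      then show ?thesis by (simp add: gauss_diff_sym[of _ p])
    qed
    then show "integrable lborel (\<lambda>q. gauss_mass TYPE('a) \<epsilon> * gauss (1 / (4 * \<epsilon>)) (p - q) * B)" by simp
    show "AE q in lborel. norm (complex_of_real (gauss_mass TYPE('a) \<epsilon> * gauss (1 / (4 * \<epsilon>)) (p - q)) * trunc n \<phi> q)
        \<le> gauss_mass TYPE('a) \<epsilon> * gauss (1 / (4 * \<epsilon>)) (p - q) * B" for n
    proof (rule AE_I2)
      fix q
      have "norm (trunc n \<phi> q) \<le> B" using B[of q] norm_ge_zero[of "\<phi> q"] order_trans[OF norm_ge_zero B]
        by (auto simp: trunc_def indicator_def)
      then show "norm (complex_of_real (gauss_mass TYPE('a) \<epsilon> * gauss (1 / (4 * \<epsilon>)) (p - q)) * trunc n \<phi> q)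
        \<le> gauss_mass TYPE('a) \<epsilon> * gauss (1 / (4 * \<epsilon>)) (p - q) * B"
        using gauss_mass_pos[OF e, where 'a='a] gauss_pos[of "1 / (4 * \<epsilon>)" "p - q"]
        by (simp add: norm_mult abs_of_pos mult_left_mono)
    qed
    show "AE q in lborel. (\<lambda>n. complex_of_real (gauss_mass TYPE('a) \<epsilon> * gauss (1 / (4 * \<epsilon>)) (p - q)) * trunc n \<phi> q)
       \<longlonglongrightarrow> complex_of_real (gauss_mass TYPE('a) \<epsilon> * gauss (1 / (4 * \<epsilon>)) (p - q)) * \<phi> q"
      by (intro AE_I2 tendsto_intros trunc_tendsto)
  qed auto
  ultimately show ?thesis by (rule LIMSEQ_unique)
qed

text \<open>Gaussian summation. Integrability of g lets the weight be removed on the left;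
  continuity of \<phi> gives the limit on the right at every p and not just almost everywhere, which
  continuation along a single line requires.\<close>

theorem l2_ftrans_inversion:
  fixes \<phi> g :: "'a::euclidean_space \<Rightarrow> complex"
  assumes cont: "continuous_on UNIV \<phi>" and B: "\<And>p. norm (\<phi> p) \<le> B"
    and fin: "(\<integral>\<^sup>+x. ennreal ((norm (\<phi> x))\<^sup>2) \<partial>lborel) < \<infinity>" and s: "s\<^sup>2 = 1"
    and g: "l2_ftrans s \<phi> g" and gi: "integrable lborel g"
  shows "ftrans (- s) g p = of_real (plancherel_const TYPE('a)) * \<phi> p"
proof -
  have \<phi>m[measurable]: "\<phi> \<in> borel_measurable borel" using cont by (rule borel_measurable_continuous_onI)
  have gm[measurable]: "g \<in> borel_measurable borel" using g by (simp add: l2_ftrans_def)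
  define c where "c n = 1 / real (Suc n)" for n
  have c: "c n > 0" for n by (simp add: c_def)
  have c0: "c \<longlonglongrightarrow> 0" unfolding c_def by (rule LIMSEQ_Suc[OF lim_1_over_n])
  let ?m = "gauss_mass TYPE('a) 1"
  let ?L = "\<lambda>n. \<integral>x. cis (- s * (p \<bullet> x)) * of_real (gauss ((c n)\<^sup>2) x) * g x \<partial>lborel"
  \<comment> \<open>The substitution q = p + 2 c u gives the kernel width 1 for every n; its mass
    and the Jacobian combine to 2^d times \<open>?m\<close>.\<close>
  have R: "?L n = of_real (2 ^ DIM('a) * ?m) * (\<integral>u. of_real (gauss 1 u) * \<phi> (p + (2 * c n) *\<^sub>R u) \<partial>lborel)" for n
  proof -
    let ?e = "(c n)\<^sup>2"
    have m: "?m = c n ^ DIM('a) * gauss_mass TYPE('a) ?e"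
      using gauss_mass_scale[of "c n" 1, where 'a='a] c[of n] by simp
    have "?L n = (\<integral>q. of_real (gauss_mass TYPE('a) ?e * gauss (1 / (4 * ?e)) (p - q)) * \<phi> q \<partial>lborel)"
      using c[of n] by (intro ftrans_gauss_weight_convolution[OF \<phi>m B fin s g gi]) simp
    also have "\<dots> = \<bar>2 * c n\<bar> ^ DIM('a) *\<^sub>R
        (\<integral>u. of_real (gauss_mass TYPE('a) ?e * gauss (1 / (4 * ?e)) (p - (p + (2 * c n) *\<^sub>R u))) * \<phi> (p + (2 * c n) *\<^sub>R u) \<partial>lborel)"
      using c[of n] by (intro integral_lborel_affine) auto
    also have "(\<lambda>u. complex_of_real (gauss_mass TYPE('a) ?e * gauss (1 / (4 * ?e)) (p - (p + (2 * c n) *\<^sub>R u))) * \<phi> (p + (2 * c n) *\<^sub>R u))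
       = (\<lambda>u. of_real (gauss_mass TYPE('a) ?e) * (of_real (gauss 1 u) * \<phi> (p + (2 * c n) *\<^sub>R u)))"
    proof
      fix u :: 'a
      have "gauss (1 / (4 * ?e)) (p - (p + (2 * c n) *\<^sub>R u)) = gauss 1 u"
        using c[of n] by (simp add: gauss_def power_mult_distrib)
      then show "complex_of_real (gauss_mass TYPE('a) ?e * gauss (1 / (4 * ?e)) (p - (p + (2 * c n) *\<^sub>R u))) * \<phi> (p + (2 * c n) *\<^sub>R u)
         = of_real (gauss_mass TYPE('a) ?e) * (of_real (gauss 1 u) * \<phi> (p + (2 * c n) *\<^sub>R u))"
        by (simp add: mult_ac)
    qed
    also have "(\<integral>u. of_real (gauss_mass TYPE('a) ?e) * (of_real (gauss 1 u) * \<phi> (p + (2 * c n) *\<^sub>R u)) \<partial>lborel)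
        = of_real (gauss_mass TYPE('a) ?e) * (\<integral>u. of_real (gauss 1 u) * \<phi> (p + (2 * c n) *\<^sub>R u) \<partial>lborel)"
      by (rule integral_mult_right_zero)
    finally show ?thesis
      using c[of n] m by (simp add: scaleR_conv_of_real power_mult_distrib mult_ac)
  qed
  have "(\<lambda>n. \<integral>u. of_real (gauss 1 u) * \<phi> (p + (2 * c n) *\<^sub>R u) \<partial>lborel) \<longlonglongrightarrow> (\<integral>u. of_real (gauss 1 (u::'a)) * \<phi> p \<partial>lborel)"
  proof (rule integral_dominated_convergence)
    show "integrable lborel (\<lambda>u::'a. gauss 1 u * B)" using integrable_gauss[of 1] by auto
    show "AE u in lborel. norm (complex_of_real (gauss 1 u) * \<phi> (p + (2 * c n) *\<^sub>R u)) \<le> gauss 1 u * B" for n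
      using B by (auto simp: norm_mult abs_of_pos[OF gauss_pos] intro!: mult_left_mono less_imp_le[OF gauss_pos])
    show "AE u in lborel. (\<lambda>n. complex_of_real (gauss 1 u) * \<phi> (p + (2 * c n) *\<^sub>R u)) \<longlonglongrightarrow> of_real (gauss 1 u) * \<phi> p"
    proof (intro AE_I2 tendsto_mult tendsto_const)
      fix u :: 'a
      have "(\<lambda>n. p + (2 * c n) *\<^sub>R u) \<longlonglongrightarrow> p + (2 * 0) *\<^sub>R u" by (intro tendsto_intros c0)
      then have "(\<lambda>n. p + (2 * c n) *\<^sub>R u) \<longlonglongrightarrow> p" by simp
      moreover have "isCont \<phi> p" using cont by (simp add: continuous_on_eq_continuous_at)
      ultimately show "(\<lambda>n. \<phi> (p + (2 * c n) *\<^sub>R u)) \<longlonglongrightarrow> \<phi> p" by (rule isCont_tendsto_compose[rotated])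
    qed
  qed auto
  then have L1: "?L \<longlonglongrightarrow> of_real (2 ^ DIM('a) * ?m) * (\<integral>u. of_real (gauss 1 (u::'a)) * \<phi> p \<partial>lborel)"
    unfolding R by (rule tendsto_mult[OF tendsto_const])
  have m: "(\<integral>u. complex_of_real (gauss 1 (u::'a)) * \<phi> p \<partial>lborel) = of_real ?m * \<phi> p"
    by (simp add: gauss_mass_def)
  have L2: "?L \<longlonglongrightarrow> ftrans (- s) g p"
    unfolding ftrans_def
  proof (rule integral_dominated_convergence)
    show "integrable lborel (\<lambda>x. norm (g x))" using gi by simp
    show "AE x in lborel. norm (cis (- s * (p \<bullet> x)) * complex_of_real (gauss ((c n)\<^sup>2) x) * g x) \<le> norm (g x)" for n
      by (intro AE_I2) (auto simp: norm_mult abs_of_pos[OF gauss_pos] gauss_le_1 intro!: mult_left_le_one_le less_imp_le[OF gauss_pos])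
    show "AE x in lborel. (\<lambda>n. cis (- s * (p \<bullet> x)) * complex_of_real (gauss ((c n)\<^sup>2) x) * g x) \<longlonglongrightarrow> cis (- s * (p \<bullet> x)) * g x"
    proof (rule AE_I2)
      fix x
      have "(\<lambda>n. cis (- s * (p \<bullet> x)) * complex_of_real (gauss ((c n)\<^sup>2) x) * g x) \<longlonglongrightarrow> cis (- s * (p \<bullet> x)) * complex_of_real (exp (- (0\<^sup>2) * (norm x)\<^sup>2)) * g x"
        unfolding gauss_def by (intro tendsto_intros c0)
      then show "(\<lambda>n. cis (- s * (p \<bullet> x)) * complex_of_real (gauss ((c n)\<^sup>2) x) * g x) \<longlonglongrightarrow> cis (- s * (p \<bullet> x)) * g x" by simp
    qed
  qed auto
  have "ftrans (- s) g p = of_real (2 ^ DIM('a) * ?m) * (of_real ?m * \<phi> p)"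
    using LIMSEQ_unique[OF L2 L1] unfolding m .
  then show ?thesis by (simp add: plancherel_const_def power2_eq_square)
qed

section \<open>A Paley--Wiener criterion for half spaces\<close>

text \<open>The zero of 1 + \<i> \<delta> w is \<i>/\<delta>, with imaginary part at least 2, away
  from the half plane Im w \<le> 1. For |w| \<ge> 2/\<delta> the linear term dominates; otherwise
  the real part, at least 1/2, suffices.\<close>

lemma norm_one_plus_imult_ge:
  assumes "0 < \<delta>" "\<delta> \<le> 1/2" "Im w \<le> 1"
  shows "\<delta> / 8 * (1 + norm w) \<le> norm (1 + \<i> * of_real \<delta> * w)"
proof -
  have 1: "1/2 \<le> norm (1 + \<i> * of_real \<delta> * w)"
  proof -
    have "\<delta> * Im w \<le> \<delta> * 1" using assms by (intro mult_left_mono) auto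
    then have "\<delta> * Im w \<le> 1/2" using assms by linarith
    then have "1/2 \<le> Re (1 + \<i> * of_real \<delta> * w)" by simp
    then show ?thesis using complex_Re_le_cmod order_trans by blast
  qed
  have 2: "\<delta> * norm w - 1 \<le> norm (1 + \<i> * of_real \<delta> * w)"
  proof -
    have "norm (\<i> * of_real \<delta> * w) \<le> norm (1 + \<i> * of_real \<delta> * w) + norm (1::complex)"
      by (metis add.commute add_diff_cancel_left' norm_triangle_ineq4)
    then show ?thesis using assms by (simp add: norm_mult)
  qed
  show ?thesis
  proof (cases "\<delta> * norm w \<ge> 2")
    case True
    have "\<delta> / 8 * (1 + norm w) = \<delta> / 8 + \<delta> * norm w / 8" by (simp add: field_simps)
    also have "\<dots> \<le> \<delta> * norm w - 1" using True assms by linarith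
    finally show ?thesis using 2 by linarith
  next
    case False
    have "\<delta> / 8 * (1 + norm w) = \<delta> / 8 + \<delta> * norm w / 8" by (simp add: field_simps)
    also have "\<dots> \<le> 1/2" using False assms by linarith
    finally show ?thesis using 1 by linarith
  qed
qed

text \<open>Completing the square bounds the left side by a multiple of exp(-N r), and exp(-r) \<le>
  1/(1 + r). The Gaussian thus pays both for an exponential loss and for N powers of decay.\<close>

lemma exp_quadratic_bound:
  fixes r C \<delta> :: real
  assumes "\<delta> > 0" "r \<ge> 0"
  shows "exp (C * r) * exp (- \<delta> * r\<^sup>2) \<le> exp ((C + real N)\<^sup>2 / (4 * \<delta>)) * inverse ((1 + r) ^ N)"
proof -
  have "0 \<le> (C + real N - 2 * \<delta> * r)\<^sup>2 / (4 * \<delta>)" using assms by simp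
  also have "\<dots> = (C + real N)\<^sup>2 / (4 * \<delta>) - (C + real N) * r + \<delta> * r\<^sup>2"
    using assms by (simp add: field_simps power2_eq_square)
  finally have "C * r + - \<delta> * r\<^sup>2 \<le> (C + real N)\<^sup>2 / (4 * \<delta>) + - (real N * r)" by (simp add: algebra_simps)
  then have "exp (C * r + - \<delta> * r\<^sup>2) \<le> exp ((C + real N)\<^sup>2 / (4 * \<delta>) + - (real N * r))" by simp
  then have 1: "exp (C * r) * exp (- \<delta> * r\<^sup>2) \<le> exp ((C + real N)\<^sup>2 / (4 * \<delta>)) * exp (- (real N * r))"
    unfolding exp_add .
  have "(1 + r) ^ N \<le> exp r ^ N" using assms by (intro power_mono exp_ge_add_one_self) auto
  then have "(1 + r) ^ N \<le> exp (real N * r)" by (simp add: exp_of_nat_mult)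
  then have "exp (- (real N * r)) \<le> inverse ((1 + r) ^ N)"
    unfolding exp_minus using assms by (intro le_imp_inverse_le) auto
  then show ?thesis using 1 by (meson exp_ge_zero mult_left_mono order_trans)
qed

definition perp :: "'a::real_inner \<Rightarrow> 'a \<Rightarrow> 'a" where
  "perp e p = p - (p \<bullet> e) *\<^sub>R e"

lemma inner_perp: "norm e = 1 \<Longrightarrow> perp e p \<bullet> e = 0"
  by (simp add: perp_def inner_diff_left norm_eq_1)

lemma perp_add: "norm e = 1 \<Longrightarrow> perp e (p + s *\<^sub>R e) = perp e p"
  by (simp add: perp_def inner_add_left norm_eq_1 scaleR_add_left)

lemma norm_le_perp: "norm e = 1 \<Longrightarrow> norm p \<le> \<bar>p \<bullet> e\<bar> + norm (perp e p)"
  using norm_triangle_ineq[of "(p \<bullet> e) *\<^sub>R e" "perp e p"] by (simp add: perp_def)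

lemma borel_measurable_perp[measurable]: "perp e \<in> borel_measurable borel"
  for e :: "'a::euclidean_space"
  unfolding perp_def by measurable

text \<open>The multiplier below is holomorphic and bounded in the lower half plane, so that it
  regularizes without moving the edge of the support.\<close>

definition regularizer :: "'a::euclidean_space \<Rightarrow> nat \<Rightarrow> real \<Rightarrow> 'a \<Rightarrow> complex \<Rightarrow> complex" where
  "regularizer e K \<delta> p w = of_real (exp (- \<delta> * (norm (perp e p))\<^sup>2)) / (1 + \<i> * of_real \<delta> * (w + of_real (p \<bullet> e))) ^ K"

lemma norm_regularizer_le_1:
  assumes "\<delta> > 0"
  shows "norm (regularizer e K \<delta> p 0) \<le> 1"
proof -
  have "1 = Re (1 + \<i> * of_real \<delta> * of_real (p \<bullet> e))" by simp
  also have "\<dots> \<le> norm (1 + \<i> * of_real \<delta> * of_real (p \<bullet> e))" by (rule complex_Re_le_cmod)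
  finally have "1 \<le> norm (1 + \<i> * of_real \<delta> * of_real (p \<bullet> e)) ^ K" by (rule one_le_power)
  moreover have "exp (- \<delta> * (norm (perp e p))\<^sup>2) \<le> 1" using assms by simp
  ultimately have "exp (- \<delta> * (norm (perp e p))\<^sup>2) / norm (1 + \<i> * of_real \<delta> * of_real (p \<bullet> e)) ^ K \<le> 1"
    by (smt (verit, best) divide_le_eq_1_pos)
  then show ?thesis by (simp add: regularizer_def norm_divide norm_power)
qed

lemma AE_off_hyperplane:
  fixes e :: "'a::euclidean_space"
  assumes "norm e = 1"
  shows "AE x in lborel. x \<bullet> e \<noteq> a"
proof -
  have "negligible {x. e \<bullet> x = a}" using assms by (intro negligible_hyperplane) auto
  then have "{x. e \<bullet> x = a} \<in> null_sets lebesgue" by (simp add: negligible_iff_null_sets)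
  moreover have "{x. e \<bullet> x = a} \<in> sets borel" by measurable
  ultimately have "{x. e \<bullet> x = a} \<in> null_sets lborel"
    by (metis null_sets_completion_iff sets_lborel)
  from AE_not_in[OF this] show ?thesis by (simp add: inner_commute)
qed

text \<open>\<open>Fc p w\<close> stands for the value at the complex point p + w e, which is what
  \<open>shift\<close> expresses. The bound is in terms of the orthogonal part of p and the
  coordinate w + p \<bullet> e along its line. It reaches up to Im w \<le> 1, so that the real axis
  is interior to the region where the contour is moved.\<close>

locale halfspace_extension =
  fixes e :: "'a::euclidean_space" and Fc :: "'a \<Rightarrow> complex \<Rightarrow> complex" and C a :: real and k :: nat
  assumes e: "norm e = 1" and C: "C \<ge> 0"
    and hol: "\<And>p. Fc p holomorphic_on UNIV"
    and shift: "\<And>p s w. Fc (p + s *\<^sub>R e) w = Fc p (w + of_real s)"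
    and meas[measurable]: "\<And>w. (\<lambda>p. Fc p w) \<in> borel_measurable borel"
    and bound: "\<And>p w. Im w \<le> 1 \<Longrightarrow>
      norm (Fc p w) \<le> C * (1 + norm (w + of_real (p \<bullet> e))) ^ k * exp (C * norm (perp e p)) * exp (a * Im w)"
begin

text \<open>Of the powers in the denominator, k pay for the growth of \<open>Fc\<close> and
  \<open>2 * DIM('a)\<close> remain for integrability.\<close>

abbreviation "reg \<equiv> regularizer e (k + 2 * DIM('a))"

lemma reg_bound:
  assumes \<delta>: "0 < \<delta>" "\<delta> \<le> 1/2"
  obtains L where "L \<ge> 0" and "\<And>p w. Im w \<le> 1 \<Longrightarrow> norm (Fc p w * reg \<delta> p w)
    \<le> L * (1 + \<bar>Re w\<bar>) ^ (2 * DIM('a)) * exp (a * Im w) * inverse ((1 + norm p) ^ (2 * DIM('a)))"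
proof -
  define N where "N = 2 * DIM('a)"
  define L where "L = C * inverse ((\<delta> / 8) ^ (k + N)) * exp ((C + real N)\<^sup>2 / (4 * \<delta>))"
  have L: "L \<ge> 0" unfolding L_def using C \<delta> by simp
  have "norm (Fc p w * reg \<delta> p w) \<le> L * (1 + \<bar>Re w\<bar>) ^ N * exp (a * Im w) * inverse ((1 + norm p) ^ N)"
    if w: "Im w \<le> 1" for p w
  proof -
    define u where "u = 1 + norm (w + of_real (p \<bullet> e))"
    define q where "q = norm (perp e p)"
    have u: "u \<ge> 1" by (simp add: u_def)
    have q: "q \<ge> 0" by (simp add: q_def)
    have den: "(\<delta> / 8 * u) ^ (k + N) \<le> norm (1 + \<i> * of_real \<delta> * (w + of_real (p \<bullet> e))) ^ (k + N)"
      unfolding u_def using \<delta> w by (intro power_mono norm_one_plus_imult_ge) auto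
    have pos: "0 < (\<delta> / 8 * u) ^ (k + N)" using \<delta> u by simp
    \<comment> \<open>Decay in the coordinate w + p \<bullet> e is traded for decay in p \<bullet>
      e. The price, powers of 1 + |Re w|, is harmless: w is later confined to a disc or to the
      imaginary axis.\<close>
    have upe: "inverse u \<le> (1 + \<bar>Re w\<bar>) * inverse (1 + \<bar>p \<bullet> e\<bar>)"
    proof -
      have "\<bar>Re w + p \<bullet> e\<bar> \<le> norm (w + of_real (p \<bullet> e))" using abs_Re_le_cmod[of "w + of_real (p \<bullet> e)"] by simp
      then have "1 + \<bar>p \<bullet> e\<bar> \<le> u + \<bar>Re w\<bar> * 1" unfolding u_def by linarith
      also have "\<dots> \<le> u + \<bar>Re w\<bar> * u" using u by (intro add_left_mono mult_left_mono) auto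
      finally have "1 + \<bar>p \<bullet> e\<bar> \<le> (1 + \<bar>Re w\<bar>) * u" by (simp add: algebra_simps)
      then show ?thesis using u by (simp add: field_simps)
    qed
    have "1 + norm p \<le> (1 + \<bar>p \<bullet> e\<bar>) * (1 + q)"
      using norm_le_perp[OF e, of p] q by (simp add: algebra_simps q_def[symmetric]) (smt (verit) abs_ge_zero mult_nonneg_nonneg)
    then have "inverse ((1 + \<bar>p \<bullet> e\<bar>) * (1 + q)) \<le> inverse (1 + norm p)"
      by (intro le_imp_inverse_le) (auto intro: add_pos_nonneg)
    then have pq: "inverse (1 + \<bar>p \<bullet> e\<bar>) * inverse (1 + q) \<le> inverse (1 + norm p)" by simp
    have "norm (Fc p w * reg \<delta> p w) = norm (Fc p w) * exp (- \<delta> * q\<^sup>2) *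
        inverse (norm (1 + \<i> * of_real \<delta> * (w + of_real (p \<bullet> e))) ^ (k + N))"
      by (simp add: regularizer_def norm_mult norm_inverse norm_power q_def N_def divide_inverse)
    also have "\<dots> \<le> (C * u ^ k * exp (C * q) * exp (a * Im w)) * exp (- \<delta> * q\<^sup>2) * inverse ((\<delta> / 8 * u) ^ (k + N))"
      using bound[OF w, of p] C u unfolding u_def[symmetric] q_def[symmetric]
      by (intro mult_mono le_imp_inverse_le[OF den pos] order_refl) auto
    also have "\<dots> = C * inverse ((\<delta> / 8) ^ (k + N)) * exp (a * Im w) * (inverse u) ^ N * (exp (C * q) * exp (- \<delta> * q\<^sup>2))"
      using u \<delta> by (simp add: power_mult_distrib power_add power_inverse field_simps)
    also have "\<dots> \<le> C * inverse ((\<delta> / 8) ^ (k + N)) * exp (a * Im w) * ((1 + \<bar>Re w\<bar>) * inverse (1 + \<bar>p \<bullet> e\<bar>)) ^ N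
        * (exp ((C + real N)\<^sup>2 / (4 * \<delta>)) * inverse ((1 + q) ^ N))"
      using C \<delta> u by (intro mult_mono power_mono upe exp_quadratic_bound \<delta> q order_refl) auto
    also have "\<dots> = L * (1 + \<bar>Re w\<bar>) ^ N * exp (a * Im w) * (inverse (1 + \<bar>p \<bullet> e\<bar>) * inverse (1 + q)) ^ N"
      by (simp add: L_def power_mult_distrib power_inverse mult_ac)
    also have "\<dots> \<le> L * (1 + \<bar>Re w\<bar>) ^ N * exp (a * Im w) * (inverse (1 + norm p)) ^ N"
      using L q by (intro mult_left_mono power_mono pq) auto
    finally show ?thesis by (simp add: power_inverse)
  qed
  then show thesis using that L unfolding N_def by blast
qed

lemma reg_meas[measurable]: "(\<lambda>p. reg \<delta> p w) \<in> borel_measurable borel"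
  unfolding regularizer_def by measurable

lemma integrable_reg:
  assumes \<delta>: "0 < \<delta>" "\<delta> \<le> 1/2"
  shows "integrable lborel (\<lambda>p. reg \<delta> p 0 * Fc p 0)"
proof -
  obtain L where L: "L \<ge> 0" "\<And>p w. Im w \<le> 1 \<Longrightarrow> norm (Fc p w * reg \<delta> p w)
    \<le> L * (1 + \<bar>Re w\<bar>) ^ (2 * DIM('a)) * exp (a * Im w) * inverse ((1 + norm p) ^ (2 * DIM('a)))"
    using reg_bound[OF \<delta>] by metis
  show ?thesis
  proof (rule Bochner_Integration.integrable_bound)
    show "integrable lborel (\<lambda>p::'a. L * inverse ((1 + norm p) ^ (2 * DIM('a))))"
      using integrable_inverse_power_norm by auto
    show "AE p in lborel. norm (reg \<delta> p 0 * Fc p 0) \<le> norm (L * inverse ((1 + norm p) ^ (2 * DIM('a))))"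
      using L(2)[of 0] by (auto intro!: AE_I2 order_trans[OF _ abs_ge_self] simp: mult.commute)
  qed measurable
qed

text \<open>Moving the contour: by translation invariance the integral over p does not change under
  a real shift w, hence by the identity theorem it is constant on Im w < 1. At w = -\<i> t it is
  O(exp(-(a - x \<bullet> e) t)), so the constant is 0.\<close>

lemma ftrans_reg_vanish:
  assumes \<delta>: "0 < \<delta>" "\<delta> \<le> 1/2" and x: "x \<bullet> e < a"
  shows "ftrans 1 (\<lambda>p. reg \<delta> p 0 * Fc p 0) x = 0"
proof -
  define N where "N = 2 * DIM('a)"
  define G where "G p w = exp (\<i> * (of_real (x \<bullet> p) + w * of_real (x \<bullet> e))) * (Fc p w * reg \<delta> p w)" for p w
  define I where "I w = (\<integral>p. G p w \<partial>lborel)" for w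
  define U where "U = {w. Im w < 1}"
  define c where "c = a - x \<bullet> e"
  have c: "c > 0" using x by (simp add: c_def)
  obtain L where L: "L \<ge> 0" and Lb: "\<And>p w. Im w \<le> 1 \<Longrightarrow> norm (Fc p w * reg \<delta> p w)
    \<le> L * (1 + \<bar>Re w\<bar>) ^ N * exp (a * Im w) * inverse ((1 + norm p) ^ N)"
    using reg_bound[OF \<delta>] unfolding N_def by metis
  have J: "integrable lborel (\<lambda>p::'a. inverse ((1 + norm p) ^ N))"
    unfolding N_def by (rule integrable_inverse_power_norm)
  define JJ where "JJ = (\<integral>p. inverse ((1 + norm (p::'a)) ^ N) \<partial>lborel)"
  have Gb: "norm (G p w) \<le> L * (1 + \<bar>Re w\<bar>) ^ N * exp (c * Im w) * inverse ((1 + norm p) ^ N)" if "Im w \<le> 1" for p w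
  proof -
    have "norm (G p w) = exp (- (Im w * (x \<bullet> e))) * norm (Fc p w * reg \<delta> p w)"
      by (simp add: G_def norm_mult)
    also have "\<dots> \<le> exp (- (Im w * (x \<bullet> e))) * (L * (1 + \<bar>Re w\<bar>) ^ N * exp (a * Im w) * inverse ((1 + norm p) ^ N))"
      by (intro mult_left_mono Lb that) auto
    also have "\<dots> = L * (1 + \<bar>Re w\<bar>) ^ N * (exp (a * Im w) * exp (- (Im w * (x \<bullet> e)))) * inverse ((1 + norm p) ^ N)"
      by (simp only: mult_ac)
    also have "exp (a * Im w) * exp (- (Im w * (x \<bullet> e))) = exp (c * Im w)"
      unfolding exp_add[symmetric] c_def by (simp add: algebra_simps)
    finally show ?thesis .
  qed
  have oU: "open U" unfolding U_def by (rule open_halfspace_Im_lt)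
  have Ihol: "I holomorphic_on U"
    unfolding I_def
  proof (rule holomorphic_on_param_integral[OF oU])
    fix p show "G p holomorphic_on U"
    proof -
      have nz: "1 + \<i> * of_real \<delta> * (w + of_real (p \<bullet> e)) \<noteq> 0" if "w \<in> U" for w
      proof -
        have "\<delta> / 8 * (1 + norm (w + of_real (p \<bullet> e))) \<le> norm (1 + \<i> * of_real \<delta> * (w + of_real (p \<bullet> e)))"
          using that \<delta> by (intro norm_one_plus_imult_ge) (auto simp: U_def)
        moreover have "0 < \<delta> / 8 * (1 + norm (w + of_real (p \<bullet> e)))"
          using \<delta> by (intro mult_pos_pos) (auto intro: add_pos_nonneg)
        ultimately have "0 < norm (1 + \<i> * of_real \<delta> * (w + of_real (p \<bullet> e)))" by linarith
        then show ?thesis by simp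
      qed
      have "Fc p holomorphic_on U" using hol holomorphic_on_subset by blast
      then show ?thesis
        unfolding G_def regularizer_def
        by (intro holomorphic_on_mult holomorphic_on_divide holomorphic_intros) (use nz in auto)
    qed
  next
    fix w show "(\<lambda>p. G p w) \<in> borel_measurable lborel"
      unfolding G_def by measurable
  next
    fix z assume z: "z \<in> U"
    define r where "r = 1 - Im z"
    have r: "r > 0" using z by (simp add: r_def U_def)
    have w: "Im w < 1" "\<bar>Re w\<bar> \<le> norm z + r" if "w \<in> ball z r" for w
    proof -
      have "norm (w - z) < r" using that by (simp add: dist_norm norm_minus_commute)
      then show "Im w < 1" "\<bar>Re w\<bar> \<le> norm z + r"
        using abs_Im_le_cmod[of "w - z"] abs_Re_le_cmod[of "w - z"] abs_Re_le_cmod[of z] by (auto simp: r_def)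
    qed
    show "\<exists>r>0. \<exists>B. integrable lborel B \<and> ball z r \<subseteq> U \<and> (\<forall>p. \<forall>w\<in>ball z r. norm (G p w) \<le> B p)"
    proof (intro exI[of _ r] exI[of _ "\<lambda>p. L * (1 + (norm z + r)) ^ N * exp c * inverse ((1 + norm p) ^ N)"] conjI r allI ballI)
      show "integrable lborel (\<lambda>p::'a. L * (1 + (norm z + r)) ^ N * exp c * inverse ((1 + norm p) ^ N))"
        using J by auto
      show "ball z r \<subseteq> U" using w unfolding U_def by auto
      fix p w' assume w': "w' \<in> ball z r"
      have "norm (G p w') \<le> L * (1 + \<bar>Re w'\<bar>) ^ N * exp (c * Im w') * inverse ((1 + norm p) ^ N)"
        using w[OF w'] by (intro Gb) auto
      also have "\<dots> \<le> L * (1 + (norm z + r)) ^ N * exp c * inverse ((1 + norm p) ^ N)"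
        using w[OF w'] L c by (intro mult_mono power_mono order_refl) (auto intro!: mult_left_le)
      finally show "norm (G p w') \<le> L * (1 + (norm z + r)) ^ N * exp c * inverse ((1 + norm p) ^ N)" .
    qed
  qed
  have Ishift: "I (of_real s) = I 0" for s :: real
  proof -
    have "G p (of_real s) = G (s *\<^sub>R e + p) 0" for p
      using shift[of p s 0] perp_add[OF e, of p s] e
      by (simp add: G_def regularizer_def add.commute[of _ p] inner_add_right inner_add_left norm_eq_1 algebra_simps)
    moreover have "(\<lambda>p. G p 0) \<in> borel_measurable borel" unfolding G_def by measurable
    ultimately show ?thesis
      unfolding I_def using integral_lborel_translate[of "\<lambda>p. G p 0" "s *\<^sub>R e"] by simp
  qed
  have Iconst: "I w = I 0" if "w \<in> U" for w
  proof -
    have cU: "connected U" unfolding U_def by (intro convex_connected convex_halfspace_Im_lt)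
    have "I w - I 0 = 0"
      by (rule analytic_continuation[of "\<lambda>w. I w - I 0", OF _ oU cU _ _ zero_islimpt_range_of_real _ that])
        (use Ihol Ishift in \<open>auto simp: U_def intro!: holomorphic_on_diff\<close>)
    then show ?thesis by simp
  qed
  have "norm (I 0) \<le> exp (- c * t) * (L * JJ)" if "t \<ge> 0" for t
  proof -
    let ?w = "- \<i> * of_real t"
    have "norm (I 0) = norm (I ?w)" using Iconst[of ?w] that by (simp add: U_def)
    also have "\<dots> \<le> (\<integral>p. L * exp (- c * t) * inverse ((1 + norm p) ^ N) \<partial>(lborel::'a measure))"
      unfolding I_def
    proof (rule order_trans[OF integral_norm_bound integral_mono])
      show i: "integrable lborel (\<lambda>p::'a. L * exp (- c * t) * inverse ((1 + norm p) ^ N))" using J by auto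
      show b: "norm (G p ?w) \<le> L * exp (- c * t) * inverse ((1 + norm p) ^ N)" for p
        using Gb[of ?w p] that by simp
      have m: "(\<lambda>p. G p ?w) \<in> borel_measurable lborel" unfolding G_def by measurable
      have "integrable lborel (\<lambda>p. G p ?w)"
        by (rule Bochner_Integration.integrable_bound[OF i m])
          (intro AE_I2, simp only: real_norm_def, rule order_trans[OF b abs_ge_self])
      then show "integrable lborel (\<lambda>p. norm (G p ?w))" by simp
    qed
    also have "\<dots> = exp (- c * t) * (L * JJ)" by (simp add: JJ_def)
    finally show ?thesis .
  qed
  moreover have "((\<lambda>t. exp (- c * t) * (L * JJ)) \<longlongrightarrow> 0 * (L * JJ)) at_top"
  proof (intro tendsto_mult tendsto_const)
    show "((\<lambda>t. exp (- c * t)) \<longlongrightarrow> 0) at_top"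
      using c by real_asymp
  qed
  ultimately have "norm (I 0) \<le> 0 * (L * JJ)"
    by (intro tendsto_lowerbound[of _ _ at_top]) (auto intro!: eventually_mono[OF eventually_ge_at_top[of 0]])
  then have "I 0 = 0" by simp
  moreover have "ftrans 1 (\<lambda>p. reg \<delta> p 0 * Fc p 0) x = I 0"
    by (simp add: ftrans_def I_def G_def cis_conv_exp mult_ac)
  ultimately show ?thesis by simp
qed

theorem l2_ftrans_halfspace:
  assumes fin: "(\<integral>\<^sup>+p. ennreal ((norm (Fc p 0))\<^sup>2) \<partial>lborel) < \<infinity>"
    and g: "l2_ftrans 1 (\<lambda>p. Fc p 0) g"
  shows "AE x in lborel. x \<bullet> e \<le> a \<longrightarrow> g x = 0"
proof -
  \<comment> \<open>Starting at 1/2 keeps the pole \<i>/\<delta> of every regulariser away from Im w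
    \<le> 1.\<close>
  define \<delta> where "\<delta> n = 1 / real (Suc (Suc n))" for n
  have \<delta>: "0 < \<delta> n" "\<delta> n \<le> 1/2" for n by (auto simp: \<delta>_def field_simps)
  have \<delta>0: "\<delta> \<longlonglongrightarrow> 0" unfolding \<delta>_def by (rule LIMSEQ_Suc[OF LIMSEQ_Suc[OF lim_1_over_n]])
  have "AE x in lborel. x \<in> {x. x \<bullet> e < a} \<longrightarrow> g x = 0"
  proof (rule l2_ftrans_vanish[OF _ fin g, where \<kappa> = "\<lambda>n p. reg (\<delta> n) p 0"])
    show "(\<lambda>n. reg (\<delta> n) p 0) \<longlonglongrightarrow> 1" for p
    proof -
      have "(\<lambda>n. reg (\<delta> n) p 0) \<longlonglongrightarrow> of_real (exp (- 0 * (norm (perp e p))\<^sup>2)) / (1 + \<i> * of_real 0 * (0 + of_real (p \<bullet> e))) ^ (k + 2 * DIM('a))"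
        unfolding regularizer_def by (intro tendsto_intros \<delta>0) auto
      then show ?thesis by simp
    qed
    show "ftrans 1 (\<lambda>p. reg (\<delta> n) p 0 * Fc p 0) x = 0" if "x \<in> {x. x \<bullet> e < a}" for n x
      using that by (intro ftrans_reg_vanish \<delta>) auto
  qed (auto intro: norm_regularizer_le_1 integrable_reg \<delta>)
  \<comment> \<open>The moved contour gives a decaying exponential only for x \<bullet> e < a; the
    remaining hyperplane is a null set.\<close>
  moreover have "AE x in lborel. x \<bullet> e \<noteq> a" by (rule AE_off_hyperplane[OF e])
  ultimately show ?thesis by eventually_elim auto
qed

end

section \<open>Functions of one complex variable\<close>

text \<open>cos is even, so the branch of \<open>csqrt\<close> drops out and the result is entire in
  y.\<close>

definition cos_sqrt :: "complex \<Rightarrow> complex" where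
  "cos_sqrt y = cos (csqrt y)"

text \<open>sin(z)/z is even as well; the value 1 at y = 0 fills its removable singularity.\<close>

definition sinc_sqrt :: "complex \<Rightarrow> complex" where
  "sinc_sqrt y = (if y = 0 then 1 else sin (csqrt y) / csqrt y)"

lemma csqrt_square_cases: "csqrt (z\<^sup>2) = z \<or> csqrt (z\<^sup>2) = - z"
  by (rule power2_eq_iff[THEN iffD1]) simp

lemma cos_sqrt_square: "cos_sqrt (z\<^sup>2) = cos z"
  using csqrt_square_cases[of z] by (auto simp: cos_sqrt_def)

lemma sinc_sqrt_square: "z * sinc_sqrt (z\<^sup>2) = sin z"
proof (cases "z = 0")
  case False
  then show ?thesis using csqrt_square_cases[of z] by (auto simp: sinc_sqrt_def)
qed (simp add: sinc_sqrt_def)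

lemma holomorphic_on_of_entire_powser:
  fixes f :: "complex \<Rightarrow> complex"
  assumes "\<And>w. (\<lambda>n. a n * w ^ n) sums f w"
  shows "f holomorphic_on UNIV"
proof -
  have "f holomorphic_on ball 0 r" for r
    by (rule power_series_holomorphic[where a = a]) (simp add: assms)
  then have "f analytic_on ball 0 r" for r by (simp add: analytic_on_open)
  moreover have "z \<in> ball 0 (norm z + 1)" for z :: complex by simp
  ultimately have "f analytic_on UNIV" by (meson analytic_on_def analytic_on_analytic_at analytic_on_subset subset_iff UNIV_I)
  then show ?thesis by (simp add: analytic_on_open)
qed

text \<open>The series of cos has only even terms; reindexing by 2 n gives a power series in w
  itself, which settles holomorphy across the cut of \<open>csqrt\<close>.\<close>

lemma holomorphic_cos_sqrt: "cos_sqrt holomorphic_on UNIV"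
proof (rule holomorphic_on_of_entire_powser)
  fix w :: complex
  have "cos_coeff n *\<^sub>R csqrt w ^ n = 0" if "n \<notin> range (\<lambda>n. 2 * n)" for n
    using that by (auto simp: cos_coeff_def elim!: evenE)
  then have "(\<lambda>n. cos_coeff (2 * n) *\<^sub>R csqrt w ^ (2 * n)) sums cos (csqrt w)"
    using sums_mono_reindex[of "\<lambda>n. 2 * n" "\<lambda>n. cos_coeff n *\<^sub>R csqrt w ^ n"] cos_converges[of "csqrt w"]
    by (simp add: strict_mono_def)
  then show "(\<lambda>n. complex_of_real (cos_coeff (2 * n)) * w ^ n) sums cos_sqrt w"
    by (simp add: power_mult cos_sqrt_def scaleR_conv_of_real)
qed

lemma holomorphic_sinc_sqrt: "sinc_sqrt holomorphic_on UNIV"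
proof (rule holomorphic_on_of_entire_powser)
  fix w :: complex
  show "(\<lambda>n. complex_of_real (sin_coeff (2 * n + 1)) * w ^ n) sums sinc_sqrt w"
  proof (cases "w = 0")
    case True
    have "(\<lambda>n. complex_of_real (sin_coeff (2 * n + 1)) * 0 ^ n) sums complex_of_real (sin_coeff (2 * 0 + 1))"
      using powser_sums_zero[of "\<lambda>n. complex_of_real (sin_coeff (2 * n + 1))"] by simp
    then show ?thesis using True by (simp add: sinc_sqrt_def sin_coeff_def)
  next
    case False
    have "sin_coeff n *\<^sub>R csqrt w ^ n = 0" if "n \<notin> range (\<lambda>n. 2 * n + 1)" for n
      using that by (auto simp: sin_coeff_def elim!: oddE)
    then have "(\<lambda>n. sin_coeff (2 * n + 1) *\<^sub>R csqrt w ^ (2 * n + 1)) sums sin (csqrt w)"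
      using sums_mono_reindex[of "\<lambda>n. 2 * n + 1" "\<lambda>n. sin_coeff n *\<^sub>R csqrt w ^ n"] sin_converges[of "csqrt w"]
      by (simp add: strict_mono_def)
    moreover have "csqrt w ^ (2 * n + 1) = w ^ n * csqrt w" for n by (simp add: power_mult)
    ultimately have "(\<lambda>n. (complex_of_real (sin_coeff (2 * n + 1)) * w ^ n) * csqrt w) sums sin (csqrt w)"
      by (simp only: scaleR_conv_of_real mult.assoc)
    then have "(\<lambda>n. (complex_of_real (sin_coeff (2 * n + 1)) * w ^ n) * csqrt w / csqrt w) sums (sin (csqrt w) / csqrt w)"
      by (rule sums_divide)
    then show ?thesis using False by (simp add: sinc_sqrt_def)
  qed
qed

text \<open>The mean value inequality on the segment from 0 to z, where |cos| \<le> exp |Im z|. The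
  factor |z| allows division by z without loss near 0.\<close>

lemma norm_sin_le_mult:
  fixes z :: complex
  shows "norm (sin z) \<le> norm z * exp \<bar>Im z\<bar>"
proof -
  have "norm (sin z - sin 0) \<le> exp \<bar>Im z\<bar> * norm (z - 0)"
  proof (rule field_differentiable_bound[of "closed_segment 0 z" sin cos])
    fix v assume "v \<in> closed_segment 0 z"
    then obtain u where "0 \<le> u" "u \<le> 1" "v = u *\<^sub>R z" by (auto simp: closed_segment_def)
    then show "norm (cos v) \<le> exp \<bar>Im z\<bar>" using cmod_cos_le_exp by auto
  qed (auto intro!: derivative_eq_intros)
  then show ?thesis by (simp add: mult.commute)
qed

lemma norm_sinc_sqrt_square_le: "norm (sinc_sqrt (z\<^sup>2)) \<le> exp \<bar>Im z\<bar>"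
proof (cases "z = 0")
  case False
  have "norm z * norm (sinc_sqrt (z\<^sup>2)) \<le> norm z * exp \<bar>Im z\<bar>"
    using norm_sin_le_mult[of z] by (simp add: sinc_sqrt_square[symmetric] norm_mult)
  then show ?thesis using False by simp
qed (simp add: sinc_sqrt_def)

text \<open>In the squares a, b of the parts of E and x, y of the parts of w, the equation says a b
  = x y and a - b = x - y + \<mu>^2. If b > y then a > x; if b + \<mu>^2 < y then a < x; either
  contradicts the equality of the products.\<close>

lemma Im_sqrt_bounds:
  assumes E: "E\<^sup>2 = w\<^sup>2 + of_real (\<mu>\<^sup>2)" and \<mu>: "\<mu> > 0"
  shows "\<bar>Im E\<bar> \<le> \<bar>Im w\<bar>" and "\<bar>Im w\<bar> - \<mu> \<le> \<bar>Im E\<bar>"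
proof -
  define a b x y where "a = (Re E)\<^sup>2" and "b = (Im E)\<^sup>2" and "x = (Re w)\<^sup>2" and "y = (Im w)\<^sup>2"
  have re: "a - b = x - y + \<mu>\<^sup>2"
    using arg_cong[OF E, of Re] by (simp add: a_def b_def x_def y_def power2_eq_square)
  have "Re E * Im E = Re w * Im w"
    using arg_cong[OF E, of Im] by (simp add: power2_eq_square mult.commute[of "Re E"] mult.commute[of "Re w"])
  then have im: "a * b = x * y" unfolding a_def b_def x_def y_def by (metis power_mult_distrib)
  have nn: "a \<ge> 0" "b \<ge> 0" "x \<ge> 0" "y \<ge> 0" by (simp_all add: a_def b_def x_def y_def)
  have "b \<le> y"
  proof (rule ccontr)
    assume "\<not> b \<le> y"
    then have "a > x" "b > y" using re \<mu> by (auto simp: zero_less_power add_strict_increasing2 intro: le_less_trans) (smt (verit) zero_less_power2)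
    then have "x * y < a * b" using nn by (intro mult_strict_mono') auto
    then show False using im by simp
  qed
  then show "\<bar>Im E\<bar> \<le> \<bar>Im w\<bar>" by (simp add: b_def y_def abs_le_square_iff)
  show "\<bar>Im w\<bar> - \<mu> \<le> \<bar>Im E\<bar>"
  proof (rule ccontr)
    assume "\<not> \<bar>Im w\<bar> - \<mu> \<le> \<bar>Im E\<bar>"
    then have lt: "\<bar>Im E\<bar> + \<mu> < \<bar>Im w\<bar>" by simp
    then have "(\<bar>Im E\<bar> + \<mu>)\<^sup>2 < \<bar>Im w\<bar>\<^sup>2" using \<mu> by (intro power_strict_mono) auto
    then have "b + \<mu>\<^sup>2 + 2 * \<bar>Im E\<bar> * \<mu> < y" by (simp add: b_def y_def power2_sum)
    moreover have "2 * \<bar>Im E\<bar> * \<mu> \<ge> 0" using \<mu> by simp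
    ultimately have "b + \<mu>\<^sup>2 < y" by linarith
    then have "a < x" "b < y" using re zero_le_power2[of \<mu>] by linarith+
    then have "a * b < x * y" using nn by (intro mult_strict_mono') auto
    then show False using im by simp
  qed
qed

text \<open>Liouville makes f a polynomial. A nonconstant one is large near infinity, so the limit 0
  along one ray leaves only the constant 0.\<close>

lemma entire_decay_imp_zero:
  assumes hol: "f holomorphic_on UNIV" and b: "\<And>w. norm (f w) \<le> C * (1 + norm w) ^ n"
    and lim: "((\<lambda>t. f (- \<i> * of_real t)) \<longlongrightarrow> 0) at_top"
  shows "f w = 0"
proof -
  have C: "C \<ge> 0" using b[of 0] by (simp add: order_trans[OF norm_ge_zero])
  have "norm (f z) \<le> (C * 2 ^ n) * norm z ^ n" if "1 \<le> norm z" for z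
  proof -
    have "norm (f z) \<le> C * (1 + norm z) ^ n" by (rule b)
    also have "\<dots> \<le> C * (2 * norm z) ^ n" using that C by (intro mult_left_mono power_mono) auto
    finally show ?thesis by (simp add: power_mult_distrib)
  qed
  note poly = Liouville_polynomial[OF hol this]
  define c where "c k = (deriv ^^ k) f 0 / fact k" for k
  have f: "f z = (\<Sum>k\<le>n. c k * z ^ k)" for z using poly unfolding c_def by blast
  have fl: "filterlim (\<lambda>t. - \<i> * of_real t) at_infinity at_top"
    unfolding filterlim_at_infinity[OF order_refl] eventually_at_top_linorder
  proof (intro allI impI)
    fix r :: real
    show "\<exists>N. \<forall>t\<ge>N. r \<le> norm (- \<i> * of_real t)" by (intro exI[of _ r]) (auto simp: norm_mult)
  qed
  have "c k = 0" if "k \<noteq> 0" "k \<le> n" for k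
  proof (rule ccontr)
    assume "c k \<noteq> 0"
    then have "\<forall>\<^sub>F z in at_infinity. norm (\<Sum>i\<le>n. c i * z ^ i) \<ge> 1"
      using that by (intro Poly_Roots.polyfun_extremal) auto
    then have "\<forall>\<^sub>F t in at_top. norm (f (- \<i> * of_real t)) \<ge> 1"
      unfolding f[symmetric] using fl by (rule eventually_compose_filterlim)
    moreover have "\<forall>\<^sub>F t in at_top. norm (f (- \<i> * of_real t)) < 1"
      using tendstoD[OF lim, of 1] by simp
    ultimately have "\<forall>\<^sub>F t::real in at_top. False" by eventually_elim auto
    then show False by (simp add: eventually_False)
  qed
  then have f0: "f z = c 0" for z unfolding f by (subst sum.remove[of _ 0]) auto
  then have "c 0 = 0" using lim by (simp add: tendsto_const_iff)
  then show ?thesis using f0 by simp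
qed

text \<open>Parity of the order at \<i> \<mu>: if u did not vanish identically, the left side would
  have odd order there, because of the simple zero of the quadratic factor, and the right side even
  order.\<close>

lemma zero_of_simple_zero_times_square:
  fixes u v :: "complex \<Rightarrow> complex"
  assumes u: "u holomorphic_on UNIV" and v: "v holomorphic_on UNIV" and \<mu>: "\<mu> > 0"
    and eq: "\<And>w. (w\<^sup>2 + of_real (\<mu>\<^sup>2)) * (u w)\<^sup>2 = (v w)\<^sup>2"
  shows "u w = 0"
proof (rule ccontr)
  assume nz: "u w \<noteq> 0"
  define z where "z = \<i> * complex_of_real \<mu>"
  have z: "z \<noteq> 0" "z + z \<noteq> 0" using \<mu> by (auto simp: z_def)
  have q: "w\<^sup>2 + of_real (\<mu>\<^sup>2) = (w + z) * (w - z)" for w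
    by (simp add: z_def algebra_simps power2_eq_square)
  have an: "f analytic_on {x}" if "f holomorphic_on UNIV" for f :: "complex \<Rightarrow> complex" and x
    using that by (meson analytic_on_open analytic_on_subset open_UNIV subset_UNIV)
  have evu: "\<forall>\<^sub>F x in at z. u x \<noteq> 0"
  proof -
    have "\<forall>\<^sub>F x in at z. u x \<noteq> 0 \<and> x \<in> UNIV"
      by (rule non_zero_neighbour_alt[OF u open_UNIV connected_UNIV UNIV_I UNIV_I nz])
    then show ?thesis by (rule eventually_mono) auto
  qed
  have evq: "\<forall>\<^sub>F x in at z. (x + z) * (x - z) \<noteq> 0"
  proof -
    have "\<forall>\<^sub>F x in at z. x \<in> - {- z}" using z by (intro eventually_at_in_open') auto
    moreover have "\<forall>\<^sub>F x in at z. x \<noteq> z" by (rule eventually_neq_at_within)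
    ultimately show ?thesis by eventually_elim (auto simp: add_eq_0_iff2)
  qed
  have evv: "\<forall>\<^sub>F x in at z. v x \<noteq> 0"
    using evu evq
  proof eventually_elim
    fix x assume "u x \<noteq> 0" "(x + z) * (x - z) \<noteq> 0"
    then have "(v x)\<^sup>2 \<noteq> 0" unfolding eq[of x, symmetric] q by simp
    then show "v x \<noteq> 0" by simp
  qed
  have sq: "zorder (\<lambda>x. f x * f x) z = zorder f z + zorder f z"
    if "f holomorphic_on UNIV" "\<forall>\<^sub>F x in at z. f x \<noteq> 0" for f
    by (rule zorder_times_analytic[OF an an]) (use that in \<open>auto elim: eventually_mono\<close>)
  have "zorder (\<lambda>x. ((x + z) * (x - z)) * (u x * u x)) z
      = zorder (\<lambda>x. (x + z) * (x - z)) z + zorder (\<lambda>x. u x * u x) z"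
  proof (rule zorder_times_analytic)
    show "(\<lambda>x. (x + z) * (x - z)) analytic_on {z}" by (intro analytic_intros)
    show "(\<lambda>x. u x * u x) analytic_on {z}" using an[OF u] by (intro analytic_intros)
    show "\<forall>\<^sub>F x in at z. (x + z) * (x - z) * (u x * u x) \<noteq> 0"
      using evu evq by eventually_elim auto
  qed
  also have "zorder (\<lambda>x. (x + z) * (x - z)) z = 1"
    by (rule zorder_eqI[of UNIV _ "\<lambda>x. x + z"]) (use z in \<open>auto intro!: holomorphic_intros\<close>)
  also have "(\<lambda>x. ((x + z) * (x - z)) * (u x * u x)) = (\<lambda>x. v x * v x)"
  proof
    show "((x + z) * (x - z)) * (u x * u x) = v x * v x" for x
      using eq[of x] unfolding q by (simp add: power2_eq_square)
  qed
  finally have "zorder v z + zorder v z = 1 + (zorder u z + zorder u z)"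
    using sq[OF u evu] sq[OF v evv] by simp
  then show False by presburger
qed

section \<open>The Dirac symbol on complex lines\<close>

lemma norm_vector_smult: "norm (c *s v) = norm c * norm v" for c :: complex and v :: "complex^'n"
  by (simp add: norm_vec_def norm_mult L2_set_right_distrib)

lemma matrix_vector_mult_scaleR: "M *v (r *\<^sub>R v) = r *\<^sub>R (M *v v)" for M :: "complex^'n^'m"
  by (simp add: vec_eq_iff matrix_vector_mult_def scaleR_sum_right)

lemma matrix_vector_bounded:
  fixes M :: "complex^'n^'m"
  obtains K where "K \<ge> 0" "\<And>v. norm (M *v v) \<le> K * norm v"
proof -
  have "linear ((*v) M)"
    by (rule linearI[OF matrix_vector_right_distrib matrix_vector_mult_scaleR])
  then have "bounded_linear ((*v) M)" by (simp add: linear_conv_bounded_linear)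
  then show thesis using that bounded_linear.nonneg_bounded by (metis mult.commute)
qed

lemma scaleR_matrix_vector_mult: "(r *\<^sub>R M) *v v = r *\<^sub>R (M *v v)" for M :: "complex^'n^'m"
  by (simp add: vec_eq_iff matrix_vector_mult_def scaleR_sum_right)

lemma dirac_symbol_vector:
  "dirac_symbol \<alpha> \<beta> m p *v v = (p $ 1) *\<^sub>R (\<alpha> 1 *v v) + (p $ 2) *\<^sub>R (\<alpha> 2 *v v) + (p $ 3) *\<^sub>R (\<alpha> 3 *v v) + m *\<^sub>R (\<beta> *v v)"
  by (simp add: dirac_symbol_def sum_3 matrix_vector_mult_add_rdistrib scaleR_matrix_vector_mult)

lemma dirac_symbol_add:
  "dirac_symbol \<alpha> \<beta> (m + n) (p + r) = dirac_symbol \<alpha> \<beta> m p + dirac_symbol \<alpha> \<beta> n r"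
  by (simp add: dirac_symbol_def sum_3 scaleR_add_left algebra_simps)

lemma dirac_symbol_scaleR:
  "dirac_symbol \<alpha> \<beta> 0 (s *\<^sub>R p) = s *\<^sub>R dirac_symbol \<alpha> \<beta> 0 p"
  by (simp add: dirac_symbol_def sum_3 scaleR_add_right)

lemma dirac_symbol_square:
  assumes "dirac_matrices \<alpha> \<beta>"
  shows "dirac_symbol \<alpha> \<beta> m p *v (dirac_symbol \<alpha> \<beta> m p *v v) = ((norm p)\<^sup>2 + m\<^sup>2) *\<^sub>R v"
proof -
  have anti: "\<alpha> j *v (\<alpha> k *v v) = - (\<alpha> k *v (\<alpha> j *v v))" if "j \<noteq> k" for j k v
  proof -
    have "\<alpha> j ** \<alpha> k + \<alpha> k ** \<alpha> j = 0" using assms that by (simp add: dirac_matrices_def)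
    from arg_cong[OF this, of "\<lambda>M. M *v v"] show ?thesis
      by (simp add: matrix_vector_mult_add_rdistrib matrix_vector_mul_assoc[symmetric] eq_neg_iff_add_eq_0)
  qed
  have sq: "\<alpha> j *v (\<alpha> j *v v) = v" for j v
  proof -
    have "\<alpha> j ** \<alpha> j + \<alpha> j ** \<alpha> j = mat 2" using assms by (simp add: dirac_matrices_def)
    from arg_cong[OF this, of "\<lambda>M. M *v v"] have "\<alpha> j *v (\<alpha> j *v v) + \<alpha> j *v (\<alpha> j *v v) = mat 2 *v v"
      by (simp only: matrix_vector_mult_add_rdistrib matrix_vector_mul_assoc)
    also have "mat 2 *v v = v + v"
      by (simp add: vec_eq_iff matrix_vector_mult_def mat_def if_distrib[where f = "\<lambda>x. x * _"] cong: if_cong)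
    finally have "2 *\<^sub>R (\<alpha> j *v (\<alpha> j *v v)) = 2 *\<^sub>R v" by (simp add: scaleR_2)
    then show ?thesis by simp
  qed
  have antib: "\<beta> *v (\<alpha> k *v v) = - (\<alpha> k *v (\<beta> *v v))" for k v
  proof -
    have "\<alpha> k ** \<beta> + \<beta> ** \<alpha> k = 0" using assms by (simp add: dirac_matrices_def)
    from arg_cong[OF this, of "\<lambda>M. M *v v"] show ?thesis
      by (simp add: matrix_vector_mult_add_rdistrib matrix_vector_mul_assoc[symmetric] eq_neg_iff_add_eq_0 add.commute)
  qed
  have sqb: "\<beta> *v (\<beta> *v v) = v" for v
    using assms by (simp add: dirac_matrices_def matrix_vector_mul_assoc)
  have n: "(norm p)\<^sup>2 = (p $ 1)\<^sup>2 + (p $ 2)\<^sup>2 + (p $ 3)\<^sup>2"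
    unfolding power2_norm_eq_inner inner_vec_def by (simp add: sum_3 power2_eq_square)
  \<comment> \<open>The instances of \<open>anti\<close> sort products of the \<alpha> by increasing
    index and \<open>antib\<close> moves \<beta> to the right, so the mixed terms meet in the same
    form and cancel.\<close>
  show ?thesis
    unfolding dirac_symbol_vector n
    by (simp add: matrix_vector_right_distrib matrix_vector_mult_scaleR sq sqb antib
        anti[of 2 1] anti[of 3 1] anti[of 3 2] scaleR_add_right scaleR_add_left scaleR_diff_right power2_eq_square algebra_simps)
qed

text \<open>Bounds that are uniform on all complex lines in the direction orthogonal to \<open>p\<close>: polynomial
  in the complex variable, exponential in the orthogonal momentum.\<close>

definition growth :: "real \<Rightarrow> nat \<Rightarrow> 'a::real_normed_vector \<Rightarrow> complex \<Rightarrow> real" where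
  "growth C k p w = C * (1 + norm w) ^ k * exp (C * norm p)"

lemma growth_mono: "0 \<le> C \<Longrightarrow> C \<le> C' \<Longrightarrow> k \<le> k' \<Longrightarrow> growth C k p w \<le> growth C' k' p w"
  unfolding growth_def by (intro mult_mono power_increasing) (auto intro: mult_right_mono)

lemma growth_nonneg: "0 \<le> C \<Longrightarrow> 0 \<le> growth C k p w"
  by (simp add: growth_def)

text \<open>The constant occurs twice in \<open>growth\<close>, as factor and as exponential rate; a
  product needs C C' for the one and C + C' for the other.\<close>

lemma growth_mult_le:
  assumes "0 \<le> C" "0 \<le> C'"
  shows "growth C k p w * growth C' k' p w \<le> growth (C * C' + C + C') (k + k') p w"
proof -
  have "growth C k p w * growth C' k' p w = (C * C') * (1 + norm w) ^ (k + k') * exp ((C + C') * norm p)"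
    by (simp add: growth_def power_add exp_add algebra_simps)
  also have "\<dots> \<le> growth (C * C' + C + C') (k + k') p w"
    unfolding growth_def using assms by (intro mult_mono) (auto intro!: mult_right_mono)
  finally show ?thesis .
qed

lemma one_plus_norms_le_growth:
  assumes "K \<ge> 0"
  shows "K * (1 + norm p + norm w) \<le> growth (K + 1) 1 p w"
proof -
  have "1 + norm p + norm w \<le> (1 + norm w) * (1 + norm p)" by (simp add: algebra_simps)
  also have "\<dots> \<le> (1 + norm w) * exp (norm p)" by (intro mult_left_mono exp_ge_add_one_self) auto
  also have "\<dots> \<le> (1 + norm w) * exp ((K + 1) * norm p)"
    using assms by (intro mult_left_mono) (auto simp: algebra_simps)
  finally have "K * (1 + norm p + norm w) \<le> (K + 1) * ((1 + norm w) * exp ((K + 1) * norm p))"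
    using assms by (intro mult_mono) auto
  then show ?thesis by (simp add: growth_def mult.assoc)
qed

section \<open>The symbol at complex momenta along a fixed direction\<close>

locale dirac =
  fixes \<alpha> :: "3 \<Rightarrow> complex^4^4" and \<beta> :: "complex^4^4" and m :: real and e :: "real^3"
  assumes m: "m > 0" and dm: "dirac_matrices \<alpha> \<beta>" and e: "norm e = 1"
begin

text \<open>The symbol at the momentum p + w e. The mass term is already in the first summand, hence
  the mass 0 in the second.\<close>

definition D :: "real^3 \<Rightarrow> complex \<Rightarrow> complex^4 \<Rightarrow> complex^4" where
  "D p w v = dirac_symbol \<alpha> \<beta> m p *v v + w *s (dirac_symbol \<alpha> \<beta> 0 e *v v)"

text \<open>The squared energy |p + w e|^2 + m^2, continued bilinearly rather than as a Hermitian
  norm, so that it is holomorphic in w.\<close>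

definition q :: "real^3 \<Rightarrow> complex \<Rightarrow> complex" where
  "q p w = of_real ((norm p)\<^sup>2 + m\<^sup>2) + w * of_real (2 * (p \<bullet> e)) + w\<^sup>2"

lemma D_add: "D p w (u + v) = D p w u + D p w v"
  by (simp add: D_def matrix_vector_right_distrib vector_add_ldistrib)

lemma D_smult: "D p w (c *s v) = c *s D p w v"
  by (simp add: D_def vector_scalar_commute vector_add_ldistrib vector_smult_assoc mult.commute)

lemma smult_of_real: "of_real r *s v = r *\<^sub>R v" for v :: "complex^4"
  by (simp add: vec_eq_iff scaleR_conv_of_real[where 'a = complex])

lemma D_square: "D p w (D p w v) = q p w *s v"
proof -
  define X where "X = (*v) (dirac_symbol \<alpha> \<beta> m p)"
  define A where "A = (*v) (dirac_symbol \<alpha> \<beta> 0 e)"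
  have Xa: "X (u + v) = X u + X v" "A (u + v) = A u + A v" "X (c *s v) = c *s X v" "A (c *s v) = c *s A v" for u v c
    by (simp_all add: X_def A_def matrix_vector_right_distrib vector_scalar_commute)
  have XX: "X (X v) = ((norm p)\<^sup>2 + m\<^sup>2) *\<^sub>R v" unfolding X_def by (rule dirac_symbol_square[OF dm])
  have AA: "A (A v) = v" using dirac_symbol_square[OF dm, of 0 e v] e by (simp add: A_def)
  \<comment> \<open>Polarisation: comparing the squares at p, e and p + e yields the anticommutator
    of the two parts of D.\<close>
  have "dirac_symbol \<alpha> \<beta> m (p + e) *v v = X v + A v" for v
    using dirac_symbol_add[of \<alpha> \<beta> m 0 p e] by (simp add: X_def A_def matrix_vector_mult_add_rdistrib)
  then have "(X (X v) + A (X v)) + (X (A v) + A (A v)) = ((norm (p + e))\<^sup>2 + m\<^sup>2) *\<^sub>R v"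
    using dirac_symbol_square[OF dm, of m "p + e" v] by (simp add: Xa add_ac)
  moreover have "(norm (p + e))\<^sup>2 = (norm p)\<^sup>2 + 2 * (p \<bullet> e) + 1"
    using e by (simp add: power2_norm_eq_inner inner_add_left inner_add_right inner_commute norm_eq_1)
  ultimately have XA: "X (A v) + A (X v) = (2 * (p \<bullet> e)) *\<^sub>R v"
    by (simp add: XX AA scaleR_add_left algebra_simps)
  have "D p w (D p w v) = X (X v) + w *s (X (A v) + A (X v)) + (w * w) *s A (A v)"
    by (simp add: D_def X_def[symmetric] A_def[symmetric] Xa vector_add_ldistrib vector_smult_assoc add_ac)
  also have "\<dots> = q p w *s v"
    unfolding XX XA AA q_def smult_of_real[symmetric]
    by (simp add: vector_smult_assoc vector_sadd_rdistrib power2_eq_square)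
  finally show ?thesis .
qed

lemma D_shift: "D (p + s *\<^sub>R e) w v = D p (w + of_real s) v"
proof -
  have "dirac_symbol \<alpha> \<beta> m (p + s *\<^sub>R e) = dirac_symbol \<alpha> \<beta> m p + s *\<^sub>R dirac_symbol \<alpha> \<beta> 0 e"
    using dirac_symbol_add[of \<alpha> \<beta> m 0 p "s *\<^sub>R e"] by (simp add: dirac_symbol_scaleR)
  then show ?thesis
    by (simp add: D_def matrix_vector_mult_add_rdistrib scaleR_matrix_vector_mult vector_sadd_rdistrib smult_of_real add_ac)
qed

lemma q_shift: "q (p + s *\<^sub>R e) w = q p (w + of_real s)"
proof -
  have "(norm (p + s *\<^sub>R e))\<^sup>2 = (norm p)\<^sup>2 + 2 * s * (p \<bullet> e) + s\<^sup>2"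
    using e unfolding power2_norm_eq_inner norm_eq_1
    by (simp add: inner_add_left inner_add_right inner_commute[of e p] distrib_left power2_eq_square)
  moreover have "(p + s *\<^sub>R e) \<bullet> e = p \<bullet> e + s" using e by (simp add: inner_add_left norm_eq_1)
  ultimately show ?thesis by (simp add: q_def power2_eq_square algebra_simps)
qed

lemma D_bound:
  obtains K where "K \<ge> 0" "\<And>p w v. norm (D p w v) \<le> K * (1 + norm p + norm w) * norm v"
proof -
  obtain K1 where K1: "K1 \<ge> 0" "\<And>v. norm (\<alpha> 1 *v v) \<le> K1 * norm v" using matrix_vector_bounded by metis
  obtain K2 where K2: "K2 \<ge> 0" "\<And>v. norm (\<alpha> 2 *v v) \<le> K2 * norm v" using matrix_vector_bounded by metis
  obtain K3 where K3: "K3 \<ge> 0" "\<And>v. norm (\<alpha> 3 *v v) \<le> K3 * norm v" using matrix_vector_bounded by metis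
  obtain K4 where K4: "K4 \<ge> 0" "\<And>v. norm (\<beta> *v v) \<le> K4 * norm v" using matrix_vector_bounded by metis
  obtain K5 where K5: "K5 \<ge> 0" "\<And>v. norm (dirac_symbol \<alpha> \<beta> 0 e *v v) \<le> K5 * norm v" using matrix_vector_bounded by metis
  define K where "K = K1 + K2 + K3 + m * K4 + K5"
  have K: "K \<ge> 0" unfolding K_def using K1 K2 K3 K4 K5 m by simp
  have "norm (D p w v) \<le> K * (1 + norm p + norm w) * norm v" for p w v
  proof -
    let ?S = "1 + norm p + norm w"
    have c: "\<bar>p $ i\<bar> \<le> ?S" for i using component_le_norm_cart[of p i] norm_ge_zero[of w] by linarith
    have b: "r * norm u \<le> ?S * (L * norm v)" if "norm u \<le> L * norm v" "0 \<le> r" "r \<le> ?S" for r L and u :: "complex^4"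
      using that by (intro mult_mono) auto
    have S1: "m * norm u \<le> m * (?S * (L * norm v))" if "norm u \<le> L * norm v" for L and u :: "complex^4"
      using m b[OF that, of 1] by (intro mult_left_mono) auto
    have "norm (D p w v) \<le> \<bar>p $ 1\<bar> * norm (\<alpha> 1 *v v) + \<bar>p $ 2\<bar> * norm (\<alpha> 2 *v v) + \<bar>p $ 3\<bar> * norm (\<alpha> 3 *v v)
       + m * norm (\<beta> *v v) + norm w * norm (dirac_symbol \<alpha> \<beta> 0 e *v v)"
      unfolding D_def dirac_symbol_vector[of \<alpha> \<beta> m] using m
      by (intro norm_triangle_mono) (auto simp: norm_vector_smult)
    also have "\<dots> \<le> ?S * (K1 * norm v) + ?S * (K2 * norm v) + ?S * (K3 * norm v) + m * (?S * (K4 * norm v)) + ?S * (K5 * norm v)"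
      by (intro add_mono b S1 K1 K2 K3 K4 K5 c) auto
    also have "\<dots> = K * ?S * norm v" by (simp add: K_def algebra_simps)
    finally show ?thesis .
  qed
  then show thesis using that K by blast
qed

abbreviation \<mu> :: "real^3 \<Rightarrow> real" where "\<mu> p \<equiv> sqrt ((norm p)\<^sup>2 + m\<^sup>2)"

lemma \<mu>_bounds: "m \<le> \<mu> p" "\<mu> p \<le> norm p + m" "0 < \<mu> p"
proof -
  show 1: "m \<le> \<mu> p" using m by (intro real_le_rsqrt) auto
  show "0 < \<mu> p" using 1 m by linarith
  show "\<mu> p \<le> norm p + m"
    using m sqrt_add_le_add_sqrt[of "(norm p)\<^sup>2" "m\<^sup>2"] by simp
qed

lemma q_perp: "p \<bullet> e = 0 \<Longrightarrow> q p w = w\<^sup>2 + of_real ((\<mu> p)\<^sup>2)"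
  by (simp add: q_def)

end

lemma power_times_exp_decay:
  fixes c :: real
  assumes c: "c > 0"
  shows "((\<lambda>t. (1 + t) ^ n * exp (- c * t)) \<longlongrightarrow> 0) at_top"
proof -
  have "filterlim (\<lambda>t. c * (1 + t)) at_top at_top" using c by real_asymp
  from filterlim_compose[OF tendsto_power_div_exp_0[of n] this]
  have "((\<lambda>t. (exp c / c ^ n) * ((c * (1 + t)) ^ n / exp (c * (1 + t)))) \<longlongrightarrow> (exp c / c ^ n) * 0) at_top"
    by (intro tendsto_mult tendsto_const)
  moreover have "(exp c / c ^ n) * ((c * (1 + t)) ^ n / exp (c * (1 + t))) = (1 + t) ^ n * exp (- c * t)" for t
  proof -
    have "(c * (1 + t)) ^ n = c ^ n * (1 + t) ^ n" by (rule power_mult_distrib)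
    moreover have "exp (c * (1 + t)) = exp c * exp (c * t)" by (simp add: exp_add[symmetric] distrib_left)
    moreover have "exp (- c * t) = inverse (exp (c * t))" by (simp add: exp_minus)
    ultimately show ?thesis using c by (simp only:) (simp add: divide_simps)
  qed
  ultimately show ?thesis by simp
qed

text \<open>\<open>\<Phi> p w\<close> stands for the transform of the initial state at p + w e.
  \<open>\<Phi>_bound\<close> is the easy half of Paley-Wiener for a state supported in the ball of
  radius R.\<close>

locale dirac_flow = dirac +
  fixes \<Phi> :: "real^3 \<Rightarrow> complex \<Rightarrow> complex^4" and R B :: real
  assumes R: "R > 0" and B: "B \<ge> 0"
    and \<Phi>_hol: "\<And>p i. (\<lambda>w. \<Phi> p w $ i) holomorphic_on UNIV"
    and \<Phi>_shift: "\<And>p s w. \<Phi> (p + s *\<^sub>R e) w = \<Phi> p (w + of_real s)"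
    and \<Phi>_bound: "\<And>p w. norm (\<Phi> p w) \<le> B * exp (R * \<bar>Im w\<bar>)"
begin

text \<open>As h^2 = E^2, exp(\<i> t h) = cos(t E) + \<i> (sin(t E)/E) h; in terms of
  \<open>cos_sqrt\<close> and \<open>sinc_sqrt\<close> this continues to all complex w without a
  choice of E.\<close>

definition F :: "real \<Rightarrow> real^3 \<Rightarrow> complex \<Rightarrow> complex^4" where
  "F t p w = cos_sqrt (of_real (t\<^sup>2) * q p w) *s \<Phi> p w
     + (\<i> * (of_real t * sinc_sqrt (of_real (t\<^sup>2) * q p w))) *s D p w (\<Phi> p w)"

lemma F_shift: "F t (p + s *\<^sub>R e) w = F t p (w + of_real s)"
  by (simp add: F_def D_shift q_shift \<Phi>_shift)

lemma q_hol: "(\<lambda>w. q p w) holomorphic_on UNIV"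
  unfolding q_def by (intro holomorphic_intros)

lemma D\<Phi>_hol: "(\<lambda>w. D p w (\<Phi> p w) $ i) holomorphic_on UNIV"
  unfolding D_def matrix_vector_mult_def
  by (simp, intro holomorphic_intros \<Phi>_hol)

lemma F_hol: "(\<lambda>w. F t p w $ i) holomorphic_on UNIV"
proof -
  have "(\<lambda>w. of_real (t\<^sup>2) * q p w) holomorphic_on UNIV" by (intro holomorphic_intros q_hol)
  from holomorphic_on_compose_gen[OF this holomorphic_cos_sqrt] holomorphic_on_compose_gen[OF this holomorphic_sinc_sqrt]
  have "(\<lambda>w. cos_sqrt (of_real (t\<^sup>2) * q p w)) holomorphic_on UNIV" "(\<lambda>w. sinc_sqrt (of_real (t\<^sup>2) * q p w)) holomorphic_on UNIV"
    by (simp_all add: o_def)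
  then show ?thesis
    unfolding F_def using \<Phi>_hol[of p i] D\<Phi>_hol[of p i] by (simp, intro holomorphic_intros)
qed

text \<open>Either root E will do; \<sigma> is sin(t E)/E, with its limit t at E = 0.\<close>

lemma F_root:
  assumes E: "E\<^sup>2 = q p w"
  obtains \<sigma> where "E * \<sigma> = sin (of_real t * E)"
    and "F t p w = cos (of_real t * E) *s \<Phi> p w + (\<i> * \<sigma>) *s D p w (\<Phi> p w)"
    and "norm \<sigma> \<le> \<bar>t\<bar> * exp (\<bar>t\<bar> * \<bar>Im E\<bar>)"
proof
  have sq: "(of_real t * E)\<^sup>2 = of_real (t\<^sup>2) * q p w" by (simp add: power_mult_distrib E)
  show "E * (of_real t * sinc_sqrt ((of_real t * E)\<^sup>2)) = sin (of_real t * E)"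
    using sinc_sqrt_square[of "of_real t * E"] by (simp only: mult_ac)
  show "F t p w = cos (of_real t * E) *s \<Phi> p w + (\<i> * (of_real t * sinc_sqrt ((of_real t * E)\<^sup>2))) *s D p w (\<Phi> p w)"
    unfolding F_def sq[symmetric] cos_sqrt_square ..
  show "norm (of_real t * sinc_sqrt ((of_real t * E)\<^sup>2)) \<le> \<bar>t\<bar> * exp (\<bar>t\<bar> * \<bar>Im E\<bar>)"
    using norm_sinc_sqrt_square_le[of "of_real t * E"] by (simp add: norm_mult mult_left_mono abs_mult)
qed

text \<open>Since D^2 = E^2, the operator E + D maps into the eigenspace of D for the eigenvalue E,
  where the flow is multiplication by exp(\<i> t E).\<close>

lemma F_up:
  assumes E: "E\<^sup>2 = q p w"
  shows "E *s F t p w + D p w (F t p w) = exp (\<i> * (of_real t * E)) *s (E *s \<Phi> p w + D p w (\<Phi> p w))"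
proof -
  obtain \<sigma> where s: "E * \<sigma> = sin (of_real t * E)"
    and F: "F t p w = cos (of_real t * E) *s \<Phi> p w + (\<i> * \<sigma>) *s D p w (\<Phi> p w)"
    using F_root[OF E] by metis
  show ?thesis
    unfolding F D_add D_smult D_square exp_Euler s[symmetric] E[symmetric]
    by (simp add: vec_eq_iff algebra_simps power2_eq_square)
qed

text \<open>2 E = (E + D) + (E - D), and on the range of E - D the flow is multiplication by
  exp(-\<i> t E).\<close>

lemma F_split:
  assumes E: "E\<^sup>2 = q p w"
  shows "(2 * E) *s F t p w = exp (\<i> * (of_real t * E)) *s (E *s \<Phi> p w + D p w (\<Phi> p w))
    + exp (- (\<i> * (of_real t * E))) *s (E *s \<Phi> p w - D p w (\<Phi> p w))"
proof -
  obtain \<sigma> where s: "E * \<sigma> = sin (of_real t * E)"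
    and F: "F t p w = cos (of_real t * E) *s \<Phi> p w + (\<i> * \<sigma>) *s D p w (\<Phi> p w)"
    using F_root[OF E] by metis
  show ?thesis
    unfolding F exp_Euler exp_minus_Euler s[symmetric]
    by (simp add: vec_eq_iff algebra_simps)
qed

text \<open>Turns the p-dependent depth \<mu> at which the roots separate into a loss that
  \<open>growth\<close> admits.\<close>

lemma exp_\<mu>_le_growth:
  assumes "L \<ge> 0"
  shows "exp (L * \<mu> p) \<le> growth (exp (L * m) + L) 0 p w"
proof -
  have "L * \<mu> p \<le> L * m + L * norm p"
    using mult_left_mono[OF \<mu>_bounds(2)[of p] assms] by (simp add: algebra_simps)
  then have "exp (L * \<mu> p) \<le> exp (L * m) * exp (L * norm p)" by (simp add: exp_add[symmetric])
  also have "\<dots> \<le> (exp (L * m) + L) * exp ((exp (L * m) + L) * norm p)"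
    using assms by (intro mult_mono) (auto intro!: mult_right_mono)
  finally show ?thesis by (simp add: growth_def)
qed

text \<open>Finite propagation speed: |Im E| \<le> |Im w|, so cos(t E) and sin(t E)/E raise the
  exponential type in w from R to at most R + |t|.\<close>

lemma F_apriori:
  obtains C k where "C \<ge> 0" and "\<And>p w. p \<bullet> e = 0 \<Longrightarrow> norm (F t p w) \<le> growth C k p w * exp ((R + \<bar>t\<bar>) * \<bar>Im w\<bar>)"
proof -
  obtain K where K: "K \<ge> 0" "\<And>p w v. norm (D p w v) \<le> K * (1 + norm p + norm w) * norm v"
    using D_bound by metis
  define L where "L = (1 + \<bar>t\<bar> * K) * B"
  have L: "L \<ge> 0" unfolding L_def using K B by simp
  have "norm (F t p w) \<le> growth (L + 1) 1 p w * exp ((R + \<bar>t\<bar>) * \<bar>Im w\<bar>)" if p: "p \<bullet> e = 0" for p w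
  proof -
    define E where "E = csqrt (q p w)"
    have E: "E\<^sup>2 = q p w" by (simp add: E_def)
    have ImE: "\<bar>Im E\<bar> \<le> \<bar>Im w\<bar>"
      using Im_sqrt_bounds(1)[of E w "\<mu> p"] E q_perp[OF p, of w] \<mu>_bounds(3) by simp
    obtain \<sigma> where F: "F t p w = cos (of_real t * E) *s \<Phi> p w + (\<i> * \<sigma>) *s D p w (\<Phi> p w)"
      and \<sigma>: "norm \<sigma> \<le> \<bar>t\<bar> * exp (\<bar>t\<bar> * \<bar>Im E\<bar>)"
      using F_root[OF E] by metis
    let ?S = "1 + norm p + norm w" and ?e = "exp (\<bar>t\<bar> * \<bar>Im w\<bar>)"
    have ee: "exp (\<bar>t\<bar> * \<bar>Im E\<bar>) \<le> ?e" using ImE by (simp add: mult_left_mono)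
    have c: "norm (cos (of_real t * E)) \<le> ?e"
      by (rule order_trans[OF _ ee]) (use cmod_cos_le_exp[of 1 "of_real t * E"] in \<open>simp add: abs_mult\<close>)
    have s: "norm \<sigma> \<le> \<bar>t\<bar> * ?e"
      using \<sigma> mult_left_mono[OF ee, of "\<bar>t\<bar>"] by simp
    have "norm (F t p w) \<le> norm (cos (of_real t * E)) * norm (\<Phi> p w) + norm \<sigma> * norm (D p w (\<Phi> p w))"
      unfolding F by (rule order_trans[OF norm_triangle_ineq]) (simp add: norm_vector_smult norm_mult)
    also have "\<dots> \<le> ?e * norm (\<Phi> p w) + (\<bar>t\<bar> * ?e) * (K * ?S * norm (\<Phi> p w))"
      by (intro add_mono mult_mono c s K) auto
    also have "\<dots> \<le> ?e * (?S * norm (\<Phi> p w)) + (\<bar>t\<bar> * ?e) * (K * ?S * norm (\<Phi> p w))"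
    proof -
      have "1 * norm (\<Phi> p w) \<le> ?S * norm (\<Phi> p w)" by (intro mult_right_mono) auto
      then show ?thesis by (intro add_right_mono mult_left_mono) auto
    qed
    also have "\<dots> = (1 + \<bar>t\<bar> * K) * ?S * ?e * norm (\<Phi> p w)" by (simp add: algebra_simps)
    also have "\<dots> \<le> (1 + \<bar>t\<bar> * K) * ?S * ?e * (B * exp (R * \<bar>Im w\<bar>))"
      using K by (intro mult_left_mono \<Phi>_bound) auto
    also have "\<dots> = (L * ?S) * exp ((R + \<bar>t\<bar>) * \<bar>Im w\<bar>)"
      by (simp add: L_def exp_add algebra_simps)
    also have "\<dots> \<le> growth (L + 1) 1 p w * exp ((R + \<bar>t\<bar>) * \<bar>Im w\<bar>)"
      by (intro mult_right_mono one_plus_norms_le_growth L) auto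
    finally show ?thesis .
  qed
  then show thesis using that[of "L + 1" 1] L by simp
qed

text \<open>The Paley-Wiener counterpart of vanishing for x \<bullet> e \<le> a. One pair C, k
  serves all p orthogonal to e; the other momenta are reached by \<open>F_shift\<close>.\<close>

definition decays :: "real \<Rightarrow> real \<Rightarrow> bool" where
  "decays t a \<longleftrightarrow> (\<exists>C\<ge>0. \<exists>k. \<forall>p w. p \<bullet> e = 0 \<longrightarrow> Im w \<le> 0 \<longrightarrow> norm (F t p w) \<le> growth C k p w * exp (a * Im w))"

text \<open>Far below the real axis the two branches of the square root of \<open>q\<close> separate; \<open>E \<Phi> + D \<Phi>\<close> and
  \<open>E \<Phi> - D \<Phi>\<close> are, up to the factor \<open>2 E\<close>, the components of \<open>\<Phi>\<close> that the flow enlarges and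
  diminishes there.\<close>

lemma component_bounds:
  assumes dec: "decays t a" and t: "t \<ge> 0"
  obtains M k where "M \<ge> 0" and "\<And>p w. p \<bullet> e = 0 \<Longrightarrow> 2 * \<mu> p \<le> - Im w \<Longrightarrow>
    \<exists>E. E\<^sup>2 = q p w \<and> - Im w - \<mu> p \<le> - Im E \<and> - Im E \<le> - Im w \<and>
      norm (E *s \<Phi> p w + D p w (\<Phi> p w)) \<le> growth M k p w * exp ((a + t) * Im w) \<and>
      norm (E *s \<Phi> p w - D p w (\<Phi> p w)) \<le> growth M k p w * exp (- R * Im w)"
proof -
  obtain K where K: "K \<ge> 0" "\<And>p w v. norm (D p w v) \<le> K * (1 + norm p + norm w) * norm v"
    using D_bound by metis
  obtain C k where C: "C \<ge> 0" and Fb: "\<And>p w. p \<bullet> e = 0 \<Longrightarrow> Im w \<le> 0 \<Longrightarrow> norm (F t p w) \<le> growth C k p w * exp (a * Im w)"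
    using dec unfolding decays_def by metis
  define K1 where "K1 = m + 1 + K"
  have K1: "K1 \<ge> 0" unfolding K1_def using K m by simp
  define C1 where "C1 = (K1 + 1) * C + (K1 + 1) + C"
  define C2 where "C2 = exp (t * m) + t"
  define M1 where "M1 = C1 * C2 + C1 + C2"
  define M2 where "M2 = (K1 + 1) * B + (K1 + 1) + B"
  have C1: "C1 \<ge> 0" and C2: "C2 \<ge> 0" unfolding C1_def C2_def using C K1 t by auto
  have M1: "M1 \<ge> 0" and M2: "M2 \<ge> 0" unfolding M1_def M2_def using C1 C2 K1 B by auto
  have main: "\<exists>E. E\<^sup>2 = q p w \<and> - Im w - \<mu> p \<le> - Im E \<and> - Im E \<le> - Im w \<and>
      norm (E *s \<Phi> p w + D p w (\<Phi> p w)) \<le> growth (M1 + M2) (k + 1) p w * exp ((a + t) * Im w) \<and>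
      norm (E *s \<Phi> p w - D p w (\<Phi> p w)) \<le> growth (M1 + M2) (k + 1) p w * exp (- R * Im w)"
    if p: "p \<bullet> e = 0" and w: "2 * \<mu> p \<le> - Im w" for p w
  proof -
    have Imw: "Im w \<le> 0" using w \<mu>_bounds(3)[of p] by linarith
    \<comment> \<open>The root in the closed lower half plane, picked separately at each w; no
      continuity in w is claimed.\<close>
    define E where "E = (if Im (csqrt (q p w)) \<le> 0 then csqrt (q p w) else - csqrt (q p w))"
    have E: "E\<^sup>2 = q p w" and ImE: "Im E \<le> 0" by (auto simp: E_def)
    have E': "E\<^sup>2 = w\<^sup>2 + of_real ((\<mu> p)\<^sup>2)" unfolding E by (rule q_perp[OF p])
    have b1: "- Im w - \<mu> p \<le> - Im E" and b2: "- Im E \<le> - Im w"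
      using Im_sqrt_bounds[OF E' \<mu>_bounds(3)] Imw ImE by auto
    have nE: "norm E \<le> norm w + \<mu> p"
    proof (rule power2_le_imp_le)
      have "(norm E)\<^sup>2 \<le> norm (w\<^sup>2) + norm (complex_of_real ((\<mu> p)\<^sup>2))"
        unfolding norm_power[symmetric] E' by (rule norm_triangle_ineq)
      also have "\<dots> = (norm w)\<^sup>2 + (\<mu> p)\<^sup>2" by (simp only: norm_power norm_of_real abs_power2 power2_abs)
      also have "\<dots> \<le> (norm w + \<mu> p)\<^sup>2" using \<mu>_bounds(3)[of p] by (simp add: power2_sum)
      finally show "(norm E)\<^sup>2 \<le> (norm w + \<mu> p)\<^sup>2" .
    qed (use \<mu>_bounds(3)[of p] in auto)
    let ?S = "1 + norm p + norm w"
    have "norm E \<le> (m + 1) * ?S"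
    proof -
      have "norm E \<le> norm w + norm p + m" using nE \<mu>_bounds(2)[of p] by linarith
      also have "\<dots> \<le> (m + 1) * ?S" using m by (simp add: algebra_simps add_nonneg_nonneg)
      finally show ?thesis .
    qed
    then have UK: "norm (E *s v) + norm (D p w v) \<le> K1 * ?S * norm v" for v
    proof -
      have "norm (E *s v) + norm (D p w v) \<le> (m + 1) * ?S * norm v + K * ?S * norm v"
        unfolding norm_vector_smult using \<open>norm E \<le> (m + 1) * ?S\<close> K by (intro add_mono mult_right_mono) auto
      then show ?thesis by (simp add: K1_def algebra_simps)
    qed
    have U: "norm (E *s v) + norm (D p w v) \<le> growth (K1 + 1) 1 p w * norm v" for v
      using UK[of v] mult_right_mono[OF one_plus_norms_le_growth[OF K1, of p w] norm_ge_zero[of v]] by linarith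
    let ?P = "norm (E *s \<Phi> p w + D p w (\<Phi> p w))"
    \<comment> \<open>|exp(\<i> t E)| = exp(-t Im E) is at least exp(t (-Im w - \<mu>)): this
      component is enlarged by nearly exp(-t Im w) on its way to F, so a bound on F gives a
      correspondingly smaller bound on the component of \<Phi>.\<close>
    have "exp (t * (- Im w - \<mu> p)) * ?P \<le> exp (- t * Im E) * ?P"
      using b1 t by (intro mult_right_mono) (auto simp: mult_left_mono intro: mult_left_mono_neg order_trans[OF mult_left_mono])
    also have "\<dots> = norm (exp (\<i> * (of_real t * E)) *s (E *s \<Phi> p w + D p w (\<Phi> p w)))"
      by (simp only: norm_vector_smult, simp)
    also have "\<dots> = norm (E *s F t p w + D p w (F t p w))" unfolding F_up[OF E] ..
    also have "\<dots> \<le> norm (E *s F t p w) + norm (D p w (F t p w))" by (rule norm_triangle_ineq)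
    also have "\<dots> \<le> growth (K1 + 1) 1 p w * norm (F t p w)" by (rule U)
    also have "\<dots> \<le> growth (K1 + 1) 1 p w * (growth C k p w * exp (a * Im w))"
      using K1 by (intro mult_left_mono Fb p Imw growth_nonneg) auto
    also have "\<dots> \<le> growth C1 (1 + k) p w * exp (a * Im w)"
      unfolding mult.assoc[symmetric] C1_def using K1 C by (intro mult_right_mono growth_mult_le) auto
    finally have "exp (t * (- Im w - \<mu> p)) * ?P \<le> growth C1 (1 + k) p w * exp (a * Im w)" .
    \<comment> \<open>Multiplication by the inverse exponential turns the rate a into a + t and
      leaves exp(t \<mu>), which \<open>growth\<close> absorbs.\<close>
    then have "exp (t * \<mu> p + t * Im w) * (exp (t * (- Im w - \<mu> p)) * ?P) \<le> exp (t * \<mu> p + t * Im w) * (growth C1 (1 + k) p w * exp (a * Im w))"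
      by (rule mult_left_mono) simp
    moreover have "exp (t * \<mu> p + t * Im w) * (exp (t * (- Im w - \<mu> p)) * ?P) = ?P"
      unfolding mult.assoc[symmetric] exp_add[symmetric] by (simp add: algebra_simps)
    moreover have "exp (t * \<mu> p + t * Im w) * (growth C1 (1 + k) p w * exp (a * Im w))
        = growth C1 (1 + k) p w * exp (t * \<mu> p) * exp ((a + t) * Im w)"
      by (simp add: exp_add algebra_simps)
    ultimately have "?P \<le> growth C1 (1 + k) p w * exp (t * \<mu> p) * exp ((a + t) * Im w)" by (simp only:)
    also have "\<dots> \<le> growth C1 (1 + k) p w * growth C2 0 p w * exp ((a + t) * Im w)"
      unfolding C2_def using C1 t by (intro mult_right_mono mult_left_mono exp_\<mu>_le_growth growth_nonneg) auto
    also have "\<dots> \<le> growth M1 (1 + k + 0) p w * exp ((a + t) * Im w)"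
      unfolding M1_def using C1 C2 by (intro mult_right_mono growth_mult_le) auto
    also have "\<dots> \<le> growth (M1 + M2) (k + 1) p w * exp ((a + t) * Im w)"
      using M1 M2 by (intro mult_right_mono growth_mono) auto
    finally have P: "?P \<le> growth (M1 + M2) (k + 1) p w * exp ((a + t) * Im w)" .
    \<comment> \<open>For the other component just the support of the initial state enters, through
      \<open>\<Phi>_bound\<close>.\<close>
    have "norm (E *s \<Phi> p w - D p w (\<Phi> p w)) \<le> norm (E *s \<Phi> p w) + norm (D p w (\<Phi> p w))"
      by (rule norm_triangle_ineq4)
    also have "\<dots> \<le> growth (K1 + 1) 1 p w * norm (\<Phi> p w)" by (rule U)
    also have "\<dots> \<le> growth (K1 + 1) 1 p w * (growth B 0 p w * exp (- R * Im w))"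
    proof (intro mult_left_mono growth_nonneg)
      have "norm (\<Phi> p w) \<le> B * exp (R * \<bar>Im w\<bar>)" by (rule \<Phi>_bound)
      also have "\<dots> \<le> growth B 0 p w * exp (- R * Im w)"
        unfolding growth_def using B Imw by (intro mult_mono) (auto simp: mult_le_cancel_left1)
      finally show "norm (\<Phi> p w) \<le> growth B 0 p w * exp (- R * Im w)" .
    qed (use K1 in auto)
    also have "\<dots> \<le> growth M2 (1 + 0) p w * exp (- R * Im w)"
      unfolding mult.assoc[symmetric] M2_def using K1 B by (intro mult_right_mono growth_mult_le) auto
    also have "\<dots> \<le> growth (M1 + M2) (k + 1) p w * exp (- R * Im w)"
      using M1 M2 by (intro mult_right_mono growth_mono) auto
    finally show ?thesis using E b1 b2 P by blast
  qed
  show thesis using that[of "M1 + M2" "k + 1"] main M1 M2 by simp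
qed

lemma \<Phi>_eq_0:
  assumes dec: "decays t a" and t: "t \<ge> 0" and b: "a + t > 3 * R" and p: "p \<bullet> e = 0"
  shows "\<Phi> p w = 0"
proof -
  obtain M k where M: "M \<ge> 0" and Mb: "\<And>p w. p \<bullet> e = 0 \<Longrightarrow> 2 * \<mu> p \<le> - Im w \<Longrightarrow>
    \<exists>E. E\<^sup>2 = q p w \<and> - Im w - \<mu> p \<le> - Im E \<and> - Im E \<le> - Im w \<and>
      norm (E *s \<Phi> p w + D p w (\<Phi> p w)) \<le> growth M k p w * exp ((a + t) * Im w) \<and>
      norm (E *s \<Phi> p w - D p w (\<Phi> p w)) \<le> growth M k p w * exp (- R * Im w)"
    using component_bounds[OF dec t] by metis
  obtain K where K: "K \<ge> 0" "\<And>p w v. norm (D p w v) \<le> K * (1 + norm p + norm w) * norm v"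
    using D_bound by metis
  define b' where "b' = a + t"
  have "\<Phi> p w $ i = 0" for i w
  proof (rule zero_of_simple_zero_times_square[OF \<Phi>_hol D\<Phi>_hol \<mu>_bounds(3)])
    \<comment> \<open>The product of the i-th coordinates of E \<Phi> + D \<Phi> and E \<Phi> - D
      \<Phi>, invariant under the change from E to -E and hence entire although E is not.\<close>
    define N where "N w = q p w * (\<Phi> p w $ i)\<^sup>2 - (D p w (\<Phi> p w) $ i)\<^sup>2" for w
    \<comment> \<open>The factor has modulus exp(-2 R Im w), which cancels the growth of N above the
      real axis.\<close>
    define f where "f w = N w * exp (2 * \<i> * of_real R * w)" for w
    define Cp where "Cp = ((m + 1)\<^sup>2 + K\<^sup>2) * B\<^sup>2 * (1 + norm p)\<^sup>2"
    define Mp where "Mp = (M * exp (M * norm p))\<^sup>2"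
    have Cp: "Cp \<ge> 0" and Mp: "Mp \<ge> 0" by (simp_all add: Cp_def Mp_def)
    have Nb1: "norm (N w) \<le> Cp * (1 + norm w)\<^sup>2 * exp (2 * R * \<bar>Im w\<bar>)" for w
    proof -
      let ?S = "1 + norm p + norm w"
      have nq: "norm (q p w) \<le> ((m + 1) * ?S)\<^sup>2"
      proof -
        have "norm (q p w) \<le> norm (w\<^sup>2) + norm (complex_of_real ((\<mu> p)\<^sup>2))"
          unfolding q_perp[OF p] by (rule norm_triangle_ineq)
        also have "\<dots> = (norm w)\<^sup>2 + (\<mu> p)\<^sup>2" by (simp only: norm_power norm_of_real abs_power2 power2_abs)
        also have "\<dots> \<le> (norm w + \<mu> p)\<^sup>2" using \<mu>_bounds(3)[of p] by (simp add: power2_sum)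
        also have "\<dots> \<le> ((m + 1) * ?S)\<^sup>2"
        proof (rule power_mono)
          have "norm w + \<mu> p \<le> norm w + norm p + m" using \<mu>_bounds(2)[of p] by linarith
          also have "\<dots> \<le> (m + 1) * ?S" using m by (simp add: algebra_simps add_nonneg_nonneg)
          finally show "norm w + \<mu> p \<le> (m + 1) * ?S" .
        qed (use \<mu>_bounds(3)[of p] in auto)
        finally show ?thesis .
      qed
      let ?\<phi> = "B * exp (R * \<bar>Im w\<bar>)"
      have n1: "norm (\<Phi> p w $ i) \<le> ?\<phi>"
        using order_trans[OF Finite_Cartesian_Product.norm_nth_le \<Phi>_bound] .
      have n2: "norm (D p w (\<Phi> p w) $ i) \<le> K * ?S * ?\<phi>"
      proof -
        have "norm (D p w (\<Phi> p w) $ i) \<le> K * ?S * norm (\<Phi> p w)"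
          using order_trans[OF Finite_Cartesian_Product.norm_nth_le K(2)] .
        also have "\<dots> \<le> K * ?S * ?\<phi>" using K by (intro mult_left_mono \<Phi>_bound) auto
        finally show ?thesis .
      qed
      have "norm (N w) \<le> norm (q p w) * (norm (\<Phi> p w $ i))\<^sup>2 + (norm (D p w (\<Phi> p w) $ i))\<^sup>2"
        unfolding N_def by (rule order_trans[OF norm_triangle_ineq4]) (simp add: norm_mult norm_power)
      also have "\<dots> \<le> ((m + 1) * ?S)\<^sup>2 * ?\<phi>\<^sup>2 + (K * ?S * ?\<phi>)\<^sup>2"
        by (intro add_mono mult_mono power_mono nq n1 n2) auto
      also have "\<dots> = ((m + 1)\<^sup>2 + K\<^sup>2) * B\<^sup>2 * ?S\<^sup>2 * (exp (R * \<bar>Im w\<bar>))\<^sup>2"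
        by (simp only: power_mult_distrib) (simp only: distrib_left distrib_right mult_ac)
      also have "(exp (R * \<bar>Im w\<bar>))\<^sup>2 = exp (2 * R * \<bar>Im w\<bar>)" by (simp add: power2_eq_square exp_add[symmetric])
      also have "((m + 1)\<^sup>2 + K\<^sup>2) * B\<^sup>2 * ?S\<^sup>2 * exp (2 * R * \<bar>Im w\<bar>)
          \<le> ((m + 1)\<^sup>2 + K\<^sup>2) * B\<^sup>2 * ((1 + norm p) * (1 + norm w))\<^sup>2 * exp (2 * R * \<bar>Im w\<bar>)"
        by (intro mult_right_mono mult_left_mono power_mono) (auto simp: algebra_simps)
      finally show ?thesis by (simp add: Cp_def power_mult_distrib mult_ac)
    qed
    have Nb2: "norm (N w) \<le> Mp * (1 + norm w) ^ (2 * k) * exp ((b' - R) * Im w)" if w: "2 * \<mu> p \<le> - Im w" for w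
    proof -
      obtain E where E: "E\<^sup>2 = q p w"
        and P: "norm (E *s \<Phi> p w + D p w (\<Phi> p w)) \<le> growth M k p w * exp (b' * Im w)"
        and Q: "norm (E *s \<Phi> p w - D p w (\<Phi> p w)) \<le> growth M k p w * exp (- R * Im w)"
        using Mb[OF p w] unfolding b'_def by metis
      have "N w = (E *s \<Phi> p w + D p w (\<Phi> p w)) $ i * (E *s \<Phi> p w - D p w (\<Phi> p w)) $ i"
        unfolding N_def E[symmetric] by (simp add: power2_eq_square algebra_simps)
      then have "norm (N w) \<le> norm (E *s \<Phi> p w + D p w (\<Phi> p w)) * norm (E *s \<Phi> p w - D p w (\<Phi> p w))"
        by (simp only: norm_mult) (intro mult_mono Finite_Cartesian_Product.norm_nth_le norm_ge_zero)
      also have "\<dots> \<le> (growth M k p w * exp (b' * Im w)) * (growth M k p w * exp (- R * Im w))"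
        using M by (intro mult_mono P Q mult_nonneg_nonneg growth_nonneg) auto
      also have "\<dots> = Mp * (1 + norm w) ^ (2 * k) * (exp (b' * Im w) * exp (- R * Im w))"
        unfolding mult_2 power_add by (simp add: growth_def Mp_def power2_eq_square mult_ac)
      also have "exp (b' * Im w) * exp (- R * Im w) = exp ((b' - R) * Im w)"
        unfolding exp_add[symmetric] by (simp add: algebra_simps)
      finally show ?thesis .
    qed
    have nf: "norm (f w) = norm (N w) * exp (- 2 * R * Im w)" for w
      by (simp add: f_def norm_mult)
    have fb2: "norm (f w) \<le> Mp * (1 + norm w) ^ (2 * k) * exp ((b' - 3 * R) * Im w)" if w: "2 * \<mu> p \<le> - Im w" for w
    proof -
      have "norm (f w) \<le> Mp * (1 + norm w) ^ (2 * k) * exp ((b' - R) * Im w) * exp (- 2 * R * Im w)"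
        unfolding nf by (intro mult_right_mono Nb2 w) auto
      also have "\<dots> = Mp * (1 + norm w) ^ (2 * k) * exp ((b' - 3 * R) * Im w)"
        unfolding mult.assoc exp_add[symmetric] by (simp add: algebra_simps)
      finally show ?thesis .
    qed
    have "f w = 0" for w
    proof (rule entire_decay_imp_zero[of f])
      show "f holomorphic_on UNIV"
        unfolding f_def N_def by (intro holomorphic_intros q_hol \<Phi>_hol D\<Phi>_hol)
      show "norm (f w) \<le> (Cp * exp (8 * R * \<mu> p) + Mp) * (1 + norm w) ^ (2 * k + 2)" for w
      proof (cases "2 * \<mu> p \<le> - Im w")
        case True
        have "norm (f w) \<le> Mp * (1 + norm w) ^ (2 * k) * exp ((b' - 3 * R) * Im w)" by (rule fb2[OF True])
        also have "\<dots> \<le> Mp * (1 + norm w) ^ (2 * k + 2) * 1"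
        proof (rule mult_mono)
          have "Im w \<le> 0" using True \<mu>_bounds(3)[of p] by linarith
          then show "exp ((b' - 3 * R) * Im w) \<le> 1" using b by (simp add: b'_def mult_nonneg_nonpos)
          show "Mp * (1 + norm w) ^ (2 * k) \<le> Mp * (1 + norm w) ^ (2 * k + 2)"
            using Mp by (intro mult_left_mono power_increasing) auto
        qed (use Mp in auto)
        also have "\<dots> \<le> (Cp * exp (8 * R * \<mu> p) + Mp) * (1 + norm w) ^ (2 * k + 2)"
          using Cp by (simp add: mult_right_mono)
        finally show ?thesis .
      next
        case False
        have "norm (f w) \<le> Cp * (1 + norm w)\<^sup>2 * exp (2 * R * \<bar>Im w\<bar>) * exp (- 2 * R * Im w)"
          unfolding nf by (intro mult_right_mono Nb1) auto
        also have "\<dots> = Cp * (1 + norm w)\<^sup>2 * exp (2 * R * (\<bar>Im w\<bar> - Im w))"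
          unfolding mult.assoc exp_add[symmetric] by (simp add: algebra_simps)
        also have "\<dots> \<le> Cp * (1 + norm w) ^ (2 * k + 2) * exp (8 * R * \<mu> p)"
        proof (rule mult_mono)
          \<comment> \<open>Above the axis the difference is 0; in the strip below it is -2 Im w < 4
            \<mu>. Times 2 R this gives the constant 8 R \<mu>.\<close>
          have "\<bar>Im w\<bar> - Im w \<le> 4 * \<mu> p" using False \<mu>_bounds(3)[of p] by (cases "Im w \<ge> 0") auto
          then have "2 * R * (\<bar>Im w\<bar> - Im w) \<le> 2 * R * (4 * \<mu> p)" using R by (intro mult_left_mono) auto
          then show "exp (2 * R * (\<bar>Im w\<bar> - Im w)) \<le> exp (8 * R * \<mu> p)" by simp
          show "Cp * (1 + norm w)\<^sup>2 \<le> Cp * (1 + norm w) ^ (2 * k + 2)"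
            using Cp by (intro mult_left_mono power_increasing) auto
        qed (use Cp in auto)
        also have "\<dots> = Cp * exp (8 * R * \<mu> p) * (1 + norm w) ^ (2 * k + 2)" by (simp only: mult_ac)
        also have "\<dots> \<le> (Cp * exp (8 * R * \<mu> p) + Mp) * (1 + norm w) ^ (2 * k + 2)"
          using Mp by (intro mult_right_mono) auto
        finally show ?thesis .
      qed
      show "((\<lambda>s. f (- \<i> * of_real s)) \<longlongrightarrow> 0) at_top"
      proof (rule Lim_null_comparison)
        \<comment> \<open>The strict inequality b > 3 R makes the exponential beat the power;
          equality would give no decay.\<close>
        have "((\<lambda>s. Mp * ((1 + s) ^ (2 * k) * exp (- (b' - 3 * R) * s))) \<longlongrightarrow> Mp * 0) at_top"
          using b by (intro tendsto_mult tendsto_const power_times_exp_decay) (auto simp: b'_def)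
        then show "((\<lambda>s. Mp * ((1 + s) ^ (2 * k) * exp (- (b' - 3 * R) * s))) \<longlongrightarrow> 0) at_top" by simp
        show "\<forall>\<^sub>F s in at_top. norm (f (- \<i> * of_real s)) \<le> Mp * ((1 + s) ^ (2 * k) * exp (- (b' - 3 * R) * s))"
          using eventually_ge_at_top[of "2 * \<mu> p"]
        proof eventually_elim
          case (elim s)
          then have "s \<ge> 0" using \<mu>_bounds(3)[of p] by linarith
          then show ?case using fb2[of "- \<i> * of_real s"] elim by (simp add: norm_mult mult.assoc del: minus_diff_eq)
        qed
      qed
    qed
    \<comment> \<open>The vanishing of N is the relation to which the parity argument for the zero
      at \<i> \<mu> applies.\<close>
    then have "N w = 0" for w by (simp add: f_def)
    then show "(w\<^sup>2 + of_real ((\<mu> p)\<^sup>2)) * (\<Phi> p w $ i)\<^sup>2 = (D p w (\<Phi> p w) $ i)\<^sup>2" for w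
      unfolding q_perp[OF p, symmetric] N_def by simp
  qed
  then show ?thesis by (simp add: vec_eq_iff)
qed

lemma D_zero: "D p w 0 = 0" using D_smult[of p w 0 0] by simp

text \<open>The bound on the enlarged component depends on a and t through a + t, and the bound on
  the other is free of both. The source time needs t \<ge> 0 and the target time t' \<ge> 2 R, so
  between two times that are at least 2 R the transfer runs both ways.\<close>

theorem decays_transfer:
  assumes dec: "decays t a" and t: "t \<ge> 0" and t': "t' \<ge> 2 * R" and eq: "a + t = a' + t'"
  shows "decays t' a'"
proof (cases "a + t > 3 * R")
  case True
  \<comment> \<open>With \<Phi> = 0 the evolved transform is zero and decays at every rate, here
    with constant 0.\<close>
  have "F t' p w = 0" if "p \<bullet> e = 0" for p w
    by (simp add: F_def \<Phi>_eq_0[OF dec t True that] D_zero)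
  then show ?thesis unfolding decays_def by (intro exI[of _ 0] conjI exI[of _ 0]) (auto simp: growth_def)
next
  case False
  \<comment> \<open>From a + t \<le> 3 R and t' \<ge> 2 R: a' = a + t - t' \<le> 3 R - t' \<le> t' -
    R.\<close>
  then have a': "a' \<le> t' - R" using t' eq by linarith
  have t'0: "t' \<ge> 0" using t' R by linarith
  obtain M k where M: "M \<ge> 0" and Mb: "\<And>p w. p \<bullet> e = 0 \<Longrightarrow> 2 * \<mu> p \<le> - Im w \<Longrightarrow>
    \<exists>E. E\<^sup>2 = q p w \<and> - Im w - \<mu> p \<le> - Im E \<and> - Im E \<le> - Im w \<and>
      norm (E *s \<Phi> p w + D p w (\<Phi> p w)) \<le> growth M k p w * exp ((a + t) * Im w) \<and>
      norm (E *s \<Phi> p w - D p w (\<Phi> p w)) \<le> growth M k p w * exp (- R * Im w)"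
    using component_bounds[OF dec t] by metis
  obtain C0 k0 where C0: "C0 \<ge> 0" and Fb: "\<And>p w. p \<bullet> e = 0 \<Longrightarrow> norm (F t' p w) \<le> growth C0 k0 p w * exp ((R + \<bar>t'\<bar>) * \<bar>Im w\<bar>)"
    using F_apriori by metis
  define C1 where "C1 = exp (t' * m) + t'"
  define M1 where "M1 = M * C1 + M + C1"
  define M2 where "M2 = M1 / m + M1"
  \<comment> \<open>In the strip -2 \<mu> < Im w \<le> 0 the exponent of the a priori bound exceeds
    a' Im w by at most 2 \<mu> (R + t' + |a'|).\<close>
  define L where "L = 2 * (R + t' + \<bar>a'\<bar>)"
  define C2 where "C2 = exp (L * m) + L"
  define M3 where "M3 = C0 * C2 + C0 + C2"
  have L: "L \<ge> 0" using R t'0 by (simp add: L_def)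
  have C1: "C1 \<ge> 0" and C2: "C2 \<ge> 0" using t'0 L by (auto simp: C1_def C2_def)
  have M1: "M1 \<ge> M" "M1 \<ge> 0" and M3: "M3 \<ge> 0" using M C0 C1 C2 by (auto simp: M1_def M3_def)
  have M2: "M2 \<ge> M1" "M2 \<ge> 0" using M1 m by (auto simp: M2_def)
  have "norm (F t' p w) \<le> growth (M2 + M3) (k + k0) p w * exp (a' * Im w)"
    if p: "p \<bullet> e = 0" and w: "Im w \<le> 0" for p w
  proof (cases "2 * \<mu> p \<le> - Im w")
    case True
    obtain E where E: "E\<^sup>2 = q p w" and b1: "- Im w - \<mu> p \<le> - Im E" and b2: "- Im E \<le> - Im w"
      and P: "norm (E *s \<Phi> p w + D p w (\<Phi> p w)) \<le> growth M k p w * exp ((a + t) * Im w)"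
      and Q: "norm (E *s \<Phi> p w - D p w (\<Phi> p w)) \<le> growth M k p w * exp (- R * Im w)"
      using Mb[OF p True] by metis
    \<comment> \<open>At this depth -Im E \<ge> -Im w - \<mu> \<ge> \<mu> \<ge> m, so dividing by 2
      E costs a constant independent of p.\<close>
    have nE: "m \<le> norm E"
      using b1 True \<mu>_bounds(1)[of p] abs_Im_le_cmod[of E] by linarith
    have e1: "exp (- t' * Im E) \<le> exp (- t' * Im w)"
      using mult_left_mono[OF b2 t'0] by simp
    have e2: "exp (t' * Im E) \<le> exp (t' * \<mu> p) * exp (t' * Im w)"
      using mult_left_mono[OF b1 t'0] by (simp add: exp_add[symmetric] algebra_simps)
    \<comment> \<open>The diminished component arrives with the rate t' - R, which is at least a';
      for Im w \<le> 0 the larger rate is the better one.\<close>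
    have e3: "exp ((t' - R) * Im w) \<le> exp (a' * Im w)"
      using mult_right_mono_neg[OF a' w] by simp
    have "2 * m * norm (F t' p w) \<le> norm ((2 * E) *s F t' p w)"
      using nE by (simp add: norm_vector_smult norm_mult mult_right_mono)
    also have "\<dots> \<le> exp (- t' * Im E) * norm (E *s \<Phi> p w + D p w (\<Phi> p w)) + exp (t' * Im E) * norm (E *s \<Phi> p w - D p w (\<Phi> p w))"
      unfolding F_split[OF E] by (rule order_trans[OF norm_triangle_ineq]) (simp only: norm_vector_smult, simp)
    also have "\<dots> \<le> exp (- t' * Im w) * (growth M k p w * exp ((a + t) * Im w))
        + (exp (t' * \<mu> p) * exp (t' * Im w)) * (growth M k p w * exp (- R * Im w))"
      by (intro add_mono mult_mono e1 e2 P Q) auto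
    also have "\<dots> = growth M k p w * (exp (- t' * Im w) * exp ((a + t) * Im w))
        + growth M k p w * exp (t' * \<mu> p) * (exp (t' * Im w) * exp (- R * Im w))"
      by (simp only: mult_ac)
    also have "\<dots> = growth M k p w * exp (a' * Im w) + growth M k p w * exp (t' * \<mu> p) * exp ((t' - R) * Im w)"
      unfolding exp_add[symmetric] eq by (simp add: algebra_simps)
    also have "\<dots> \<le> growth M k p w * exp (a' * Im w) + growth M k p w * growth C1 0 p w * exp (a' * Im w)"
      unfolding C1_def by (intro add_left_mono mult_mono mult_left_mono e3 exp_\<mu>_le_growth t'0 growth_nonneg mult_nonneg_nonneg M) (use t'0 in auto)
    also have "\<dots> \<le> growth M1 k p w * exp (a' * Im w) + growth M1 (k + 0) p w * exp (a' * Im w)"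
      unfolding M1_def using M C1 by (intro add_mono mult_right_mono growth_mono growth_mult_le) auto
    finally have "m * norm (F t' p w) \<le> growth M1 k p w * exp (a' * Im w)" by simp
    then have "norm (F t' p w) \<le> (1 / m) * growth M1 k p w * exp (a' * Im w)" using m by (simp add: field_simps)
    also have "(1 / m) * growth M1 k p w \<le> growth M2 k p w"
    proof -
      have "(1 / m) * growth M1 k p w = (M1 / m) * (1 + norm w) ^ k * exp (M1 * norm p)" by (simp add: growth_def)
      also have "\<dots> \<le> growth M2 k p w"
        unfolding growth_def using M1 M2 m by (intro mult_mono) (auto simp: M2_def intro: mult_right_mono)
      finally show ?thesis .
    qed
    also have "growth M2 k p w \<le> growth (M2 + M3) (k + k0) p w"
      using M2 M3 by (intro growth_mono) auto
    finally show ?thesis by (simp add: mult_right_mono)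
  next
    case False
    have ee: "exp ((R + \<bar>t'\<bar>) * \<bar>Im w\<bar>) \<le> exp (L * \<mu> p) * exp (a' * Im w)"
    proof -
      have "(R + t' + a') * (- Im w) \<le> (R + t' + \<bar>a'\<bar>) * (2 * \<mu> p)"
        using False w R t'0 \<mu>_bounds(3)[of p] by (intro mult_mono) auto
      then have "(R + \<bar>t'\<bar>) * \<bar>Im w\<bar> \<le> L * \<mu> p + a' * Im w"
        using w t'0 by (simp add: L_def algebra_simps)
      then show ?thesis by (simp add: exp_add[symmetric])
    qed
    have "norm (F t' p w) \<le> growth C0 k0 p w * (exp (L * \<mu> p) * exp (a' * Im w))"
      using order_trans[OF Fb[OF p] mult_left_mono[OF ee growth_nonneg[OF C0]]] .
    also have "\<dots> \<le> growth C0 k0 p w * (growth C2 0 p w * exp (a' * Im w))"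
      unfolding C2_def by (intro mult_left_mono mult_right_mono exp_\<mu>_le_growth L growth_nonneg C0) auto
    also have "\<dots> \<le> growth M3 (k0 + 0) p w * exp (a' * Im w)"
      unfolding mult.assoc[symmetric] M3_def using C0 C2 by (intro mult_right_mono growth_mult_le) auto
    also have "\<dots> \<le> growth (M2 + M3) (k + k0) p w * exp (a' * Im w)"
      using M2 M3 by (intro mult_right_mono growth_mono) auto
    finally show ?thesis .
  qed
  then show ?thesis unfolding decays_def using M2 M3 by (intro exI[of _ "M2 + M3"]) auto
qed

end

section \<open>Identification of \<open>fourier\<close> and \<open>inv_fourier\<close>\<close>

lemma borel_measurable_vecI:
  fixes f :: "'a \<Rightarrow> complex^'n"
  assumes [measurable]: "\<And>i. (\<lambda>x. f x $ i) \<in> borel_measurable M"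
  shows "f \<in> borel_measurable M"
proof (subst borel_measurable_euclidean_space, intro ballI)
  fix b :: "complex^'n" assume "b \<in> Basis"
  then obtain i c where b: "b = axis i c" by (auto simp: Basis_vec_def)
  have "(\<lambda>x. f x $ i \<bullet> c) \<in> borel_measurable M" by measurable
  then show "(\<lambda>x. f x \<bullet> b) \<in> borel_measurable M" by (simp add: b inner_axis)
qed

lemma borel_measurable_vec_nth:
  fixes f :: "'a \<Rightarrow> complex^'n"
  assumes "f \<in> borel_measurable M"
  shows "(\<lambda>x. f x $ i) \<in> borel_measurable M"
proof (rule borel_measurable_continuous_on[OF _ assms])
  show "continuous_on UNIV (\<lambda>v::complex^'n. v $ i)" by (intro continuous_intros)
qed

text \<open>The real and imaginary parts of the finitely many components are corrected separately,
  and the null sets united.\<close>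

lemma lebesgue_ex_borel_version:
  fixes f :: "'a::euclidean_space \<Rightarrow> complex^'n"
  assumes f: "f \<in> borel_measurable lebesgue"
  obtains g where "g \<in> borel_measurable borel" "AE x in lebesgue. f x = g x"
proof -
  have m: "(\<lambda>x. Re (f x $ i)) \<in> borel_measurable (completion lborel)" "(\<lambda>x. Im (f x $ i)) \<in> borel_measurable (completion lborel)" for i
    using borel_measurable_vec_nth[OF f, of i] by (auto intro: measurable_compose[OF _ borel_measurable_Re] measurable_compose[OF _ borel_measurable_Im])
  have "\<forall>i. \<exists>g. g \<in> borel_measurable lborel \<and> (AE x in lborel. Re (f x $ i) = g x)"
    using completion_ex_borel_measurable_real[OF m(1)] by blast
  from choice[OF this] obtain r where r: "\<And>i. r i \<in> borel_measurable lborel" "\<And>i. AE x in lborel. Re (f x $ i) = r i x"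
    by blast
  have "\<forall>i. \<exists>g. g \<in> borel_measurable lborel \<and> (AE x in lborel. Im (f x $ i) = g x)"
    using completion_ex_borel_measurable_real[OF m(2)] by blast
  from choice[OF this] obtain s where s: "\<And>i. s i \<in> borel_measurable lborel" "\<And>i. AE x in lborel. Im (f x $ i) = s i x"
    by blast
  define g where "g x = (\<chi> i. Complex (r i x) (s i x))" for x
  have [measurable]: "r i \<in> borel_measurable borel" "s i \<in> borel_measurable borel" for i
    using r(1)[of i] s(1)[of i] by auto
  have "g \<in> borel_measurable borel"
  proof (rule borel_measurable_vecI)
    fix i
    have "(\<lambda>x. of_real (r i x) + \<i> * of_real (s i x)) \<in> borel_measurable borel" by measurable
    then show "(\<lambda>x. g x $ i) \<in> borel_measurable borel" by (simp add: g_def Complex_eq)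
  qed
  moreover have "AE x in lborel. \<forall>i. Re (f x $ i) = r i x \<and> Im (f x $ i) = s i x"
    using r(2) s(2) by (auto simp: AE_all_countable AE_conj_iff)
  then have "AE x in lborel. f x = g x"
    by eventually_elim (auto simp: g_def vec_eq_iff complex_eq_iff)
  then have "AE x in lebesgue. f x = g x" by (rule AE_completion)
  ultimately show thesis using that by blast
qed

lemma norm_vec_squared: "(norm v)\<^sup>2 = (\<Sum>i\<in>UNIV. (norm (v $ i))\<^sup>2)" for v :: "complex^'n"
  by (simp add: norm_vec_def L2_set_def sum_nonneg)

text \<open>\<open>L2_limit\<close> is a choice: g0 shows that there is something to choose, and the
  triangle inequality forces the chosen function to agree with g0 almost everywhere.\<close>

lemma L2_limit_AE:
  fixes g0 :: "real^3 \<Rightarrow> complex^4"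
  assumes F[measurable]: "\<And>n. F n \<in> borel_measurable borel" and g0m[measurable]: "g0 \<in> borel_measurable borel"
    and fin: "(\<integral>\<^sup>+x. ennreal ((norm (g0 x))\<^sup>2) \<partial>lborel) < \<infinity>"
    and lim: "(\<lambda>n. \<integral>\<^sup>+x. ennreal ((norm (F n x - g0 x))\<^sup>2) \<partial>lborel) \<longlonglongrightarrow> 0"
  shows "square_integrable (L2_limit F)" "AE x in lebesgue. L2_limit F x = g0 x"
proof -
  have g0L: "g0 \<in> borel_measurable lebesgue" using g0m by (intro measurable_completion) simp
  have FL: "F n \<in> borel_measurable lebesgue" for n using F by (intro measurable_completion) simp
  have sq: "square_integrable g0"
    unfolding square_integrable_def
  proof (intro conjI g0L)
    have "integrable lborel (\<lambda>x. (norm (g0 x))\<^sup>2)"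
      using fin by (intro integrableI_bounded) auto
    then show "integrable lebesgue (\<lambda>x. (norm (g0 x))\<^sup>2)"
      by (subst integrable_completion) auto
  qed
  have lim': "(\<lambda>n. \<integral>\<^sup>+x. ennreal ((norm (F n x - g0 x))\<^sup>2) \<partial>lebesgue) \<longlonglongrightarrow> 0"
    using lim by (simp add: nn_integral_completion)
  define h where "h = L2_limit F"
  have h: "square_integrable h \<and> (\<lambda>n. \<integral>\<^sup>+x. ennreal ((norm (F n x - h x))\<^sup>2) \<partial>lebesgue) \<longlonglongrightarrow> 0"
    unfolding h_def L2_limit_def by (rule someI[of _ g0]) (use sq lim' in blast)
  then show "square_integrable (L2_limit F)" by (simp add: h_def)
  have hL: "h \<in> borel_measurable lebesgue" using h by (simp add: square_integrable_def)
  have le: "(\<integral>\<^sup>+x. ennreal ((norm (h x - g0 x))\<^sup>2) \<partial>lebesgue)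
      \<le> 2 * (\<integral>\<^sup>+x. ennreal ((norm (F n x - h x))\<^sup>2) \<partial>lebesgue) + 2 * (\<integral>\<^sup>+x. ennreal ((norm (F n x - g0 x))\<^sup>2) \<partial>lebesgue)" for n
    using nn_integral_norm_sq_add[of "\<lambda>x. h x - F n x" lebesgue "\<lambda>x. F n x - g0 x"] FL[of n] hL g0L
    by (simp add: norm_minus_commute[of "h _"])
  have "(\<lambda>n. 2 * (\<integral>\<^sup>+x. ennreal ((norm (F n x - h x))\<^sup>2) \<partial>lebesgue) + 2 * (\<integral>\<^sup>+x. ennreal ((norm (F n x - g0 x))\<^sup>2) \<partial>lebesgue)) \<longlonglongrightarrow> 2 * 0 + 2 * 0"
    using h lim' by (intro tendsto_add ennreal_tendsto_cmult) auto
  then have "(\<integral>\<^sup>+x. ennreal ((norm (h x - g0 x))\<^sup>2) \<partial>lebesgue) \<le> 2 * 0 + 2 * 0"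
    by (rule LIMSEQ_le_const) (use le in auto)
  then have "(\<integral>\<^sup>+x. ennreal ((norm (h x - g0 x))\<^sup>2) \<partial>lebesgue) = 0" by simp
  then have "AE x in lebesgue. ennreal ((norm (h x - g0 x))\<^sup>2) = 0"
    by (subst (asm) nn_integral_0_iff_AE) (use hL g0L in auto)
  then show "AE x in lebesgue. L2_limit F x = g0 x"
    unfolding h_def[symmetric] by eventually_elim auto
qed

lemma nn_integral_norm_vec_squared:
  fixes f :: "'a \<Rightarrow> complex^'n"
  assumes [measurable]: "\<And>i. (\<lambda>x. f x $ i) \<in> borel_measurable M"
  shows "(\<integral>\<^sup>+x. ennreal ((norm (f x))\<^sup>2) \<partial>M) = (\<Sum>i\<in>UNIV. \<integral>\<^sup>+x. ennreal ((norm (f x $ i))\<^sup>2) \<partial>M)"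
  by (simp add: norm_vec_squared sum_ennreal[symmetric] nn_integral_sum del: sum_ennreal)

text \<open>Passage from the vector-valued Lebesgue integral of an arbitrary representative to the
  componentwise Borel integrals that \<open>ftrans\<close> is about.\<close>

lemma truncated_transform_component:
  fixes f f1 :: "real^3 \<Rightarrow> complex^4"
  assumes ae: "AE x in lebesgue. f x = f1 x" and f1[measurable]: "\<And>i. (\<lambda>x. f1 x $ i) \<in> borel_measurable borel"
    and int: "\<And>i. integrable lborel (trunc n (\<lambda>x. f1 x $ i))"
  shows "set_lebesgue_integral lebesgue (cball 0 (real n)) (\<lambda>x. cis (s * (p \<bullet> x)) *s f x)
    = (\<chi> i. ftrans s (trunc n (\<lambda>x. f1 x $ i)) p)"
proof -
  define H where "H x = indicat_real (cball 0 (real n)) x *\<^sub>R (cis (s * (p \<bullet> x)) *s f1 x)" for x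
  have Hi: "H x $ i = cis (s * (p \<bullet> x)) * trunc n (\<lambda>x. f1 x $ i) x" for x i
    by (simp add: H_def trunc_def indicator_def)
  have tm: "trunc n (\<lambda>x. f1 x $ i) \<in> borel_measurable borel" for i by (rule borel_measurable_trunc) simp
  have Hm: "H \<in> borel_measurable borel"
  proof (rule borel_measurable_vecI)
    fix i show "(\<lambda>x. H x $ i) \<in> borel_measurable borel"
      unfolding Hi using tm[of i] by measurable
  qed
  have HL: "H \<in> borel_measurable lebesgue" using Hm by (intro measurable_completion) simp
  have ae': "AE x in lebesgue. indicat_real (cball 0 (real n)) x *\<^sub>R (cis (s * (p \<bullet> x)) *s f x) = H x"
    using ae by eventually_elim (simp add: H_def)
  \<comment> \<open>The original integrand is measurable because the completed measure allows
    changes on null sets.\<close>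
  have fm: "(\<lambda>x. indicat_real (cball 0 (real n)) x *\<^sub>R (cis (s * (p \<bullet> x)) *s f x)) \<in> borel_measurable lebesgue"
    by (rule borel_measurable_AE[OF HL]) (use ae' in eventually_elim, simp)
  have Hint: "integrable lborel H"
  proof -
    have "integrable lborel (\<lambda>x. \<Sum>i\<in>UNIV. norm (H x $ i))"
      unfolding Hi by (intro Bochner_Integration.integrable_sum integrable_norm integrable_cis_mult int)
    then show ?thesis
    proof (rule Bochner_Integration.integrable_bound)
      show "H \<in> borel_measurable lborel" using Hm by simp
      show "AE x in lborel. norm (H x) \<le> norm (\<Sum>i\<in>UNIV. norm (H x $ i))"
        using norm_vec_def[of "H _"] by (auto intro!: AE_I2 order_trans[OF _ abs_ge_self] L2_set_le_sum simp: norm_vec_def)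
    qed
  qed
  have "set_lebesgue_integral lebesgue (cball 0 (real n)) (\<lambda>x. cis (s * (p \<bullet> x)) *s f x) = integral\<^sup>L lebesgue H"
    unfolding set_lebesgue_integral_def by (rule integral_cong_AE[OF fm HL ae'])
  also have "\<dots> = integral\<^sup>L lborel H" using Hm by (intro integral_completion) simp
  also have "\<dots> = (\<chi> i. ftrans s (trunc n (\<lambda>x. f1 x $ i)) p)"
  proof (subst vec_eq_iff, intro allI)
    fix i
    have "(integral\<^sup>L lborel H) $ i = (\<integral>x. H x $ i \<partial>lborel)"
      by (rule integral_bounded_linear[symmetric, OF bounded_linear_vec_nth Hint])
    then show "(integral\<^sup>L lborel H) $ i = (\<chi> i. ftrans s (trunc n (\<lambda>x. f1 x $ i)) p) $ i"
      by (simp add: Hi ftrans_def)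
  qed
  finally show ?thesis .
qed

lemma inv_fourier_AE:
  fixes f f1 :: "real^3 \<Rightarrow> complex^4"
  assumes ae: "AE x in lebesgue. f x = f1 x" and f1[measurable]: "\<And>i. (\<lambda>x. f1 x $ i) \<in> borel_measurable borel"
    and fin: "\<And>i. (\<integral>\<^sup>+x. ennreal ((norm (f1 x $ i))\<^sup>2) \<partial>lborel) < \<infinity>"
    and g: "\<And>i. l2_ftrans 1 (\<lambda>p. f1 p $ i) (g i)"
  shows "AE x in lebesgue. inv_fourier f x = (\<chi> i. of_real ((2 * pi) powr (-3/2)) * g i x)"
proof -
  define c where "c = (2 * pi) powr (-3/2)"
  have gm[measurable]: "g i \<in> borel_measurable borel" for i using g[of i] by (simp add: l2_ftrans_def)
  define G where "G n x = c *\<^sub>R set_lebesgue_integral lebesgue (cball 0 (real n)) (\<lambda>p. exp (\<i> * complex_of_real (p \<bullet> x)) *s f p)" for n x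
  define g0 where "g0 x = (\<chi> i. of_real c * g i x)" for x
  have G: "G n x = (\<chi> i. of_real c * ftrans 1 (trunc n (\<lambda>p. f1 p $ i)) x)" for n x
  proof -
    have "exp (\<i> * complex_of_real (p \<bullet> x)) = cis (1 * (x \<bullet> p))" for p by (simp add: cis_conv_exp inner_commute)
    moreover have "integrable lborel (trunc n (\<lambda>x. f1 x $ i))" for i by (rule integrable_trunc[OF f1 fin])
    ultimately show ?thesis
      unfolding G_def by (simp only: truncated_transform_component[OF ae f1]) (simp add: vec_eq_iff scaleR_conv_of_real[where 'a = complex])
  qed
  have Gm: "G n \<in> borel_measurable borel" for n
    by (rule borel_measurable_vecI) (simp add: G)
  have g0m: "g0 \<in> borel_measurable borel"
    by (rule borel_measurable_vecI) (simp add: g0_def)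
  have "AE x in lebesgue. L2_limit G x = g0 x"
  proof (rule L2_limit_AE[OF Gm g0m])
    have "(\<integral>\<^sup>+x. ennreal ((norm (g i x))\<^sup>2) \<partial>lborel) < \<infinity>" for i
      by (rule l2_ftrans_L2[OF f1 fin _ g]) simp
    then show "(\<integral>\<^sup>+x. ennreal ((norm (g0 x))\<^sup>2) \<partial>lborel) < \<infinity>"
      by (subst nn_integral_norm_vec_squared)
        (auto simp: g0_def norm_mult power_mult_distrib ennreal_mult nn_integral_cmult ennreal_mult_less_top)
    have "(\<integral>\<^sup>+x. ennreal ((norm (G n x - g0 x))\<^sup>2) \<partial>lborel)
      = (\<Sum>i\<in>UNIV. ennreal (c\<^sup>2) * (\<integral>\<^sup>+x. ennreal ((norm (ftrans 1 (trunc n (\<lambda>p. f1 p $ i)) x - g i x))\<^sup>2) \<partial>lborel))" for n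
      by (subst nn_integral_norm_vec_squared)
        (auto simp: G g0_def norm_mult power_mult_distrib ennreal_mult nn_integral_cmult right_diff_distrib[symmetric])
    moreover have "(\<lambda>n. \<Sum>i\<in>UNIV. ennreal (c\<^sup>2) * (\<integral>\<^sup>+x. ennreal ((norm (ftrans 1 (trunc n (\<lambda>p. f1 p $ i)) x - g i x))\<^sup>2) \<partial>lborel)) \<longlonglongrightarrow> (\<Sum>i\<in>(UNIV::4 set). ennreal (c\<^sup>2) * 0)"
      using g by (intro tendsto_sum ennreal_tendsto_cmult) (auto simp: l2_ftrans_def)
    ultimately show "(\<lambda>n. \<integral>\<^sup>+x. ennreal ((norm (G n x - g0 x))\<^sup>2) \<partial>lborel) \<longlonglongrightarrow> 0" by simp
  qed
  then show ?thesis unfolding inv_fourier_def G_def[abs_def] c_def[symmetric] g0_def .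
qed

text \<open>The support is bounded, so the truncations stop changing once n \<ge> R and the limit is
  an ordinary Fourier integral, defined at every p.\<close>

lemma fourier_AE:
  fixes \<psi> \<psi>1 :: "real^3 \<Rightarrow> complex^4"
  assumes ae: "AE x in lebesgue. \<psi> x = \<psi>1 x" and \<psi>1[measurable]: "\<And>i. (\<lambda>x. \<psi>1 x $ i) \<in> borel_measurable borel"
    and fin: "\<And>i. (\<integral>\<^sup>+x. ennreal ((norm (\<psi>1 x $ i))\<^sup>2) \<partial>lborel) < \<infinity>"
    and supp: "\<And>x. norm x > R \<Longrightarrow> \<psi>1 x = 0"
  shows "AE p in lebesgue. fourier \<psi> p = (\<chi> i. of_real ((2 * pi) powr (-3/2)) * ftrans (-1) (\<lambda>x. \<psi>1 x $ i) p)"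
proof -
  define c where "c = (2 * pi) powr (-3/2)"
  define G where "G n p = c *\<^sub>R set_lebesgue_integral lebesgue (cball 0 (real n)) (\<lambda>x. exp (- \<i> * complex_of_real (p \<bullet> x)) *s \<psi> x)" for n p
  define g0 where "g0 p = (\<chi> i. of_real c * ftrans (-1) (\<lambda>x. \<psi>1 x $ i) p)" for p
  have int: "integrable lborel (trunc n (\<lambda>x. \<psi>1 x $ i))" for i n by (rule integrable_trunc[OF \<psi>1 fin])
  have tr: "trunc n (\<lambda>x. \<psi>1 x $ i) = (\<lambda>x. \<psi>1 x $ i)" if "real n \<ge> R" for n i
    using that supp by (force simp: trunc_def indicator_def)
  have G: "G n p = (\<chi> i. of_real c * ftrans (-1) (trunc n (\<lambda>x. \<psi>1 x $ i)) p)" for n p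
  proof -
    have "exp (- \<i> * complex_of_real (p \<bullet> x)) = cis (-1 * (p \<bullet> x))" for x by (simp add: cis_conv_exp)
    then show ?thesis
      unfolding G_def by (simp only: truncated_transform_component[OF ae \<psi>1 int]) (simp add: vec_eq_iff scaleR_conv_of_real[where 'a = complex])
  qed
  have Gm: "G n \<in> borel_measurable borel" for n
    by (rule borel_measurable_vecI) (simp add: G)
  have g0m: "g0 \<in> borel_measurable borel"
    by (rule borel_measurable_vecI) (simp add: g0_def)
  have "AE x in lebesgue. L2_limit G x = g0 x"
  proof (rule L2_limit_AE[OF Gm g0m])
    obtain n where n: "real n \<ge> R" using real_arch_simple by blast
    have "(\<integral>\<^sup>+p. ennreal ((norm (ftrans (-1) (\<lambda>x. \<psi>1 x $ i) p))\<^sup>2) \<partial>lborel) < \<infinity>" for i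
      using int[of n i] unfolding tr[OF n] by (intro ftrans_L2 fin) auto
    then show "(\<integral>\<^sup>+x. ennreal ((norm (g0 x))\<^sup>2) \<partial>lborel) < \<infinity>"
      by (subst nn_integral_norm_vec_squared)
        (auto simp: g0_def norm_mult power_mult_distrib ennreal_mult nn_integral_cmult ennreal_mult_less_top)
    have "(\<integral>\<^sup>+x. ennreal ((norm (G k x - g0 x))\<^sup>2) \<partial>lborel) = 0" if "k \<ge> n" for k
    proof -
      have "real k \<ge> R" using n that by linarith
      then show ?thesis by (simp add: G g0_def tr)
    qed
    then show "(\<lambda>n. \<integral>\<^sup>+x. ennreal ((norm (G n x - g0 x))\<^sup>2) \<partial>lborel) \<longlonglongrightarrow> 0"
      by (intro tendsto_eventually eventually_sequentiallyI)
  qed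
  then show ?thesis unfolding fourier_def G_def[abs_def] c_def[symmetric] g0_def .
qed

lemma continuous_on_ftrans:
  fixes f :: "'a::euclidean_space \<Rightarrow> complex"
  assumes f: "integrable lborel f"
  shows "continuous_on UNIV (ftrans s f)"
proof (rule continuous_on_sequentiallyI)
  fix u :: "nat \<Rightarrow> 'a" and a assume u: "u \<longlonglongrightarrow> a"
  have [measurable]: "f \<in> borel_measurable borel" using f by auto
  show "(\<lambda>n. ftrans s f (u n)) \<longlonglongrightarrow> ftrans s f a"
    unfolding ftrans_def
  proof (rule integral_dominated_convergence)
    show "integrable lborel (\<lambda>p. norm (f p))" using f by simp
    show "AE p in lborel. (\<lambda>n. cis (s * (u n \<bullet> p)) * f p) \<longlonglongrightarrow> cis (s * (a \<bullet> p)) * f p"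
      by (intro AE_I2 tendsto_mult tendsto_const isCont_tendsto_compose[of _ cis] tendsto_inner u continuous_on_interior[of UNIV cis])
        (auto intro: continuous_intros)
  qed (auto simp: norm_mult)
qed

text \<open>On a bounded support the weight exp(-\<i> w (e \<bullet> x)) is bounded uniformly for w
  in a disc, so a multiple of |h| dominates the integrand.\<close>

lemma holomorphic_on_ftrans_line:
  fixes h :: "'a::euclidean_space \<Rightarrow> complex"
  assumes h: "integrable lborel h" and supp: "\<And>x. norm x > \<rho> \<Longrightarrow> h x = 0" and e: "norm e = 1"
  shows "(\<lambda>w. ftrans s (\<lambda>x. exp (- \<i> * w * of_real (e \<bullet> x)) * h x) p) holomorphic_on UNIV"
  unfolding ftrans_def
proof (rule holomorphic_on_param_integral)
  have [measurable]: "h \<in> borel_measurable borel" using h by auto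
  show "(\<lambda>w. cis (s * (p \<bullet> x)) * (exp (- \<i> * w * of_real (e \<bullet> x)) * h x)) holomorphic_on UNIV" for x
    by (intro holomorphic_intros)
  show "(\<lambda>x. cis (s * (p \<bullet> x)) * (exp (- \<i> * z * of_real (e \<bullet> x)) * h x)) \<in> borel_measurable lborel" for z
    by measurable
  fix z :: complex
  have "norm (cis (s * (p \<bullet> x)) * (exp (- \<i> * w * of_real (e \<bullet> x)) * h x)) \<le> exp ((norm z + 1) * \<bar>\<rho>\<bar>) * norm (h x)"
    if w: "w \<in> ball z 1" for x w
  proof (cases "norm x > \<rho>")
    case False
    have "norm (w - z) < 1" using w by (simp add: dist_norm norm_minus_commute)
    then have Im: "\<bar>Im w\<bar> \<le> norm z + 1" using abs_Im_le_cmod[of w] norm_triangle_ineq2[of w z] by linarith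
    have "\<bar>e \<bullet> x\<bar> \<le> norm x" using Cauchy_Schwarz_ineq2[of e x] e by simp
    then have "\<bar>e \<bullet> x\<bar> \<le> \<bar>\<rho>\<bar>" using False by linarith
    then have "\<bar>Im w\<bar> * \<bar>e \<bullet> x\<bar> \<le> (norm z + 1) * \<bar>\<rho>\<bar>" using Im by (intro mult_mono) auto
    then have "Im w * (e \<bullet> x) \<le> (norm z + 1) * \<bar>\<rho>\<bar>" by (metis abs_ge_self abs_mult order_trans)
    then show ?thesis by (simp add: norm_mult mult_right_mono)
  qed (simp add: supp)
  then show "\<exists>r>0. \<exists>B. integrable lborel B \<and> ball z r \<subseteq> UNIV \<and>
      (\<forall>x. \<forall>w\<in>ball z r. norm (cis (s * (p \<bullet> x)) * (exp (- \<i> * w * of_real (e \<bullet> x)) * h x)) \<le> B x)"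
    using h by (intro exI[of _ 1] exI[of _ "\<lambda>x. exp ((norm z + 1) * \<bar>\<rho>\<bar>) * norm (h x)"] conjI) auto
qed auto

section \<open>Exponentials of the symbol and edges of supports\<close>

text \<open>The matrix series is summed entry by entry, the entries being read off from the action
  of the powers on unit vectors; uniqueness of sums then identifies the result on every
  vector.\<close>

lemma matrix_exp_mult_vec:
  fixes A :: "complex^'n^'n"
  assumes sums: "\<And>v i. (\<lambda>n. ((((*v) A ^^ n) v) $ i) / of_nat (fact n)) sums (f v $ i)"
  shows "matrix_exp A *v v = f v"
proof -
  define X where "X n = (1 / fact n :: real) *\<^sub>R (((**) A ^^ n) (mat 1))" for n
  have pow: "(((**) A ^^ n) (mat 1)) *v v = ((*v) A ^^ n) v" for n v
    by (induction n) (simp_all add: matrix_vector_mul_assoc[symmetric])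
  have Xv: "(X n *v v) $ i = ((((*v) A ^^ n) v) $ i) / of_nat (fact n)" for n v i
    by (simp add: X_def scaleR_matrix_vector_mult pow scaleR_conv_of_real[where 'a = complex])
  define M where "M = (\<chi> i j. f (axis j 1) $ i)"
  have entry: "X n $ i $ j = (X n *v axis j 1) $ i" for n i j
    by (simp add: matrix_vector_mult_def axis_def if_distrib[where f = "\<lambda>x. _ * x"] cong: if_cong)
  have Mij: "(\<lambda>n. X n $ i $ j) sums (M $ i $ j)" for i j
    unfolding entry Xv using sums[of "axis j 1" i] by (simp add: M_def)
  have "X sums M"
    unfolding sums_def
  proof (intro vec_tendstoI)
    fix i j show "(\<lambda>n. (\<Sum>k<n. X k) $ i $ j) \<longlonglongrightarrow> M $ i $ j"
      using Mij[of i j] by (simp add: sums_def)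
  qed
  then have "matrix_exp A = M" unfolding matrix_exp_def X_def by (rule sums_unique[symmetric])
  moreover have "(M *v v) $ i = f v $ i" for i
  proof (rule sums_unique2)
    show "(\<lambda>n. (X n *v v) $ i) sums ((M *v v) $ i)"
      unfolding matrix_vector_mult_def by (simp, intro sums_sum sums_mult2 Mij)
    show "(\<lambda>n. (X n *v v) $ i) sums (f v $ i)" unfolding Xv by (rule sums)
  qed
  ultimately show ?thesis by (simp only: vec_eq_iff[of _ "f v"] simp_thms)
qed

text \<open>Every vector splits into eigenvectors of h for E and -E, on which the exponential series
  is scalar.\<close>

lemma matrix_exp_of_square_scalar:
  fixes h :: "complex^'n^'n"
  assumes E: "E \<noteq> (0::real)" and hh: "\<And>v. h *v (h *v v) = of_real (E\<^sup>2) *s v"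
  shows "matrix_exp (mat (\<i> * of_real t) ** h) *v v
    = cos (of_real (t * E)) *s v + (\<i> * (sin (of_real (t * E)) / of_real E)) *s (h *v v)"
proof (rule matrix_exp_mult_vec)
  fix v i
  define A where "A = mat (\<i> * of_real t) ** h"
  \<comment> \<open>For s = 1 and s = -1, the projection of v onto the eigenspace of h for the
    eigenvalue s E.\<close>
  define u where "u s v = (1/2) *s (v + (s / of_real E) *s (h *v v))" for s v
  have mat: "mat c *v v = c *s v" for c :: complex and v :: "complex^'n"
    by (simp add: vec_eq_iff matrix_vector_mult_def mat_def if_distrib[where f = "\<lambda>x. x * _"] cong: if_cong)
  have A: "A *v v = (\<i> * of_real t) *s (h *v v)" for v
    by (simp add: A_def matrix_vector_mul_assoc[symmetric] mat)
  have Asm: "A *v (c *s v) = c *s (A *v v)" and Aadd: "A *v (v + w) = A *v v + A *v w" for c v w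
    by (simp_all add: vector_scalar_commute matrix_vector_right_distrib)
  have Au: "A *v (u s v) = (s * \<i> * of_real (t * E)) *s u s v" if "s * s = 1" for s v
  proof -
    have "A *v (u s v) = (\<i> * of_real t / 2) *s (h *v v + (s / of_real E) *s (of_real (E\<^sup>2) *s v))"
      unfolding A u_def by (simp add: vector_scalar_commute matrix_vector_right_distrib hh vector_smult_assoc)
    also have "\<dots> = (s * \<i> * of_real (t * E)) *s u s v"
    proof (subst vec_eq_iff, intro allI)
      fix i
      have "s * (s * x) = x" for x using that by (simp add: mult.assoc[symmetric])
      then show "((\<i> * of_real t / 2) *s (h *v v + (s / of_real E) *s (of_real (E\<^sup>2) *s v))) $ i = ((s * \<i> * of_real (t * E)) *s u s v) $ i"
        using E by (simp add: u_def field_simps power2_eq_square)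
    qed
    finally show ?thesis .
  qed
  have powu: "((*v) A ^^ n) (u s v) = ((s * \<i> * of_real (t * E)) ^ n) *s u s v" if "s * s = 1" for n s v
    by (induction n) (simp_all add: Asm Au[OF that] vector_smult_assoc mult.commute)
  have powadd: "((*v) A ^^ n) (v + w) = ((*v) A ^^ n) v + ((*v) A ^^ n) w" for n v w
    by (induction n) (simp_all add: Aadd)
  have v: "v = u 1 v + u (-1) v"
    by (simp add: u_def vec_eq_iff algebra_simps)
  have su: "(\<lambda>n. ((((*v) A ^^ n) (u s v)) $ i) / of_nat (fact n)) sums (exp (s * \<i> * of_real (t * E)) * u s v $ i)" if "s * s = 1" for s
    using sums_mult2[OF exp_converges[of "s * \<i> * of_real (t * E)"], of "u s v $ i"]
    by (simp add: powu[OF that] scaleR_conv_of_real divide_inverse mult_ac)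
  have "(\<lambda>n. ((((*v) A ^^ n) (u 1 v)) $ i) / of_nat (fact n) + ((((*v) A ^^ n) (u (-1) v)) $ i) / of_nat (fact n))
      sums (exp (1 * \<i> * of_real (t * E)) * u 1 v $ i + exp (-1 * \<i> * of_real (t * E)) * u (-1) v $ i)"
    by (intro sums_add su) auto
  moreover have "((((*v) A ^^ n) (u 1 v)) $ i) / of_nat (fact n) + ((((*v) A ^^ n) (u (-1) v)) $ i) / of_nat (fact n)
     = ((((*v) A ^^ n) v) $ i) / of_nat (fact n)" for n
    by (subst (3) v) (simp add: powadd add_divide_distrib)
  moreover have "exp (1 * \<i> * of_real (t * E)) * u 1 v $ i + exp (-1 * \<i> * of_real (t * E)) * u (-1) v $ i
     = (cos (of_real (t * E)) *s v + (\<i> * (sin (of_real (t * E)) / of_real E)) *s (h *v v)) $ i"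
  proof -
    have e1: "exp (1 * \<i> * of_real (t * E)) = cos (of_real (t * E)) + \<i> * sin (complex_of_real (t * E))"
      using exp_Euler[of "of_real (t * E)"] by simp
    have e2: "exp (-1 * \<i> * of_real (t * E)) = cos (of_real (t * E)) - \<i> * sin (complex_of_real (t * E))"
      using exp_minus_Euler[of "of_real (t * E)"] by simp
    show ?thesis unfolding e1 e2 u_def using E by (simp add: field_simps)
  qed
  ultimately show "(\<lambda>n. ((((*v) (mat (\<i> * of_real t) ** h) ^^ n) v) $ i) / of_nat (fact n))
      sums ((cos (of_real (t * E)) *s v + (\<i> * (sin (of_real (t * E)) / of_real E)) *s (h *v v)) $ i)"
    unfolding A_def by simp
qed

section \<open>Levels below which a state vanishes, and the greatest of them\<close>

definition vanishes_below :: "real^3 \<Rightarrow> (real^3 \<Rightarrow> complex^4) \<Rightarrow> ereal \<Rightarrow> bool" where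
  "vanishes_below e \<psi> a \<longleftrightarrow> (AE x in lebesgue. indicat_real {x. ereal (x \<bullet> e) \<le> a} x *\<^sub>R \<psi> x = 0)"

lemma vanishes_below_iff: "vanishes_below e \<psi> a \<longleftrightarrow> (AE x in lebesgue. ereal (x \<bullet> e) \<le> a \<longrightarrow> \<psi> x = 0)"
  unfolding vanishes_below_def by (intro arg_cong[where f = "\<lambda>P. almost_everywhere lebesgue P"]) (auto simp: indicator_def)

lemma vanishes_below_mono: "vanishes_below e \<psi> b \<Longrightarrow> a \<le> b \<Longrightarrow> vanishes_below e \<psi> a"
  unfolding vanishes_below_iff by (auto elim!: eventually_mono intro: order_trans)

text \<open>A countable union of null sets: every x lies below some natural number.\<close>

lemma vanishes_below_PInf: "vanishes_below e \<psi> \<infinity> \<longleftrightarrow> (\<forall>a::real. vanishes_below e \<psi> a)"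
proof
  assume "\<forall>a::real. vanishes_below e \<psi> a"
  then have "\<forall>n::nat. AE x in lebesgue. ereal (x \<bullet> e) \<le> ereal (real n) \<longrightarrow> \<psi> x = 0"
    unfolding vanishes_below_iff by blast
  then have "AE x in lebesgue. \<forall>n::nat. ereal (x \<bullet> e) \<le> ereal (real n) \<longrightarrow> \<psi> x = 0"
    unfolding AE_all_countable .
  then show "vanishes_below e \<psi> \<infinity>"
    unfolding vanishes_below_iff by eventually_elim (use real_arch_simple in auto)
qed (auto intro: vanishes_below_mono)

text \<open>This makes the GREATEST in \<open>support_edge\<close> meaningful. Below a finite
  supremum countably many levels exhaust the open half space, and the bounding hyperplane is a null
  set.\<close>

lemma vanishes_below_Sup:
  assumes e: "norm e = 1"
  shows "vanishes_below e \<psi> (Sup {a. vanishes_below e \<psi> a})"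
proof -
  define s where "s = Sup {a. vanishes_below e \<psi> a}"
  have below: "vanishes_below e \<psi> a" if "a < s" for a
    using that vanishes_below_mono unfolding s_def less_Sup_iff by (auto intro: less_imp_le)
  show ?thesis
  proof (cases s)
    case (real r)
    have "vanishes_below e \<psi> (ereal (r - 1 / real (Suc n)))" for n
      by (rule below) (simp add: real)
    then have "AE x in lebesgue. \<forall>n. ereal (x \<bullet> e) \<le> ereal (r - 1 / real (Suc n)) \<longrightarrow> \<psi> x = 0"
      unfolding vanishes_below_iff AE_all_countable by blast
    with AE_completion[OF AE_off_hyperplane[OF e, of r]] have "AE x in lebesgue. ereal (x \<bullet> e) \<le> s \<longrightarrow> \<psi> x = 0"
    proof eventually_elim
      case (elim x)
      show ?case
      proof
        assume "ereal (x \<bullet> e) \<le> s"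
        then have "0 < r - x \<bullet> e" using elim(1) real by simp
        then obtain n where "1 / real (Suc n) < r - x \<bullet> e" using nat_approx_posE by metis
        then have "x \<bullet> e \<le> r - 1 / real (Suc n)" by linarith
        then show "\<psi> x = 0" using elim(2) by auto
      qed
    qed
    then have "vanishes_below e \<psi> s" by (simp only: vanishes_below_iff)
    then show ?thesis by (simp only: s_def)
  next
    case PInf
    then have "vanishes_below e \<psi> (ereal a)" for a by (intro below) simp
    then have "vanishes_below e \<psi> s" unfolding PInf vanishes_below_PInf by simp
    then show ?thesis by (simp only: s_def)
  next
    case MInf
    then have "vanishes_below e \<psi> s" by (simp add: vanishes_below_iff)
    then show ?thesis by (simp only: s_def)
  qed
qed

lemma support_edge_eq_Sup:
  assumes e: "norm e = 1"
  shows "support_edge e \<psi> = Sup {a. vanishes_below e \<psi> a}"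
  unfolding support_edge_def vanishes_below_def[symmetric]
  by (rule Greatest_equality) (auto intro: vanishes_below_Sup[OF e] Sup_upper)

text \<open>The infinite levels follow from the real ones: vanishing below +infinity is vanishing
  below every real level, and vanishing below -infinity always holds.\<close>

lemma support_edge_shift:
  assumes e: "norm e = 1"
    and eq: "\<And>a::real. vanishes_below e \<psi> (ereal a) \<longleftrightarrow> vanishes_below e \<psi>' (ereal (a + d))"
  shows "support_edge e \<psi> = support_edge e \<psi>' - ereal d"
proof -
  have eq': "vanishes_below e \<psi> a \<longleftrightarrow> vanishes_below e \<psi>' (a + ereal d)" for a
  proof (cases a)
    case PInf
    have "(\<forall>a::real. vanishes_below e \<psi>' (ereal (a + d))) \<longleftrightarrow> (\<forall>a::real. vanishes_below e \<psi>' (ereal a))"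
      by (metis diff_add_cancel)
    then show ?thesis by (simp add: PInf vanishes_below_PInf eq)
  next
    case MInf
    then show ?thesis by (simp add: vanishes_below_iff)
  qed (simp add: eq)
  have sub: "x - ereal d + ereal d = x" "x + ereal d - ereal d = x" for x by (cases x; simp)+
  show ?thesis
    unfolding support_edge_def[of e \<psi>] vanishes_below_def[symmetric]
  proof (rule Greatest_equality)
    show "vanishes_below e \<psi> (support_edge e \<psi>' - ereal d)"
      unfolding eq' sub support_edge_eq_Sup[OF e] by (rule vanishes_below_Sup[OF e])
    fix y assume "vanishes_below e \<psi> y"
    then have "y + ereal d \<le> support_edge e \<psi>'"
      unfolding eq' support_edge_eq_Sup[OF e] by (intro Sup_upper) simp
    then have "y + ereal d - ereal d \<le> support_edge e \<psi>' - ereal d" by (rule ereal_minus_mono) simp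
    then show "y \<le> support_edge e \<psi>' - ereal d" unfolding sub .
  qed
qed

section \<open>The evolution of a localized wave function\<close>

text \<open>\<open>\<psi>1\<close> is a Borel representative of \<psi> that is zero outside the ball
  at every point, so that exponential weights can be bounded pointwise.\<close>

locale localized_wave =
  fixes \<alpha> :: "3 \<Rightarrow> complex^4^4" and \<beta> :: "complex^4^4" and m R :: real
    and \<psi> \<psi>1 :: "real^3 \<Rightarrow> complex^4"
  assumes m: "m > 0" and dm: "dirac_matrices \<alpha> \<beta>" and R: "R > 0"
    and ae: "AE x in lebesgue. \<psi> x = \<psi>1 x"
    and \<psi>1_meas: "\<And>i. (\<lambda>x. \<psi>1 x $ i) \<in> borel_measurable borel"
    and \<psi>1_L2: "\<And>i. (\<integral>\<^sup>+x. ennreal ((norm (\<psi>1 x $ i))\<^sup>2) \<partial>lborel) < \<infinity>"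
    and supp: "\<And>x. norm x > R \<Longrightarrow> \<psi>1 x = 0"
begin

definition c :: real where "c = (2 * pi) powr (-3/2)"

lemma c_pos: "c > 0" by (simp add: c_def)

text \<open>The normalised Fourier transform of the state at the complex momentum p + w e: the
  exponential weight supplies the shift by w e.\<close>

definition \<Phi> :: "real^3 \<Rightarrow> real^3 \<Rightarrow> complex \<Rightarrow> complex^4" where
  "\<Phi> e p w = (\<chi> i. of_real c * ftrans (-1) (\<lambda>x. exp (- \<i> * w * of_real (e \<bullet> x)) * \<psi>1 x $ i) p)"

definition B :: real where "B = (\<Sum>i\<in>UNIV. c * (\<integral>x. norm (\<psi>1 x $ i) \<partial>lborel))"

lemma B_nonneg: "B \<ge> 0" using c_pos by (simp add: B_def sum_nonneg)

lemma \<psi>1_int: "integrable lborel (\<lambda>x. \<psi>1 x $ i)"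
proof -
  obtain n :: nat where n: "real n \<ge> R" using real_arch_simple by blast
  have "trunc n (\<lambda>x. \<psi>1 x $ i) = (\<lambda>x. \<psi>1 x $ i)"
    using n supp by (force simp: trunc_def indicator_def)
  then show ?thesis using integrable_trunc[OF \<psi>1_meas \<psi>1_L2, of n i] by simp
qed

lemma exp_weight_bound:
  assumes e: "norm e = 1"
  shows "norm (exp (- \<i> * w * of_real (e \<bullet> x)) * \<psi>1 x $ i) \<le> exp (R * \<bar>Im w\<bar>) * norm (\<psi>1 x $ i)"
proof (cases "norm x > R")
  case False
  have "\<bar>e \<bullet> x\<bar> \<le> norm x" using Cauchy_Schwarz_ineq2[of e x] e by simp
  then have "\<bar>e \<bullet> x\<bar> \<le> R" using False by linarith
  then have "\<bar>e \<bullet> x\<bar> * \<bar>Im w\<bar> \<le> R * \<bar>Im w\<bar>" by (intro mult_right_mono) auto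
  then have "Im w * (e \<bullet> x) \<le> R * \<bar>Im w\<bar>" by (metis abs_ge_self abs_mult mult.commute order_trans)
  then show ?thesis by (simp add: norm_mult mult_right_mono)
qed (simp add: supp)

lemma weighted_int:
  assumes e: "norm e = 1"
  shows "integrable lborel (\<lambda>x. exp (- \<i> * w * of_real (e \<bullet> x)) * \<psi>1 x $ i)"
proof (rule Bochner_Integration.integrable_bound)
  show "integrable lborel (\<lambda>x. exp (R * \<bar>Im w\<bar>) * norm (\<psi>1 x $ i))" using \<psi>1_int by auto
  show "(\<lambda>x. exp (- \<i> * w * of_real (e \<bullet> x)) * \<psi>1 x $ i) \<in> borel_measurable lborel"
    using \<psi>1_meas[of i] by measurable
  show "AE x in lborel. norm (exp (- \<i> * w * of_real (e \<bullet> x)) * \<psi>1 x $ i) \<le> norm (exp (R * \<bar>Im w\<bar>) * norm (\<psi>1 x $ i))"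
    using exp_weight_bound[OF e] by (auto intro!: AE_I2)
qed

lemma \<Phi>_cont:
  assumes e: "norm e = 1"
  shows "continuous_on UNIV (\<lambda>p. \<Phi> e p w $ i)"
  unfolding \<Phi>_def by (simp, intro continuous_intros continuous_on_ftrans weighted_int[OF e, simplified])

lemma flow: "norm e = 1 \<Longrightarrow> dirac_flow \<alpha> \<beta> m e (\<Phi> e) R B"
proof unfold_locales
  assume e: "norm e = 1"
  show "(\<lambda>w. \<Phi> e p w $ i) holomorphic_on UNIV" for p i
    unfolding \<Phi>_def
    using holomorphic_on_mult[OF holomorphic_on_const holomorphic_on_ftrans_line[OF \<psi>1_int _ e, of R i "-1" p], of "of_real c"] supp
    by simp
  show "\<Phi> e (p + s *\<^sub>R e) w = \<Phi> e p (w + of_real s)" for p s w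
  proof -
    have "cis (- 1 * ((p + s *\<^sub>R e) \<bullet> x)) * (exp (- \<i> * w * of_real (e \<bullet> x)) * y)
      = cis (- 1 * (p \<bullet> x)) * (exp (- \<i> * (w + of_real s) * of_real (e \<bullet> x)) * y)" for x y
      unfolding cis_conv_exp mult.assoc[symmetric] exp_add[symmetric] by (simp add: inner_add_left algebra_simps)
    then show ?thesis unfolding \<Phi>_def ftrans_def by (simp only:)
  qed
  show "norm (\<Phi> e p w) \<le> B * exp (R * \<bar>Im w\<bar>)" for p w
  proof -
    have "norm (\<Phi> e p w) \<le> (\<Sum>i\<in>UNIV. norm (\<Phi> e p w $ i))"
      unfolding norm_vec_def by (rule L2_set_le_sum) simp
    also have "\<dots> \<le> (\<Sum>i\<in>UNIV. c * (\<integral>x. norm (\<psi>1 x $ i) \<partial>lborel) * exp (R * \<bar>Im w\<bar>))"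
    proof (rule sum_mono)
      fix i :: 4
      have "norm (ftrans (-1) (\<lambda>x. exp (- \<i> * w * of_real (e \<bullet> x)) * \<psi>1 x $ i) p)
          \<le> (\<integral>x. norm (exp (- \<i> * w * of_real (e \<bullet> x)) * \<psi>1 x $ i) \<partial>lborel)" by (rule norm_ftrans_le)
      also have "\<dots> \<le> (\<integral>x. exp (R * \<bar>Im w\<bar>) * norm (\<psi>1 x $ i) \<partial>lborel)"
        using \<psi>1_int by (intro integral_mono integrable_norm weighted_int[OF e] exp_weight_bound[OF e] integrable_mult_right) auto
      also have "\<dots> = (\<integral>x. norm (\<psi>1 x $ i) \<partial>lborel) * exp (R * \<bar>Im w\<bar>)" by simp
      finally show "norm (\<Phi> e p w $ i) \<le> c * (\<integral>x. norm (\<psi>1 x $ i) \<partial>lborel) * exp (R * \<bar>Im w\<bar>)"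
        using c_pos by (simp add: \<Phi>_def norm_mult)
    qed
    also have "\<dots> = B * exp (R * \<bar>Im w\<bar>)" by (simp add: B_def sum_distrib_right)
    finally show ?thesis .
  qed
qed (use m dm R B_nonneg in auto)

abbreviation "flow_F e \<equiv> dirac_flow.F \<alpha> \<beta> m e (\<Phi> e)"
abbreviation "flow_decays e \<equiv> dirac_flow.decays \<alpha> \<beta> m e (\<Phi> e)"

definition \<psi>hat :: "real^3 \<Rightarrow> complex^4" where
  "\<psi>hat p = (\<chi> i. of_real c * ftrans (-1) (\<lambda>x. \<psi>1 x $ i) p)"

text \<open>The integrand of \<open>dirac_evolution\<close> with the continuous version
  \<open>\<psi>hat\<close> in place of \<open>fourier \<psi>\<close>, which is determined only
  almost everywhere.\<close>

definition \<Psi> :: "real \<Rightarrow> real^3 \<Rightarrow> complex^4" where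
  "\<Psi> t p = matrix_exp (mat (\<i> * of_real t) ** dirac_symbol \<alpha> \<beta> m p) *v \<psi>hat p"

abbreviation \<omega> :: "real^3 \<Rightarrow> real" where "\<omega> p \<equiv> sqrt ((norm p)\<^sup>2 + m\<^sup>2)"

lemma \<omega>_pos: "\<omega> p > 0" using m by (intro real_sqrt_gt_zero add_nonneg_pos) auto

lemma \<Psi>_eq: "\<Psi> t p = cos (of_real (t * \<omega> p)) *s \<psi>hat p
    + (\<i> * (sin (of_real (t * \<omega> p)) / of_real (\<omega> p))) *s (dirac_symbol \<alpha> \<beta> m p *v \<psi>hat p)"
  unfolding \<Psi>_def
proof (rule matrix_exp_of_square_scalar)
  show "\<omega> p \<noteq> 0" by (rule less_imp_neq[OF \<omega>_pos, symmetric])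
  have "of_real r *s v = r *\<^sub>R v" for r and v :: "complex^4"
    by (simp add: vec_eq_iff scaleR_conv_of_real[where 'a = complex])
  then show "dirac_symbol \<alpha> \<beta> m p *v (dirac_symbol \<alpha> \<beta> m p *v v) = of_real ((\<omega> p)\<^sup>2) *s v" for v
    using dirac_symbol_square[OF dm, of m p v] by (simp del: of_real_add of_real_power)
qed

text \<open>At w = 0 the squared energy q is the square of the positive number
  \<open>\<omega> p\<close>, so \<open>sinc_sqrt\<close> gives back the quotient sin(t
  \<omega>)/\<omega> of the matrix exponential.\<close>

lemma F_eq_\<Psi>:
  assumes e: "norm e = 1"
  shows "flow_F e t p 0 = \<Psi> t p"
proof -
  interpret dirac_flow \<alpha> \<beta> m e "\<Phi> e" R B by (rule flow[OF e])
  have \<Phi>0: "\<Phi> e p 0 = \<psi>hat p" by (simp add: \<Phi>_def \<psi>hat_def)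
  have sq: "of_real (t\<^sup>2) * q p 0 = (complex_of_real (t * \<omega> p))\<^sup>2"
    by (simp add: q_def power_mult_distrib flip: of_real_power)
  have "of_real (\<omega> p) * (of_real t * sinc_sqrt ((complex_of_real (t * \<omega> p))\<^sup>2)) = sin (of_real (t * \<omega> p))"
    using sinc_sqrt_square[of "of_real (t * \<omega> p)"] by (simp add: mult_ac)
  moreover have "complex_of_real (\<omega> p) \<noteq> 0"
    unfolding of_real_eq_0_iff by (rule less_imp_neq[OF \<omega>_pos, symmetric])
  ultimately have "of_real t * sinc_sqrt ((complex_of_real (t * \<omega> p))\<^sup>2) = sin (of_real (t * \<omega> p)) / of_real (\<omega> p)"
    by (metis eq_divide_imp mult.commute)
  moreover have "D p 0 (\<psi>hat p) = dirac_symbol \<alpha> \<beta> m p *v \<psi>hat p" by (simp add: D_def)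
  ultimately show ?thesis
    unfolding F_def \<Psi>_eq sq \<Phi>0 cos_sqrt_square by simp
qed

text \<open>Besides measurability this provides the continuity in p under which Fourier inversion
  holds at every momentum.\<close>

lemma F_cont:
  assumes e: "norm e = 1"
  shows "continuous_on UNIV (\<lambda>p. flow_F e t p w $ i)"
proof -
  interpret dirac_flow \<alpha> \<beta> m e "\<Phi> e" R B by (rule flow[OF e])
  have q: "continuous_on UNIV (\<lambda>p. of_real (t\<^sup>2) * q p w)" unfolding q_def by (intro continuous_intros)
  have 1: "continuous_on UNIV (\<lambda>p. cos_sqrt (of_real (t\<^sup>2) * q p w))"
    by (rule continuous_on_compose2[OF holomorphic_on_imp_continuous_on[OF holomorphic_cos_sqrt] q]) simp
  have 2: "continuous_on UNIV (\<lambda>p. sinc_sqrt (of_real (t\<^sup>2) * q p w))"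
    by (rule continuous_on_compose2[OF holomorphic_on_imp_continuous_on[OF holomorphic_sinc_sqrt] q]) simp
  have M: "continuous_on UNIV (\<lambda>p. (A *v \<Phi> e p w) $ j)" for j and A :: "complex^4^4"
    unfolding matrix_vector_mult_def vec_lambda_beta
    by (intro continuous_on_sum continuous_on_mult continuous_on_const \<Phi>_cont[OF e])
  have D: "continuous_on UNIV (\<lambda>p. D p w (\<Phi> e p w) $ j)" for j
    unfolding D_def dirac_symbol_vector[of \<alpha> \<beta> m] vector_add_component vector_scaleR_component vector_smult_component
    by (intro continuous_on_add continuous_on_mult continuous_on_scaleR continuous_on_const M continuous_on_component continuous_on_id)
  show ?thesis
    unfolding F_def vector_add_component vector_smult_component
    by (intro continuous_on_add continuous_on_mult continuous_on_const 1 2 D \<Phi>_cont[OF e])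
qed

lemma norm_axis_1: "norm (axis 1 1 :: real^3) = 1" by simp

text \<open>\<open>\<Psi>\<close> does not involve a direction; any unit vector, here the first
  axis, gives access to the continuity of F.\<close>

lemma \<Psi>_cont: "continuous_on UNIV (\<lambda>p. \<Psi> t p $ i)"
  using F_cont[OF norm_axis_1, of t 0 i] by (simp add: F_eq_\<Psi>[OF norm_axis_1])

lemma \<Psi>_meas[measurable]: "(\<lambda>p. \<Psi> t p $ i) \<in> borel_measurable borel"
  by (rule borel_measurable_continuous_onI[OF \<Psi>_cont])

lemma \<psi>hat_bound: "norm (\<psi>hat p) \<le> B"
proof -
  interpret dirac_flow \<alpha> \<beta> m "axis 1 1" "\<Phi> (axis 1 1)" R B by (rule flow[OF norm_axis_1])
  show ?thesis using \<Phi>_bound[of p 0] by (simp add: \<Phi>_def \<psi>hat_def)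
qed

text \<open>A stand-in for the unitarity of exp(\<i> t h): h(p) grows at most like 1 + |p|, and (1 +
  |p|)/\<omega> \<le> 1/m + 1.\<close>

lemma \<Psi>_bound:
  obtains K where "K \<ge> 0" "\<And>t p. norm (\<Psi> t p) \<le> K * norm (\<psi>hat p)"
proof -
  interpret dirac_flow \<alpha> \<beta> m "axis 1 1" "\<Phi> (axis 1 1)" R B by (rule flow[OF norm_axis_1])
  obtain K where K: "K \<ge> 0" "\<And>p w v. norm (D p w v) \<le> K * (1 + norm p + norm w) * norm v"
    using D_bound by metis
  define L where "L = 1 + K * (1 / m + 1)"
  have L: "L \<ge> 0" using K m by (simp add: L_def)
  have "norm (\<Psi> t p) \<le> L * norm (\<psi>hat p)" for t p
  proof -
    have h: "norm (dirac_symbol \<alpha> \<beta> m p *v \<psi>hat p) \<le> K * (1 + norm p) * norm (\<psi>hat p)"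
      using K(2)[of p 0 "\<psi>hat p"] by (simp add: D_def)
    have co: "norm (cos (complex_of_real (t * \<omega> p))) \<le> 1" and si: "norm (sin (complex_of_real (t * \<omega> p))) \<le> 1"
      by (simp_all only: cos_of_real sin_of_real norm_of_real) auto
    have mu: "m \<le> \<omega> p" "norm p \<le> \<omega> p" using m by (auto intro: real_le_rsqrt)
    have "norm (\<Psi> t p) \<le> norm (cos (complex_of_real (t * \<omega> p))) * norm (\<psi>hat p)
        + norm (sin (complex_of_real (t * \<omega> p))) / \<omega> p * norm (dirac_symbol \<alpha> \<beta> m p *v \<psi>hat p)"
      unfolding \<Psi>_eq using \<omega>_pos[of p]
      by (rule_tac order_trans[OF norm_triangle_ineq]) (simp only: norm_vector_smult norm_mult norm_divide norm_of_real, simp)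
    also have "\<dots> \<le> 1 * norm (\<psi>hat p) + 1 / \<omega> p * (K * (1 + norm p) * norm (\<psi>hat p))"
      using \<omega>_pos[of p] K(1) by (intro add_mono mult_mono co divide_right_mono si h) auto
    also have "\<dots> = norm (\<psi>hat p) + K * (1 / \<omega> p + norm p / \<omega> p) * norm (\<psi>hat p)"
      by (simp add: algebra_simps add_divide_distrib)
    also have "\<dots> \<le> norm (\<psi>hat p) + K * (1 / m + 1) * norm (\<psi>hat p)"
    proof (intro add_left_mono mult_right_mono mult_left_mono add_mono)
      show "1 / \<omega> p \<le> 1 / m" using mu(1) m by (intro divide_left_mono mult_pos_pos \<omega>_pos) auto
      show "norm p / \<omega> p \<le> 1" using mu \<omega>_pos[of p] by (simp add: divide_le_eq)
    qed (use K in auto)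
    finally show ?thesis by (simp add: L_def algebra_simps)
  qed
  then show thesis using that L by blast
qed

lemma \<Psi>_bounded: obtains M where "\<And>t p i. norm (\<Psi> t p $ i) \<le> M"
proof -
  obtain K where K: "K \<ge> 0" "\<And>t p. norm (\<Psi> t p) \<le> K * norm (\<psi>hat p)" using \<Psi>_bound by metis
  have "norm (\<Psi> t p $ i) \<le> K * B" for t p i
    using Finite_Cartesian_Product.norm_nth_le[of "\<Psi> t p" i] K(2)[of t p] mult_left_mono[OF \<psi>hat_bound[of p] K(1)] by linarith
  then show thesis using that by blast
qed

lemma \<Psi>_L2: "(\<integral>\<^sup>+p. ennreal ((norm (\<Psi> t p $ i))\<^sup>2) \<partial>lborel) < \<infinity>"
proof -
  obtain K where K: "K \<ge> 0" "\<And>t p. norm (\<Psi> t p) \<le> K * norm (\<psi>hat p)" using \<Psi>_bound by metis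
  have [measurable]: "ftrans (-1) (\<lambda>x. \<psi>1 x $ j) \<in> borel_measurable borel" for j
    by (intro borel_measurable_ftrans \<psi>1_meas)
  have "(\<integral>\<^sup>+p. ennreal ((norm (\<psi>hat p))\<^sup>2) \<partial>lborel) < \<infinity>"
    using ftrans_L2[OF \<psi>1_int \<psi>1_L2, of "-1"]
    by (subst nn_integral_norm_vec_squared)
      (auto simp: \<psi>hat_def norm_mult power_mult_distrib ennreal_mult nn_integral_cmult ennreal_mult_less_top)
  moreover have "\<psi>hat \<in> borel_measurable borel"
    by (rule borel_measurable_vecI) (simp add: \<psi>hat_def)
  ultimately have "(\<integral>\<^sup>+p. ennreal (K\<^sup>2) * ennreal ((norm (\<psi>hat p))\<^sup>2) \<partial>lborel) < \<infinity>"
    by (subst nn_integral_cmult) (auto simp: ennreal_mult_less_top)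
  moreover have "(\<integral>\<^sup>+p. ennreal ((norm (\<Psi> t p $ i))\<^sup>2) \<partial>lborel) \<le> (\<integral>\<^sup>+p. ennreal (K\<^sup>2) * ennreal ((norm (\<psi>hat p))\<^sup>2) \<partial>lborel)"
  proof (rule nn_integral_mono)
    fix p
    have "(norm (\<Psi> t p $ i))\<^sup>2 \<le> (K * norm (\<psi>hat p))\<^sup>2"
      using order_trans[OF Finite_Cartesian_Product.norm_nth_le K(2)] by (intro power_mono) auto
    then show "ennreal ((norm (\<Psi> t p $ i))\<^sup>2) \<le> ennreal (K\<^sup>2) * ennreal ((norm (\<psi>hat p))\<^sup>2)"
      by (simp add: power_mult_distrib ennreal_mult[symmetric] ennreal_leI)
  qed
  ultimately show ?thesis by (rule le_less_trans[rotated])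
qed

text \<open>Trades the choices hidden in \<open>fourier\<close> and \<open>inv_fourier\<close> for
  the relation \<open>l2_ftrans\<close>, component by component.\<close>

lemma evolution:
  obtains g where "\<And>i. l2_ftrans 1 (\<lambda>p. \<Psi> t p $ i) (g i)"
    and "AE x in lebesgue. dirac_evolution \<alpha> \<beta> m t \<psi> x = (\<chi> i. of_real c * g i x)"
proof -
  have "\<forall>i. \<exists>g. l2_ftrans 1 (\<lambda>p. \<Psi> t p $ i) g"
    using l2_ftrans_exists[OF \<Psi>_meas \<Psi>_L2, of 1] by (metis power_one)
  from choice[OF this] obtain g where g: "\<And>i. l2_ftrans 1 (\<lambda>p. \<Psi> t p $ i) (g i)" by blast
  have "AE p in lebesgue. fourier \<psi> p = \<psi>hat p"
    using fourier_AE[OF ae \<psi>1_meas \<psi>1_L2 supp] unfolding \<psi>hat_def c_def by simp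
  then have "AE p in lebesgue. matrix_exp (mat (\<i> * complex_of_real t) ** dirac_symbol \<alpha> \<beta> m p) *v fourier \<psi> p = \<Psi> t p"
    by eventually_elim (simp add: \<Psi>_def)
  from inv_fourier_AE[OF this \<Psi>_meas \<Psi>_L2 g] show thesis
    using that[OF g] unfolding dirac_evolution_def c_def by blast
qed

lemma vanish_of_decays:
  assumes e: "norm e = 1" and dec: "flow_decays e t a" and g: "l2_ftrans 1 (\<lambda>p. \<Psi> t p $ i) g"
  shows "AE x in lborel. x \<bullet> e \<le> a \<longrightarrow> g x = 0"
proof -
  interpret dirac_flow \<alpha> \<beta> m e "\<Phi> e" R B by (rule flow[OF e])
  obtain C k where C: "C \<ge> 0" and Cb: "\<And>p w. p \<bullet> e = 0 \<Longrightarrow> Im w \<le> 0 \<Longrightarrow> norm (F t p w) \<le> growth C k p w * exp (a * Im w)"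
    using dec unfolding decays_def by metis
  obtain C0 k0 where C0: "C0 \<ge> 0" and C0b: "\<And>p w. p \<bullet> e = 0 \<Longrightarrow> norm (F t p w) \<le> growth C0 k0 p w * exp ((R + \<bar>t\<bar>) * \<bar>Im w\<bar>)"
    using F_apriori by metis
  define L where "L = exp (R + \<bar>t\<bar> + \<bar>a\<bar>)"
  define C' where "C' = C + (C0 * L + C0)"
  have L: "L > 0" by (simp add: L_def)
  have C': "C' \<ge> 0" using C C0 L by (simp add: C'_def)
  \<comment> \<open>\<open>decays\<close> speaks of Im w \<le> 0, the half-space criterion of Im w
    \<le> 1. For 0 < Im w \<le> 1 the a priori exponential is at most L exp(a Im w).\<close>
  have b: "norm (F t p w) \<le> growth C' (k + k0) p w * exp (a * Im w)" if p: "p \<bullet> e = 0" and w: "Im w \<le> 1" for p w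
  proof (cases "Im w \<le> 0")
    case True
    show ?thesis
      by (rule order_trans[OF Cb[OF p True]])
        (intro mult_right_mono growth_mono, use C C0 L in \<open>auto simp: C'_def\<close>)
  next
    case False
    have "(R + \<bar>t\<bar>) * \<bar>Im w\<bar> \<le> (R + \<bar>t\<bar>) * 1" using w False R by (intro mult_left_mono) auto
    moreover have "- (a * Im w) \<le> \<bar>a\<bar> * 1"
    proof -
      have "- (a * Im w) \<le> \<bar>a\<bar> * \<bar>Im w\<bar>" by (metis abs_ge_minus_self abs_mult)
      also have "\<dots> \<le> \<bar>a\<bar> * 1" using w False by (intro mult_left_mono) auto
      finally show ?thesis .
    qed
    ultimately have "(R + \<bar>t\<bar>) * \<bar>Im w\<bar> \<le> (R + \<bar>t\<bar> + \<bar>a\<bar>) + a * Im w" by simp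
    then have le: "exp ((R + \<bar>t\<bar>) * \<bar>Im w\<bar>) \<le> L * exp (a * Im w)" by (simp add: L_def exp_add[symmetric])
    have "norm (F t p w) \<le> growth C0 k0 p w * (L * exp (a * Im w))"
      using order_trans[OF C0b[OF p] mult_left_mono[OF le growth_nonneg[OF C0]]] .
    also have "\<dots> = (C0 * L) * (1 + norm w) ^ k0 * exp (C0 * norm p) * exp (a * Im w)" by (simp add: growth_def)
    also have "\<dots> \<le> growth (C0 * L + C0) k0 p w * exp (a * Im w)"
      unfolding growth_def using C0 L by (intro mult_mono) (auto intro!: mult_right_mono)
    also have "\<dots> \<le> growth C' (k + k0) p w * exp (a * Im w)"
      using C C0 L by (intro mult_right_mono growth_mono) (auto simp: C'_def)
    finally show ?thesis .
  qed
  interpret H: halfspace_extension e "\<lambda>p w. F t p w $ i" C' a "k + k0"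
  proof
    show "norm e = 1" by (rule e)
    show "C' \<ge> 0" by (rule C')
    show "(\<lambda>w. F t p w $ i) holomorphic_on UNIV" for p by (rule F_hol)
    show "F t (p + s *\<^sub>R e) w $ i = F t p (w + of_real s) $ i" for p s w by (simp add: F_shift)
    show "(\<lambda>p. F t p w $ i) \<in> borel_measurable borel" for w
      by (rule borel_measurable_continuous_onI[OF F_cont[OF e]])
    fix p w assume w: "Im w \<le> 1"
    \<comment> \<open>Each momentum is moved along e to its orthogonal part, where the estimate is
      available.\<close>
    have "F t p w = F t (perp e p) (w + of_real (p \<bullet> e))"
      using F_shift[of t "perp e p" "p \<bullet> e" w] by (simp add: perp_def)
    then have "norm (F t p w $ i) \<le> norm (F t (perp e p) (w + of_real (p \<bullet> e)))"
      by (simp add: Finite_Cartesian_Product.norm_nth_le)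
    also have "\<dots> \<le> growth C' (k + k0) (perp e p) (w + of_real (p \<bullet> e)) * exp (a * Im (w + of_real (p \<bullet> e)))"
      using w by (intro b inner_perp e) simp
    finally show "norm (F t p w $ i) \<le> C' * (1 + norm (w + of_real (p \<bullet> e))) ^ (k + k0) * exp (C' * norm (perp e p)) * exp (a * Im w)"
      by (simp add: growth_def)
  qed
  show ?thesis
    using H.l2_ftrans_halfspace[of g] g \<Psi>_L2[of t i] by (simp add: F_eq_\<Psi>[OF e])
qed

lemma decays_apriori:
  assumes e: "norm e = 1"
  shows "flow_decays e t (- (R + \<bar>t\<bar>))"
proof -
  interpret dirac_flow \<alpha> \<beta> m e "\<Phi> e" R B by (rule flow[OF e])
  obtain C0 k0 where C0: "C0 \<ge> 0" and C0b: "\<And>p w. p \<bullet> e = 0 \<Longrightarrow> norm (F t p w) \<le> growth C0 k0 p w * exp ((R + \<bar>t\<bar>) * \<bar>Im w\<bar>)"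
    using F_apriori by metis
  show ?thesis
    unfolding decays_def
  proof (intro exI[of _ C0] conjI C0 exI[of _ k0] allI impI)
    fix p w assume pw: "p \<bullet> e = 0" "Im w \<le> 0"
    have "(R + \<bar>t\<bar>) * \<bar>Im w\<bar> = - (R + \<bar>t\<bar>) * Im w" unfolding abs_of_nonpos[OF pw(2)] by (rule minus_mult_commute[symmetric])
    then show "norm (F t p w) \<le> growth C0 k0 p w * exp (- (R + \<bar>t\<bar>) * Im w)"
      using C0b[OF pw(1), of w] by (simp only:)
  qed
qed

text \<open>The half-space criterion for the axes and their opposites confines the state to a cube
  of half-width R + |t|; the factor 3 comes from bounding the Euclidean norm by the sum of three
  coordinates.\<close>

lemma bounded_support:
  assumes g: "l2_ftrans 1 (\<lambda>p. \<Psi> t p $ i) g"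
  shows "AE x in lborel. norm x > 3 * (R + \<bar>t\<bar>) \<longrightarrow> g x = 0"
proof -
  have "AE x in lborel. x \<bullet> (s *\<^sub>R axis j 1) \<le> - (R + \<bar>t\<bar>) \<longrightarrow> g x = 0" if "\<bar>s\<bar> = 1" for s :: real and j :: 3
    using that by (intro vanish_of_decays[OF _ decays_apriori g]) auto
  from this[of 1] this[of "-1"]
  have "\<forall>j::3. AE x in lborel. (x $ j \<le> - (R + \<bar>t\<bar>) \<longrightarrow> g x = 0) \<and> (- x $ j \<le> - (R + \<bar>t\<bar>) \<longrightarrow> g x = 0)"
    by (auto simp: inner_axis AE_conj_iff)
  then have "AE x in lborel. \<forall>j::3. (x $ j \<le> - (R + \<bar>t\<bar>) \<longrightarrow> g x = 0) \<and> (- x $ j \<le> - (R + \<bar>t\<bar>) \<longrightarrow> g x = 0)"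
    unfolding AE_all_countable .
  then show ?thesis
  proof eventually_elim
    case (elim x)
    show ?case
    proof (intro impI, rule ccontr)
      assume n: "norm x > 3 * (R + \<bar>t\<bar>)" and "g x \<noteq> 0"
      then have "\<bar>x $ j\<bar> \<le> R + \<bar>t\<bar>" for j using elim[rule_format, of j] by (auto simp: abs_if)
      then have "(\<Sum>j\<in>UNIV. \<bar>x $ j\<bar>) \<le> (\<Sum>j\<in>(UNIV::3 set). R + \<bar>t\<bar>)" by (intro sum_mono)
      then show False using norm_le_l1_cart[of x] n by simp
    qed
  qed
qed

text \<open>From support to decay. Bounded support makes the evolved state integrable, so its
  transform extends along complex lines and must coincide with the continuation F; the exponential
  weight is then estimated directly on the half space x \<bullet> e > a.\<close>

lemma decays_of_vanish:
  assumes e: "norm e = 1" and g: "\<And>i. l2_ftrans 1 (\<lambda>p. \<Psi> t p $ i) (g i)"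
    and van: "\<And>i. AE x in lborel. x \<bullet> e \<le> a \<longrightarrow> g i x = 0"
  shows "flow_decays e t a"
proof -
  interpret dirac_flow \<alpha> \<beta> m e "\<Phi> e" R B by (rule flow[OF e])
  define \<rho> where "\<rho> = 3 * (R + \<bar>t\<bar>)"
  \<comment> \<open>A version of g i that is zero at every point outside the ball or the half space,
    not just almost everywhere.\<close>
  define h where "h i x = (if norm x \<le> \<rho> \<and> a < x \<bullet> e then g i x else 0)" for i x
  have gm[measurable]: "g i \<in> borel_measurable borel" for i using g[of i] by (simp add: l2_ftrans_def)
  have hm[measurable]: "h i \<in> borel_measurable borel" for i unfolding h_def by measurable
  have hg: "AE x in lborel. g i x = h i x" for i
    using van[of i] bounded_support[OF g, of i]
    by eventually_elim (auto simp: h_def \<rho>_def not_less not_le)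
  have hl: "l2_ftrans 1 (\<lambda>p. \<Psi> t p $ i) (h i)" for i
  proof -
    have "(\<integral>\<^sup>+x. ennreal ((norm (ftrans 1 (trunc n (\<lambda>p. \<Psi> t p $ i)) x - g i x))\<^sup>2) \<partial>lborel)
        = (\<integral>\<^sup>+x. ennreal ((norm (ftrans 1 (trunc n (\<lambda>p. \<Psi> t p $ i)) x - h i x))\<^sup>2) \<partial>lborel)" for n
      by (rule nn_integral_cong_AE) (use hg[of i] in eventually_elim, simp)
    then show ?thesis using g[of i] by (simp add: l2_ftrans_def)
  qed
  have hint: "integrable lborel (h i)" for i
  proof -
    obtain n :: nat where n: "real n \<ge> \<rho>" using real_arch_simple by blast
    have "trunc n (h i) = h i" using n by (force simp: trunc_def indicator_def h_def)
    moreover have "(\<integral>\<^sup>+x. ennreal ((norm (h i x))\<^sup>2) \<partial>lborel) < \<infinity>"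
      by (rule l2_ftrans_L2[OF \<Psi>_meas \<Psi>_L2 _ hl]) simp
    ultimately show ?thesis using integrable_trunc[OF hm, of i n] by simp
  qed
  define K where "K = plancherel_const TYPE(real^3)"
  have K: "K > 0" unfolding K_def by (rule plancherel_const_pos)
  obtain M where M: "\<And>t p i. norm (\<Psi> t p $ i) \<le> M" using \<Psi>_bounded by metis
  \<comment> \<open>Both transforms lack the normalising factor, so Plancherel's constant (2 pi)^3
    survives; it is divided out in \<open>N\<close>.\<close>
  have inv: "ftrans (-1) (h i) p = of_real K * \<Psi> t p $ i" for i p
    unfolding K_def by (rule l2_ftrans_inversion[OF \<Psi>_cont M \<Psi>_L2 _ hl hint]) simp
  \<comment> \<open>Both sides are entire in w and agree for real w, where w just moves p along
    e.\<close>
  have line: "ftrans (-1) (\<lambda>x. exp (- \<i> * w * of_real (e \<bullet> x)) * h i x) p = of_real K * F t p w $ i" for i p w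
  proof (rule entire_eq_of_eq_on_reals[of "\<lambda>w. ftrans (-1) (\<lambda>x. exp (- \<i> * w * of_real (e \<bullet> x)) * h i x) p" "\<lambda>w. of_real K * F t p w $ i"])
    show "(\<lambda>w. ftrans (-1) (\<lambda>x. exp (- \<i> * w * of_real (e \<bullet> x)) * h i x) p) holomorphic_on UNIV"
      by (rule holomorphic_on_ftrans_line[OF hint _ e, of \<rho>]) (simp add: h_def)
    show "(\<lambda>w. of_real K * F t p w $ i) holomorphic_on UNIV" by (intro holomorphic_intros F_hol)
    fix s :: real
    have "cis (- 1 * ((p + s *\<^sub>R e) \<bullet> x)) * y = cis (- 1 * (p \<bullet> x)) * (exp (- \<i> * of_real s * of_real (e \<bullet> x)) * y)" for x y
      unfolding cis_conv_exp mult.assoc[symmetric] exp_add[symmetric] by (simp add: inner_add_left algebra_simps)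
    then have "ftrans (-1) (\<lambda>x. exp (- \<i> * of_real s * of_real (e \<bullet> x)) * h i x) p = ftrans (-1) (h i) (p + s *\<^sub>R e)"
      unfolding ftrans_def by (simp only:)
    also have "\<dots> = of_real K * F t p (of_real s) $ i"
      using F_shift[of t p s 0] by (simp add: inv F_eq_\<Psi>[OF e, symmetric])
    finally show "ftrans (-1) (\<lambda>x. exp (- \<i> * of_real s * of_real (e \<bullet> x)) * h i x) p = of_real K * F t p (of_real s) $ i" .
  qed
  define N where "N i = (\<integral>x. norm (h i x) \<partial>lborel) / K" for i
  have N: "N i \<ge> 0" for i using K by (simp add: N_def)
  have comp: "norm (F t p w $ i) \<le> N i * exp (a * Im w)" if w: "Im w \<le> 0" for p w i
  proof -
    have pt: "norm (exp (- \<i> * w * of_real (e \<bullet> x)) * h i x) \<le> exp (a * Im w) * norm (h i x)" for x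
    proof (cases "a < x \<bullet> e")
      case True
      \<comment> \<open>Multiplication by Im w \<le> 0 reverses a < x \<bullet> e; this is why the
        lower half plane detects the half space above the level a.\<close>
      have "(e \<bullet> x) * Im w \<le> a * Im w" using True w by (intro mult_right_mono_neg) (auto simp: inner_commute)
      then have "Im w * (e \<bullet> x) \<le> a * Im w" by (simp only: mult.commute)
      then show ?thesis by (simp add: norm_mult mult_right_mono)
    qed (simp add: h_def)
    have i2: "integrable lborel (\<lambda>x. exp (a * Im w) * norm (h i x))" using hint by auto
    have i1: "integrable lborel (\<lambda>x. exp (- \<i> * w * of_real (e \<bullet> x)) * h i x)"
    proof (rule Bochner_Integration.integrable_bound[OF i2])
      show "(\<lambda>x. exp (- \<i> * w * of_real (e \<bullet> x)) * h i x) \<in> borel_measurable lborel" by measurable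
      show "AE x in lborel. norm (exp (- \<i> * w * of_real (e \<bullet> x)) * h i x) \<le> norm (exp (a * Im w) * norm (h i x))"
        using pt by (auto intro!: AE_I2)
    qed
    have "K * norm (F t p w $ i) = norm (ftrans (-1) (\<lambda>x. exp (- \<i> * w * of_real (e \<bullet> x)) * h i x) p)"
      unfolding line using K by (simp add: norm_mult)
    also have "\<dots> \<le> (\<integral>x. norm (exp (- \<i> * w * of_real (e \<bullet> x)) * h i x) \<partial>lborel)" by (rule norm_ftrans_le)
    also have "\<dots> \<le> (\<integral>x. exp (a * Im w) * norm (h i x) \<partial>lborel)"
      by (intro integral_mono integrable_norm i1 i2 pt)
    also have "\<dots> = K * (N i * exp (a * Im w))" using K by (simp add: N_def)
    finally show ?thesis using K by simp
  qed
  define S where "S = (\<Sum>i\<in>UNIV. N i)"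
  have S: "S \<ge> 0" unfolding S_def by (intro sum_nonneg N)
  show ?thesis
    unfolding decays_def
  proof (intro exI[of _ S] conjI S exI[of _ 0] allI impI)
    fix p w assume w: "Im w \<le> 0"
    have "norm (F t p w) \<le> (\<Sum>i\<in>UNIV. norm (F t p w $ i))"
      unfolding norm_vec_def by (rule L2_set_le_sum) simp
    also have "\<dots> \<le> (\<Sum>i\<in>UNIV. N i * exp (a * Im w))" by (intro sum_mono comp w)
    also have "\<dots> = S * 1 * exp (a * Im w)" by (simp add: S_def sum_distrib_right)
    also have "\<dots> \<le> growth S 0 p w * exp (a * Im w)"
      unfolding growth_def using S by (intro mult_right_mono mult_mono) auto
    finally show "norm (F t p w) \<le> growth S 0 p w * exp (a * Im w)" .
  qed
qed

lemma vanishes_below_iff_decays: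
  assumes e: "norm e = 1"
  shows "vanishes_below e (dirac_evolution \<alpha> \<beta> m t \<psi>) (ereal a) \<longleftrightarrow> flow_decays e t a"
proof -
  obtain g where g: "\<And>i. l2_ftrans 1 (\<lambda>p. \<Psi> t p $ i) (g i)"
    and ev: "AE x in lebesgue. dirac_evolution \<alpha> \<beta> m t \<psi> x = (\<chi> i. of_real c * g i x)"
    using evolution[of t] by blast
  show ?thesis
  proof
    assume "vanishes_below e (dirac_evolution \<alpha> \<beta> m t \<psi>) (ereal a)"
    then have "AE x in lebesgue. x \<bullet> e \<le> a \<longrightarrow> dirac_evolution \<alpha> \<beta> m t \<psi> x = 0" by (simp add: vanishes_below_iff)
    then have "AE x in lebesgue. x \<bullet> e \<le> a \<longrightarrow> g i x = 0" for i
      using ev by eventually_elim (use c_pos in \<open>auto simp: vec_eq_iff\<close>)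
    then have "AE x in lborel. x \<bullet> e \<le> a \<longrightarrow> g i x = 0" for i by (simp add: AE_completion_iff)
    then show "flow_decays e t a" by (rule decays_of_vanish[OF e g])
  next
    assume "flow_decays e t a"
    then have "\<forall>i. AE x in lborel. x \<bullet> e \<le> a \<longrightarrow> g i x = 0" using vanish_of_decays[OF e _ g] by blast
    then have "AE x in lborel. \<forall>i. x \<bullet> e \<le> a \<longrightarrow> g i x = 0" unfolding AE_all_countable .
    then have "AE x in lebesgue. \<forall>i. x \<bullet> e \<le> a \<longrightarrow> g i x = 0" by (rule AE_completion)
    then have "AE x in lebesgue. x \<bullet> e \<le> a \<longrightarrow> dirac_evolution \<alpha> \<beta> m t \<psi> x = 0"
      using ev by eventually_elim (auto simp: vec_eq_iff)
    then show "vanishes_below e (dirac_evolution \<alpha> \<beta> m t \<psi>) (ereal a)" by (simp add: vanishes_below_iff)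
  qed
qed

theorem support_edge_linear:
  assumes e: "norm e = 1" and t: "t \<ge> 2 * R"
  shows "support_edge e (dirac_evolution \<alpha> \<beta> m t \<psi>)
    = support_edge e (dirac_evolution \<alpha> \<beta> m (2 * R) \<psi>) - ereal (t - 2 * R)"
proof (rule support_edge_shift[OF e])
  interpret dirac_flow \<alpha> \<beta> m e "\<Phi> e" R B by (rule flow[OF e])
  fix a :: real
  \<comment> \<open>Both t and 2 R are admissible target times, and level plus time is a + t on
    either side.\<close>
  have "decays t a \<longleftrightarrow> decays (2 * R) (a + (t - 2 * R))"
    using decays_transfer[of t a "2 * R" "a + (t - 2 * R)"] decays_transfer[of "2 * R" "a + (t - 2 * R)" t a] t R
    by auto
  then show "vanishes_below e (dirac_evolution \<alpha> \<beta> m t \<psi>) (ereal a)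
      \<longleftrightarrow> vanishes_below e (dirac_evolution \<alpha> \<beta> m (2 * R) \<psi>) (ereal (a + (t - 2 * R)))"
    unfolding vanishes_below_iff_decays[OF e] .
qed

end

text \<open>Localization allows a Borel version to be cut off by the indicator of the ball while it
  still agrees with \<psi> almost everywhere.\<close>

lemma localized_wave_exists:
  assumes "m > 0" "dirac_matrices \<alpha> \<beta>" "R > 0" and sq: "square_integrable \<psi>" and loc: "localized_in \<psi> (cball 0 R)"
  obtains \<psi>1 where "localized_wave \<alpha> \<beta> m R \<psi> \<psi>1"
proof -
  obtain g where g: "g \<in> borel_measurable borel" "AE x in lebesgue. \<psi> x = g x"
    using sq lebesgue_ex_borel_version unfolding square_integrable_def by blast
  define \<psi>1 where "\<psi>1 x = indicat_real (cball 0 R) x *\<^sub>R g x" for x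
  have m1: "\<psi>1 \<in> borel_measurable borel"
    unfolding \<psi>1_def using g(1) by (intro borel_measurable_scaleR borel_measurable_indicator borel_closed closed_cball)
  have ae: "AE x in lebesgue. \<psi> x = \<psi>1 x"
    using g(2) loc[unfolded localized_in_def] by eventually_elim (simp add: \<psi>1_def)
  have "integrable lebesgue (\<lambda>x. (norm (\<psi> x))\<^sup>2)" using sq by (simp add: square_integrable_def)
  then have "(\<integral>\<^sup>+x. ennreal ((norm (\<psi> x))\<^sup>2) \<partial>lebesgue) < \<infinity>"
    by (simp add: integrable_iff_bounded)
  also have "(\<integral>\<^sup>+x. ennreal ((norm (\<psi> x))\<^sup>2) \<partial>lebesgue) = (\<integral>\<^sup>+x. ennreal ((norm (\<psi>1 x))\<^sup>2) \<partial>lebesgue)"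
    by (rule nn_integral_cong_AE) (use ae in eventually_elim, simp)
  finally have fin: "(\<integral>\<^sup>+x. ennreal ((norm (\<psi>1 x))\<^sup>2) \<partial>lborel) < \<infinity>" by (simp add: nn_integral_completion)
  have "localized_wave \<alpha> \<beta> m R \<psi> \<psi>1"
  proof
    show "(\<lambda>x. \<psi>1 x $ i) \<in> borel_measurable borel" for i by (rule borel_measurable_vec_nth[OF m1])
    show "(\<integral>\<^sup>+x. ennreal ((norm (\<psi>1 x $ i))\<^sup>2) \<partial>lborel) < \<infinity>" for i
      by (rule le_less_trans[OF nn_integral_mono fin])
        (intro ennreal_leI power_mono Finite_Cartesian_Product.norm_nth_le norm_ge_zero)
    show "\<psi>1 x = 0" if "norm x > R" for x using that by (simp add: \<psi>1_def)
  qed (use assms ae in auto)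
  then show thesis using that by blast
qed

text \<open>Time reversal: changing the sign of all Dirac matrices changes the sign of \<open>H\<close>.\<close>

lemma dirac_matrices_uminus:
  assumes "dirac_matrices \<alpha> \<beta>"
  shows "dirac_matrices (\<lambda>k. - \<alpha> k) (- \<beta>)"
proof -
  have mm: "(- A) ** (- B) = A ** B" for A B :: "complex^4^4"
    by (simp add: vec_eq_iff matrix_matrix_mult_def)
  have "hermitian (- A)" if "hermitian A" for A :: "complex^4^4"
    unfolding hermitian_def
  proof (intro allI)
    fix i j
    have "A $ i $ j = cnj (A $ j $ i)" using that unfolding hermitian_def by blast
    then show "(- A) $ i $ j = cnj ((- A) $ j $ i)" by simp
  qed
  then show ?thesis using assms unfolding dirac_matrices_def mm by blast
qed

lemma dirac_evolution_uminus:
  "dirac_evolution (\<lambda>k. - \<alpha> k) (- \<beta>) m (- t) \<psi> = dirac_evolution \<alpha> \<beta> m t \<psi>"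
proof -
  have "dirac_symbol (\<lambda>k. - \<alpha> k) (- \<beta>) m p = - dirac_symbol \<alpha> \<beta> m p" for p
    by (simp add: dirac_symbol_def sum_negf)
  moreover have "mat (- z) ** (- A) = mat z ** A" for z and A :: "complex^4^4"
    by (simp add: vec_eq_iff matrix_matrix_mult_def mat_def if_distrib[where f = "\<lambda>x. x * _"] sum_negf cong: if_cong)
  ultimately show ?thesis unfolding dirac_evolution_def by simp
qed

theorem mainTheorem3:
  fixes \<alpha> :: "3 \<Rightarrow> complex^4^4" and \<beta> :: "complex^4^4" and m R :: real
    and \<psi> :: "real^3 \<Rightarrow> complex^4" and e :: "real^3"
  assumes "m > 0" and "dirac_matrices \<alpha> \<beta>"
    and "R > 0"
    and "square_integrable \<psi>" and "\<not> (AE x in lebesgue. \<psi> x = 0)"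
    and "localized_in \<psi> (cball 0 R)"
    and "norm e = 1"
  shows "(\<forall>t\<ge>2 * R. support_edge e (dirac_evolution \<alpha> \<beta> m t \<psi>)
             = support_edge e (dirac_evolution \<alpha> \<beta> m (2 * R) \<psi>) + ereal (2 * R) - ereal t) \<and>
         (\<forall>t\<le>- 2 * R. support_edge e (dirac_evolution \<alpha> \<beta> m t \<psi>)
             = support_edge e (dirac_evolution \<alpha> \<beta> m (- 2 * R) \<psi>) + ereal (2 * R) + ereal t)"
proof (intro conjI allI impI)
  \<comment> \<open>Regrouping in the extended reals goes by cases, as \<open>support_edge\<close>
    is formed there; the shifts are finite.\<close>
  have sub: "x - ereal (t - 2 * R) = x + ereal (2 * R) - ereal t" for x t by (cases x) auto
  obtain \<psi>1 where "localized_wave \<alpha> \<beta> m R \<psi> \<psi>1"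
    by (rule localized_wave_exists[OF assms(1,2,3,4,6)])
  then interpret localized_wave \<alpha> \<beta> m R \<psi> \<psi>1 .
  fix t assume "t \<ge> 2 * R"
  from support_edge_linear[OF assms(7) this]
  show "support_edge e (dirac_evolution \<alpha> \<beta> m t \<psi>)
      = support_edge e (dirac_evolution \<alpha> \<beta> m (2 * R) \<psi>) + ereal (2 * R) - ereal t"
    unfolding sub .
next
  have sub: "x - ereal (- t - 2 * R) = x + ereal (2 * R) + ereal t" for x t by (cases x) auto
  obtain \<psi>1 where "localized_wave (\<lambda>k. - \<alpha> k) (- \<beta>) m R \<psi> \<psi>1"
    by (rule localized_wave_exists[OF assms(1) dirac_matrices_uminus[OF assms(2)] assms(3,4,6)])
  \<comment> \<open>For the opposite Dirac matrices, time -t of the new flow is time t of the old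
    one. The mass stays positive, its sign being carried by \<beta>.\<close>
  then interpret localized_wave "\<lambda>k. - \<alpha> k" "- \<beta>" m R \<psi> \<psi>1 .
  fix t :: real assume "t \<le> - 2 * R"
  then have "- t \<ge> 2 * R" by simp
  have reversed: "dirac_evolution (\<lambda>k. - \<alpha> k) (- \<beta>) m (2 * R) \<psi> = dirac_evolution \<alpha> \<beta> m (- 2 * R) \<psi>"
    using dirac_evolution_uminus[of \<alpha> \<beta> m "- 2 * R" \<psi>] by simp
  from support_edge_linear[OF assms(7) \<open>- t \<ge> 2 * R\<close>]
  show "support_edge e (dirac_evolution \<alpha> \<beta> m t \<psi>)
      = support_edge e (dirac_evolution \<alpha> \<beta> m (- 2 * R) \<psi>) + ereal (2 * R) + ereal t"
    unfolding sub dirac_evolution_uminus reversed .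
qed

end
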